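(* Let $L$ be a differential graded Lie algebra over $\mathbb{Q}$, let $H=H_*(L)$, let $k\ge 2$, and let $x_1,\dots,x_k\in H$ be homogeneous classes such that the higher Whitehead bracket set $[x_1,\dots,x_k]\subseteq H$ (formed in $L$) is non-empty. Denote by $[-,\dots,-]'$ the higher order Whitehead bracket sets of $H$, where $H$ is regarded as a differential graded Lie algebra with trivial differential and the Lie bracket induced from $L$. Then $L$ is not formal if one of the following conditions holds: (1) $0\notin [x_1,\dots,x_k]$. (2) The sets $[x_1,\dots,x_k]$ and $[x_1,\dots,x_k]'$ are not bijective.
   Context: All vector spaces are over $\mathbb{Q}$ and $\mathbb{Z}$-graded; a differential graded Lie algebra (DGL) has a differential $\partial$ of degree $-1$. No boundedness is assumed. A DGL $L$ is formal if it is connected by a zig-zag of DGL quasi-isomorphisms to $H_*(L)$ equipped with zero differential and the induced bracket. Higher Whitehead brackets. Fix $k\ge2$ and integers $n_1,\dots,n_k$, and put $N=n_1+\dots+n_k$. Let $\mathbb{L}(U)$ be the free graded Lie algebra on the graded vector space $U$ with basis $u_{i_1\dots i_s}$, $1\le i_1<\dots<i_s\le k$, $1\le s<k$, of degree $|u_{i_1\dots i_s}|=n_{i_1}+\dots+n_{i_s}-1$, with differential given by $\partial u_i=0$ and, for $s\ge 2$, $$\partial u_{i_1\dots i_s}=\sum_{p=1}^{s-1}\ \sum_{\sigma\in \widetilde S(p,s-p)}\varepsilon(\sigma)\,[u_{i_{\sigma(1)}\dots i_{\sigma(p)}},\,u_{i_{\sigma(p+1)}\dots i_{\sigma(s)}}].$$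 Here $\widetilde S(p,s-p)$ is the set of $(p,s-p)$-shuffles $\sigma$ (permutations of $\{1,\dots,s\}$ with $\sigma(1)<\dots<\sigma(p)$ and $\sigma(p+1)<\dots<\sigma(s)$) with $\sigma(1)=1$. The sign $\varepsilon(\sigma)$ is $(-1)^{|u_{i_{\sigma(1)}\dots i_{\sigma(p)}}|}$ times the Koszul sign $e$ determined by $v_{i_1}\cdots v_{i_s}=e\,v_{i_{\sigma(1)}}\cdots v_{i_{\sigma(s)}}$ for graded-commuting variables with $|v_i|=n_i$. Let $w\in\mathbb{L}(U)$ be the cycle of degree $N-2$ given by the right-hand side of the same formula with $s=k$ and $(i_1,\dots,i_k)=(1,\dots,k)$. Given a DGL $L$ and $x_i\in H_{n_i-1}(L)$, let $\varphi:\mathbb{L}(u_1,\dots,u_k)\to L$ send each $u_i$ to a cycle representing $x_i$. The $k$th order Whitehead bracket set $[x_1,\dots,x_k]\subseteq H_{N-2}(L)$ is the (possibly empty) set of homology classes $\overline{\phi(w)}$, where $\phi:\mathbb{L}(U)\to L$ runs over all DGL morphisms extending $\varphi$.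
   Formalization: Condition (1) is asserted only for k ≥ 3: for k = 2 it fails, since a graded Lie algebra with zero differential and a non-zero bracket [x_1,x_2] is formal although 0 is not in the bracket set; condition (2) is kept for all k ≥ 2. *)

theory Defs
  imports
    "HOL-Algebra.Algebraic_Closure_Type"
    "HOL-Algebra.AbelCoset"
    "HOL-Algebra.Module"
    "HOL-Library.Poly_Mapping"
    "HOL-Combinatorics.Permutations"
begin

section \<open>Differential graded Lie algebras over the rationals\<close>

abbreviation rat_field :: "rat ring" where
  "rat_field \<equiv> ring_of_type_algebra"

text \<open>
  A \<open>\<int>\<close>-graded vector space is a family of modules over the field of rationals, indexed by the
  integers. The components may overlap as sets, so the bracket and the differential take the degrees
  of their arguments as parameters. The fields \<open>mult\<close> and \<open>one\<close>, which module records
  inherit from ring records, play no role.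
\<close>

record 'a dg_data =
  piece :: "int \<Rightarrow> (rat, 'a) module"
  bracket :: "int \<Rightarrow> int \<Rightarrow> 'a \<Rightarrow> 'a \<Rightarrow> 'a"
  diff :: "int \<Rightarrow> 'a \<Rightarrow> 'a"

definition linear_map :: "(rat, 'a) module \<Rightarrow> (rat, 'b) module \<Rightarrow> ('a \<Rightarrow> 'b) \<Rightarrow> bool" where
  "linear_map M N f \<longleftrightarrow> f \<in> carrier M \<rightarrow> carrier N \<and>
     (\<forall>a\<in>carrier M. \<forall>b\<in>carrier M. f (a \<oplus>\<^bsub>M\<^esub> b) = f a \<oplus>\<^bsub>N\<^esub> f b) \<and>
     (\<forall>c. \<forall>a\<in>carrier M. f (c \<odot>\<^bsub>M\<^esub> a) = c \<odot>\<^bsub>N\<^esub> f a)"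

locale dgl =
  fixes L :: "'a dg_data"
  assumes vector_space: "module rat_field (piece L n)"
    and bracket_linear_right: "a \<in> carrier (piece L m) \<Longrightarrow>
      linear_map (piece L n) (piece L (m + n)) (\<lambda>b. bracket L m n a b)"
    and bracket_linear_left: "b \<in> carrier (piece L n) \<Longrightarrow>
      linear_map (piece L m) (piece L (m + n)) (\<lambda>a. bracket L m n a b)"
    and antisymmetry: "a \<in> carrier (piece L m) \<Longrightarrow> b \<in> carrier (piece L n) \<Longrightarrow>
      bracket L m n a b = (- ((-1) powi (m * n))) \<odot>\<^bsub>piece L (m + n)\<^esub> bracket L n m b a"
    and jacobi: "a \<in> carrier (piece L l) \<Longrightarrow> b \<in> carrier (piece L m) \<Longrightarrow>
      c \<in> carrier (piece L n) \<Longrightarrow>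
      bracket L l (m + n) a (bracket L m n b c) =
        bracket L (l + m) n (bracket L l m a b) c \<oplus>\<^bsub>piece L (l + m + n)\<^esub>
        ((-1) powi (l * m)) \<odot>\<^bsub>piece L (l + m + n)\<^esub>
          bracket L m (l + n) b (bracket L l n a c)"
    and diff_linear: "linear_map (piece L n) (piece L (n - 1)) (diff L n)"
    and diff_diff: "a \<in> carrier (piece L n) \<Longrightarrow> diff L (n - 1) (diff L n a) = \<zero>\<^bsub>piece L (n - 2)\<^esub>"
    and leibniz: "a \<in> carrier (piece L m) \<Longrightarrow> b \<in> carrier (piece L n) \<Longrightarrow>
      diff L (m + n) (bracket L m n a b) =
        bracket L (m - 1) n (diff L m a) b \<oplus>\<^bsub>piece L (m + n - 1)\<^esub>
        ((-1) powi m) \<odot>\<^bsub>piece L (m + n - 1)\<^esub> bracket L m (n - 1) a (diff L n b)"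

definition dgl_hom :: "'a dg_data \<Rightarrow> 'b dg_data \<Rightarrow> (int \<Rightarrow> 'a \<Rightarrow> 'b) \<Rightarrow> bool" where
  "dgl_hom L M f \<longleftrightarrow>
     (\<forall>n. linear_map (piece L n) (piece M n) (f n)) \<and>
     (\<forall>m n. \<forall>a\<in>carrier (piece L m). \<forall>b\<in>carrier (piece L n).
        f (m + n) (bracket L m n a b) = bracket M m n (f m a) (f n b)) \<and>
     (\<forall>n. \<forall>a\<in>carrier (piece L n). f (n - 1) (diff L n a) = diff M n (f n a))"

section \<open>Quotients and homology\<close>

definition quot_module :: "(rat, 'a) module \<Rightarrow> 'a set \<Rightarrow> (rat, 'a set) module" where
  "quot_module M B =
     \<lparr>carrier = a_rcosets\<^bsub>M\<^esub> B, monoid.mult = undefined, one = undefined, zero = B, add = (<+>\<^bsub>M\<^esub>),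
      module.smult = (\<lambda>c A. \<Union>a\<in>A. B +>\<^bsub>M\<^esub> (c \<odot>\<^bsub>M\<^esub> a))\<rparr>"

text \<open>
  When \<open>B\<close> is a graded ideal stable under the differential, all cosets united below coincide, and
  the unions are the induced operations.
\<close>

definition dg_quot :: "'a dg_data \<Rightarrow> (int \<Rightarrow> 'a set) \<Rightarrow> 'a set dg_data" where
  "dg_quot L B =
     \<lparr>piece = (\<lambda>n. quot_module (piece L n) (B n)),
      bracket = (\<lambda>m n A C. \<Union>a\<in>A. \<Union>c\<in>C. B (m + n) +>\<^bsub>piece L (m + n)\<^esub> bracket L m n a c),
      diff = (\<lambda>n A. \<Union>a\<in>A. B (n - 1) +>\<^bsub>piece L (n - 1)\<^esub> diff L n a)\<rparr>"

definition cycles :: "'a dg_data \<Rightarrow> int \<Rightarrow> 'a set" where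
  "cycles L n = {a \<in> carrier (piece L n). diff L n a = \<zero>\<^bsub>piece L (n - 1)\<^esub>}"

definition boundaries :: "'a dg_data \<Rightarrow> int \<Rightarrow> 'a set" where
  "boundaries L n = diff L (n + 1) ` carrier (piece L (n + 1))"

definition homology_class :: "'a dg_data \<Rightarrow> int \<Rightarrow> 'a \<Rightarrow> 'a set" where
  "homology_class L n a = boundaries L n +>\<^bsub>piece L n\<^esub> a"

definition cycle_algebra :: "'a dg_data \<Rightarrow> 'a dg_data" where
  "cycle_algebra L = L\<lparr>piece := (\<lambda>n. (piece L n)\<lparr>carrier := cycles L n\<rparr>)\<rparr>"

definition homology :: "'a dg_data \<Rightarrow> 'a set dg_data" where
  "homology L = (dg_quot (cycle_algebra L) (boundaries L))
     \<lparr>diff := (\<lambda>n A. \<zero>\<^bsub>quot_module (piece L (n - 1)) (boundaries L (n - 1))\<^esub>)\<rparr>"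

definition homology_map ::
    "'b dg_data \<Rightarrow> (int \<Rightarrow> 'a \<Rightarrow> 'b) \<Rightarrow> int \<Rightarrow> 'a set \<Rightarrow> 'b set" where
  "homology_map M f n A = (\<Union>a\<in>A. homology_class M n (f n a))"

definition quasi_iso :: "'a dg_data \<Rightarrow> 'b dg_data \<Rightarrow> (int \<Rightarrow> 'a \<Rightarrow> 'b) \<Rightarrow> bool" where
  "quasi_iso L M f \<longleftrightarrow> dgl_hom L M f \<and>
     (\<forall>n. bij_betw (homology_map M f n)
        (carrier (piece (homology L) n)) (carrier (piece (homology M) n)))"

section \<open>Formality\<close>

definition quasi_iso_step :: "'a dg_data \<Rightarrow> 'b dg_data \<Rightarrow> bool" where
  "quasi_iso_step L M \<longleftrightarrow> dgl L \<and> dgl M \<and> (\<exists>f. quasi_iso L M f)"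

text \<open>
  The type argument is the universe in which the intermediate algebras of the zig-zag live. Since
  components are given by carriers, finitely many algebras on different types can be transported
  to one common type; quantifying over all types therefore loses no zig-zag. In particular
  \<open>L\<close> is not formal if and only if \<open>\<not> formal TYPE('m) L\<close> holds for every type \<open>'m\<close>. Zig-zags with
  fewer than two intermediate algebras are covered by inserting identities.
\<close>

definition formal :: "'m itself \<Rightarrow> 'a dg_data \<Rightarrow> bool" where
  "formal (_ :: 'm itself) L \<longleftrightarrow>
     (\<exists>M M' :: 'm dg_data.
        (quasi_iso_step L M \<or> quasi_iso_step M L) \<and>
        equivclp quasi_iso_step M M' \<and>
        (quasi_iso_step M' (homology L) \<or> quasi_iso_step (homology L) M'))"

section \<open>Free graded Lie algebras\<close>

text \<open>
  The free graded Lie algebra on a graded vector space with basis \<open>G\<close> is the free non-associative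
  algebra on \<open>G\<close>, whose basis consists of the bracketed words below, modulo the ideal generated by
  the graded antisymmetry and Jacobi relations.
\<close>

datatype 'g word = Gen 'g | Br "'g word" "'g word"

primrec word_deg :: "('g \<Rightarrow> int) \<Rightarrow> 'g word \<Rightarrow> int" where
  "word_deg gdeg (Gen g) = gdeg g"
| "word_deg gdeg (Br s t) = word_deg gdeg s + word_deg gdeg t"

type_synonym 'g word_comb = "'g word \<Rightarrow>\<^sub>0 rat"

definition comb_scale :: "rat \<Rightarrow> 'g word_comb \<Rightarrow> 'g word_comb" where
  "comb_scale c p = Poly_Mapping.map ((*) c) p"

definition comb_mult :: "'g word_comb \<Rightarrow> 'g word_comb \<Rightarrow> 'g word_comb" (infixl \<open>\<star>\<close> 70) where
  "p \<star> q = (\<Sum>s\<in>Poly_Mapping.keys p. \<Sum>t\<in>Poly_Mapping.keys q.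
     Poly_Mapping.single (Br s t) (Poly_Mapping.lookup p s * Poly_Mapping.lookup q t))"

definition comb_piece :: "'g set \<Rightarrow> ('g \<Rightarrow> int) \<Rightarrow> int \<Rightarrow> 'g word_comb set" where
  "comb_piece G gdeg n =
     {p. \<forall>t\<in>Poly_Mapping.keys p. set_word t \<subseteq> G \<and> word_deg gdeg t = n}"

text \<open>The derivation of degree \<open>-1\<close> extending \<open>d\<close>, first on words, then on their combinations.\<close>

primrec word_diff :: "('g \<Rightarrow> int) \<Rightarrow> ('g \<Rightarrow> 'g word_comb) \<Rightarrow> 'g word \<Rightarrow> 'g word_comb" where
  "word_diff gdeg d (Gen g) = d g"
| "word_diff gdeg d (Br s t) =
     word_diff gdeg d s \<star> Poly_Mapping.single t 1 +
     comb_scale ((-1) powi word_deg gdeg s) (Poly_Mapping.single s 1 \<star> word_diff gdeg d t)"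

definition comb_diff :: "('g \<Rightarrow> int) \<Rightarrow> ('g \<Rightarrow> 'g word_comb) \<Rightarrow> 'g word_comb \<Rightarrow> 'g word_comb" where
  "comb_diff gdeg d p =
     (\<Sum>t\<in>Poly_Mapping.keys p. comb_scale (Poly_Mapping.lookup p t) (word_diff gdeg d t))"

definition word_algebra ::
    "'g set \<Rightarrow> ('g \<Rightarrow> int) \<Rightarrow> ('g \<Rightarrow> 'g word_comb) \<Rightarrow> 'g word_comb dg_data" where
  "word_algebra G gdeg d =
     \<lparr>piece = (\<lambda>n. \<lparr>carrier = comb_piece G gdeg n, monoid.mult = undefined, one = undefined,
                   zero = 0, add = (+), module.smult = comb_scale\<rparr>),
      bracket = (\<lambda>m n. (\<star>)),
      diff = (\<lambda>n. comb_diff gdeg d)\<rparr>"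

inductive lie_relation :: "'g set \<Rightarrow> ('g \<Rightarrow> int) \<Rightarrow> int \<Rightarrow> 'g word_comb \<Rightarrow> bool"
  for G gdeg where
  zero: "lie_relation G gdeg n 0"
| add: "lie_relation G gdeg n p \<Longrightarrow> lie_relation G gdeg n q \<Longrightarrow> lie_relation G gdeg n (p + q)"
| scale: "lie_relation G gdeg n p \<Longrightarrow> lie_relation G gdeg n (comb_scale c p)"
| mult_left: "p \<in> comb_piece G gdeg m \<Longrightarrow> lie_relation G gdeg n q \<Longrightarrow>
    lie_relation G gdeg (m + n) (p \<star> q)"
| mult_right: "lie_relation G gdeg m p \<Longrightarrow> q \<in> comb_piece G gdeg n \<Longrightarrow>
    lie_relation G gdeg (m + n) (p \<star> q)"
| antisymmetry: "p \<in> comb_piece G gdeg m \<Longrightarrow> q \<in> comb_piece G gdeg n \<Longrightarrow>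
    lie_relation G gdeg (m + n) (p \<star> q + comb_scale ((-1) powi (m * n)) (q \<star> p))"
| jacobi: "p \<in> comb_piece G gdeg l \<Longrightarrow> q \<in> comb_piece G gdeg m \<Longrightarrow> r \<in> comb_piece G gdeg n \<Longrightarrow>
    lie_relation G gdeg (l + m + n)
      (p \<star> (q \<star> r) - (p \<star> q) \<star> r - comb_scale ((-1) powi (l * m)) (q \<star> (p \<star> r)))"

definition lie_ideal :: "'g set \<Rightarrow> ('g \<Rightarrow> int) \<Rightarrow> int \<Rightarrow> 'g word_comb set" where
  "lie_ideal G gdeg n = {p. lie_relation G gdeg n p}"

definition free_dgl ::
    "'g set \<Rightarrow> ('g \<Rightarrow> int) \<Rightarrow> ('g \<Rightarrow> 'g word_comb) \<Rightarrow> 'g word_comb set dg_data" where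
  "free_dgl G gdeg d = dg_quot (word_algebra G gdeg d) (lie_ideal G gdeg)"

definition free_class ::
    "'g set \<Rightarrow> ('g \<Rightarrow> int) \<Rightarrow> ('g \<Rightarrow> 'g word_comb) \<Rightarrow> int \<Rightarrow> 'g word_comb \<Rightarrow> 'g word_comb set" where
  "free_class G gdeg d n p = lie_ideal G gdeg n +>\<^bsub>piece (word_algebra G gdeg d) n\<^esub> p"

section \<open>Higher Whitehead brackets\<close>

text \<open>
  The index \<open>i\<^sub>1 < \<dots> < i\<^sub>s\<close> of a generator is the list \<open>[i\<^sub>1, \<dots>, i\<^sub>s]\<close>. Shuffles permute the
  positions \<open>0, \<dots>, s - 1\<close> of that list, so the condition \<open>\<sigma>(1) = 1\<close> reads \<open>\<sigma> 0 = 0\<close>.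
\<close>

definition wh_index :: "nat \<Rightarrow> nat list set" where
  "wh_index k = {I. sorted_wrt (<) I \<and> set I \<subseteq> {1..k} \<and> 1 \<le> length I \<and> length I < k}"

definition wh_deg :: "(nat \<Rightarrow> int) \<Rightarrow> nat list \<Rightarrow> int" where
  "wh_deg n I = (\<Sum>i\<leftarrow>I. n i) - 1"

definition pointed_shuffles :: "nat \<Rightarrow> nat \<Rightarrow> (nat \<Rightarrow> nat) set" where
  "pointed_shuffles p q = {\<sigma>. \<sigma> permutes {..<p + q} \<and>
     strict_mono_on {..<p} \<sigma> \<and> strict_mono_on {p..<p + q} \<sigma> \<and> \<sigma> 0 = 0}"

text \<open>
  Sorting \<open>v\<^bsub>I ! \<sigma> 0\<^esub> \<dots> v\<^bsub>I ! \<sigma> (s - 1)\<^esub>\<close> into the original order interchanges exactly the pairs that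
  form an inversion of \<open>\<sigma>\<close>.
\<close>

definition koszul_sign :: "(nat \<Rightarrow> int) \<Rightarrow> nat list \<Rightarrow> (nat \<Rightarrow> nat) \<Rightarrow> rat" where
  "koszul_sign n I \<sigma> =
     (\<Prod>(a, b)\<in>{(a, b). a < b \<and> b < length I \<and> \<sigma> b < \<sigma> a}. (-1) powi (n (I ! \<sigma> a) * n (I ! \<sigma> b)))"

definition wh_diff :: "(nat \<Rightarrow> int) \<Rightarrow> nat list \<Rightarrow> nat list word_comb" where
  "wh_diff n I =
     (\<Sum>p = 1..<length I. \<Sum>\<sigma>\<in>pointed_shuffles p (length I - p).
        let J = map (\<lambda>j. I ! \<sigma> j) [0..<p];
            K = map (\<lambda>j. I ! \<sigma> j) [p..<length I]
        in Poly_Mapping.single (Br (Gen J) (Gen K))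
             ((-1) powi wh_deg n J * koszul_sign n I \<sigma>))"

definition wh_algebra :: "nat \<Rightarrow> (nat \<Rightarrow> int) \<Rightarrow> nat list word_comb set dg_data" where
  "wh_algebra k n = free_dgl (wh_index k) (wh_deg n) (wh_diff n)"

definition wh_generator :: "nat \<Rightarrow> (nat \<Rightarrow> int) \<Rightarrow> nat list \<Rightarrow> nat list word_comb set" where
  "wh_generator k n I =
     free_class (wh_index k) (wh_deg n) (wh_diff n) (wh_deg n I) (Poly_Mapping.single (Gen I) 1)"

definition wh_cycle :: "nat \<Rightarrow> (nat \<Rightarrow> int) \<Rightarrow> nat list word_comb set" where
  "wh_cycle k n =
     free_class (wh_index k) (wh_deg n) (wh_diff n) ((\<Sum>i = 1..k. n i) - 2) (wh_diff n [1..<Suc k])"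

text \<open>
  The bracket set formed with the morphism \<open>\<phi>\<^sub>0\<close> from the free Lie algebra on \<open>u\<^sub>1, \<dots>, u\<^sub>k\<close> that sends
  \<open>u\<^sub>i\<close> to the cycle \<open>z i\<close> of degree \<open>n i - 1\<close>; the condition on generators says that \<open>\<phi>\<close> extends \<open>\<phi>\<^sub>0\<close>.
  In \<open>homology L\<close> the differential vanishes, so a homology class of \<open>L\<close> is a cycle there, and the only
  one representing its class.
\<close>

definition whitehead_set ::
    "'a dg_data \<Rightarrow> nat \<Rightarrow> (nat \<Rightarrow> int) \<Rightarrow> (nat \<Rightarrow> 'a) \<Rightarrow> 'a set set" where
  "whitehead_set L k n z =
     {homology_class L ((\<Sum>i = 1..k. n i) - 2) (\<phi> ((\<Sum>i = 1..k. n i) - 2) (wh_cycle k n)) | \<phi>.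
        dgl_hom (wh_algebra k n) L \<phi> \<and>
        (\<forall>i\<in>{1..k}. \<phi> (n i - 1) (wh_generator k n [i]) = z i)}"

text \<open>
  For \<open>k = 2\<close> the bracket set is the singleton of the binary bracket up to sign. That it avoids
  \<open>0\<close> is no obstruction to formality: a graded Lie algebra with zero differential and non-zero
  bracket is formal. Only for \<open>k \<ge> 3\<close> can \<open>0\<close> missing from the bracket set obstruct formality.
\<close>

end

theory Submission
  imports Defs
begin

text \<open>
  A morphism from the free Lie algebra of the definition is a family \<open>Y\<^sub>J\<close>, indexed by the non-empty
  proper subsets \<open>J\<close> of \<open>{1..k}\<close>, that solves the Maurer--Cartan equation
  \<open>\<partial>Y\<^sub>J = \<Sum> \<plusminus>[Y\<^sub>A, Y\<^sub>B]\<close>, summed over the splittings \<open>J = A \<squnion> B\<close>; equivalently, it is a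
  Maurer--Cartan element of \<open>L \<otimes> \<rat>[v\<^sub>1, \<dots>, v\<^sub>k]/(v\<^sub>i\<^sup>2)\<close> truncated below \<open>v\<^sub>1\<cdots>v\<^sub>k\<close>, and the
  Whitehead bracket consists of the obstruction classes to extending it to the top monomial. Such
  families lift along a quasi-isomorphism up to gauge transformations by elements
  \<open>b \<otimes> v\<^bsub>J\<^esub>\<close>, which change the obstruction cycle by a boundary. So a quasi-isomorphism
  induces a bijection of Whitehead sets, and a zig-zag from \<open>L\<close> to \<open>H = H(L)\<close> turns the set of
  the \<open>x\<^sub>i\<close> in \<open>L\<close> into that of their images under an automorphism of \<open>H\<close>, hence into the one of
  the \<open>x\<^sub>i\<close> in \<open>H\<close>. If \<open>k \<ge> 3\<close> and the latter is non-empty, it contains \<open>0\<close>: as \<open>H\<close> has zero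
  differential, the equations for \<open>|J| = 2\<close> say that the binary brackets vanish, so that all
  components with \<open>|J| \<ge> 2\<close> may be replaced by \<open>0\<close>.

  To compute with sums in type classes instead of module records, the components of \<open>L\<close> are embedded
  into free vector spaces, to which the operations of \<open>L\<close> extend as total functions subject to
  the same identities.
\<close>

section \<open>Signs and splittings\<close>

text \<open>The pointed shuffles of the differential are not stable under the permutations that the
  Jacobi identity calls for, so all sums run over ordered splittings into subsets, at the price of a
  factor 1/2. Shifting degrees by one makes the signed bracket symmetric in the two parts, and the
  curvature of a partial solution is closed by a Bianchi identity; this turns each step of the
  lifting into an extension problem for cycles. A lift along a quasi-isomorphism reaches the
  prescribed component only up to a boundary \<partial>b, where b need not lift. Hence the target
  solution is replaced by its gauge transform under b \<otimes> v_J. Smaller sets are treated first,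
  since that transform alters only the components whose index contains J. Singletons start the
  process, so the same argument yields independence of the cycles chosen in the classes. Formality
  provides some isomorphism from H to H(H), not necessarily the canonical one. It compares the
  bracket set in L with that of the images of the x_i under an automorphism of H, and a further
  bijection, induced by this automorphism, leads back to the x_i.\<close>

definition block_sign :: "(nat \<Rightarrow> int) \<Rightarrow> nat set \<Rightarrow> nat set \<Rightarrow> rat" where
  "block_sign n J K = (\<Prod>j\<in>J. \<Prod>l\<in>K. if l < j then (-1) powi (n j * n l) else 1)"

text \<open>\<open>block_sign\<close> is the Koszul sign of sorting v_J v_K. The additional exponent
  is the degree of the left entry Y_J, as the formula for the differential prescribes.\<close>

definition split_sign :: "(nat \<Rightarrow> int) \<Rightarrow> nat set \<Rightarrow> nat set \<Rightarrow> rat" where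
  "split_sign n J K = (-1) powi (sum n J - 1) * block_sign n J K"

lemma powi_minus_one: "(-1 :: rat) powi a = (if even a then 1 else -1)"
  by (simp add: power_int_minus_left)

lemmas powi_minus_one_parity =
  powi_minus_one even_add even_diff even_mult_iff even_minus odd_one

lemma powi_minus_one_add: "(-1 :: rat) powi (a + b) = (-1) powi a * (-1) powi b"
  by (simp add: powi_minus_one)

lemma powi_minus_one_sum: "(-1 :: rat) powi (\<Sum>j\<in>J. f j) = (\<Prod>j\<in>J. (-1) powi f j)"
  by (induction J rule: infinite_finite_induct) (simp_all add: powi_minus_one_add)

lemma block_sign_Un_left:
  "finite A \<Longrightarrow> finite B \<Longrightarrow> A \<inter> B = {} \<Longrightarrow>
    block_sign n (A \<union> B) K = block_sign n A K * block_sign n B K"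
  by (simp add: block_sign_def prod.union_disjoint)

lemma block_sign_Un_right:
  "finite A \<Longrightarrow> finite B \<Longrightarrow> A \<inter> B = {} \<Longrightarrow>
    block_sign n J (A \<union> B) = block_sign n J A * block_sign n J B"
  by (simp add: block_sign_def prod.union_disjoint prod.distrib)

lemma block_sign_cases: "block_sign n J K = 1 \<or> block_sign n J K = -1"
proof -
  have *: "(\<Prod>j\<in>A. f j) = 1 \<or> (\<Prod>j\<in>A. f j) = -1" if "\<And>j. f j = 1 \<or> f j = (-1 :: rat)" for A f
    by (induction A rule: infinite_finite_induct) (use that in force)+
  show ?thesis
    unfolding block_sign_def by (intro * ) (auto simp: powi_minus_one)
qed

lemma block_sign_square: "block_sign n J K * block_sign n J K = 1"
  using block_sign_cases[of n J K] by auto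

text \<open>Each pair (j, l) is out of order in exactly one of the products v_J v_K and v_K v_J,
  because J and K are disjoint. The two signs together therefore contain every factor once.\<close>

lemma block_sign_commute:
  assumes "J \<inter> K = {}"
  shows "block_sign n K J = (-1) powi (sum n J * sum n K) * block_sign n J K"
proof -
  have "block_sign n K J = (\<Prod>j\<in>J. \<Prod>l\<in>K. if j < l then (-1) powi (n l * n j) else 1)"
    unfolding block_sign_def by (rule prod.swap)
  then have "block_sign n J K * block_sign n K J =
      (\<Prod>j\<in>J. \<Prod>l\<in>K. (if l < j then (-1) powi (n j * n l) else 1) *
        (if j < l then (-1) powi (n l * n j) else 1))"
    by (simp add: block_sign_def prod.distrib)
  also have "\<dots> = (\<Prod>j\<in>J. \<Prod>l\<in>K. (-1) powi (n j * n l))"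
    using assms by (intro prod.cong refl) (auto simp: not_less mult.commute order.order_iff_strict)
  also have "\<dots> = (-1) powi (sum n J * sum n K)"
    by (simp add: sum_product powi_minus_one_sum)
  finally have "block_sign n J K * block_sign n K J = (-1) powi (sum n J * sum n K)" .
  then have "block_sign n J K * block_sign n J K * block_sign n K J =
      (-1) powi (sum n J * sum n K) * block_sign n J K"
    by (simp add: mult_ac)
  then show ?thesis by (simp add: block_sign_square)
qed

definition splits :: "'i set \<Rightarrow> ('i set \<times> 'i set) set" where
  "splits I = {(J, K). J \<union> K = I \<and> J \<inter> K = {} \<and> J \<noteq> {} \<and> K \<noteq> {}}"

text \<open>Ordered triples can be rotated, nested splittings cannot; the cyclic Jacobi identity is
  summed over the former.\<close>

definition triples :: "'i set \<Rightarrow> ('i set \<times> 'i set \<times> 'i set) set" where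
  "triples I = {(A, B, C). A \<union> B \<union> C = I \<and> A \<inter> B = {} \<and> A \<inter> C = {} \<and> B \<inter> C = {} \<and>
     A \<noteq> {} \<and> B \<noteq> {} \<and> C \<noteq> {}}"

lemma finite_splits: "finite I \<Longrightarrow> finite (splits I)"
  by (rule finite_subset[of _ "Pow I \<times> Pow I"]) (auto simp: splits_def)

lemma sum_splits_commute: "(\<Sum>(J, K)\<in>splits I. f J K) = (\<Sum>(J, K)\<in>splits I. f K J)"
  by (rule sum.reindex_bij_witness[of _ "\<lambda>(J, K). (K, J)" "\<lambda>(J, K). (K, J)"])
    (auto simp: splits_def)

lemma sum_triples_rotate: "(\<Sum>(A, B, C)\<in>triples I. f A B C) = (\<Sum>(A, B, C)\<in>triples I. f B C A)"
  by (rule sum.reindex_bij_witness[of _ "\<lambda>(A, B, C). (B, C, A)" "\<lambda>(A, B, C). (C, A, B)"])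
    (auto simp: triples_def)

text \<open>A nested splitting is recovered from its three final parts, since J is the union of A
  and B.\<close>

lemma sum_splits_splits:
  assumes "finite I"
  shows "(\<Sum>(J, K)\<in>splits I. \<Sum>(A, B)\<in>splits J. f A B K) = (\<Sum>(A, B, C)\<in>triples I. f A B C)"
proof -
  have fin: "finite (splits (fst x))" if "x \<in> splits I" for x
    using that assms by (intro finite_splits) (auto simp: splits_def)
  have "(\<Sum>(J, K)\<in>splits I. \<Sum>(A, B)\<in>splits J. f A B K) =
      (\<Sum>(x, y)\<in>(SIGMA x : splits I. splits (fst x)). f (fst y) (snd y) (snd x))"
    using assms fin by (subst sum.Sigma[symmetric]) (auto simp: finite_splits case_prod_unfold)
  also have "\<dots> = (\<Sum>(A, B, C)\<in>triples I. f A B C)"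
    by (rule sum.reindex_bij_witness[of _ "\<lambda>(A, B, C). ((A \<union> B, C), (A, B))"
          "\<lambda>((J, K), (A, B)). (A, B, K)"]) (auto simp: splits_def triples_def)
  finally show ?thesis .
qed

section \<open>Families solving the Maurer--Cartan equation\<close>

text \<open>The operations are total and their identities hold on the whole type, so that they
  rewrite without membership conditions; \<open>V\<close> keeps track of degrees.\<close>

locale total_dgl = vector_space scale
  for scale :: "rat \<Rightarrow> 'b \<Rightarrow> 'b :: ab_group_add" (infixr \<open>*s\<close> 75) +
  fixes V :: "int \<Rightarrow> 'b set"
    and br :: "int \<Rightarrow> int \<Rightarrow> 'b \<Rightarrow> 'b \<Rightarrow> 'b"
    and d :: "int \<Rightarrow> 'b \<Rightarrow> 'b"
  assumes V_subspace: "subspace (V m)"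
    and br_mem: "br l m a b \<in> V (l + m)"
    and br_add_left: "br l m (a + a') b = br l m a b + br l m a' b"
    and br_add_right: "br l m a (b + b') = br l m a b + br l m a b'"
    and br_scale_left: "br l m (r *s a) b = r *s br l m a b"
    and br_scale_right: "br l m a (r *s b) = r *s br l m a b"
    and br_antisym: "br l m a b = (- ((-1) powi (l * m))) *s br m l b a"
    and br_jacobi: "br j (l + m) a (br l m b c) =
      br (j + l) m (br j l a b) c + ((-1) powi (j * l)) *s br l (j + m) b (br j m a c)"
    and d_mem: "d m a \<in> V (m - 1)"
    and d_add: "d m (a + b) = d m a + d m b"
    and d_scale: "d m (r *s a) = r *s d m a"
    and d_d: "d (m - 1) (d m a) = 0"
    and d_br: "d (l + m) (br l m a b) =
      br (l - 1) m (d l a) b + ((-1) powi l) *s br l (m - 1) a (d m b)"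
begin

lemma d_zero [simp]: "d m 0 = 0"
  using d_scale[of m 0 0] by simp

lemma br_zero_left [simp]: "br l m 0 b = 0"
  using br_scale_left[of l m 0 0 b] by simp

lemma br_zero_right [simp]: "br l m a 0 = 0"
  using br_scale_right[of l m a 0 0] by simp

lemma d_sum: "d m (sum f A) = (\<Sum>x\<in>A. d m (f x))"
  by (induction A rule: infinite_finite_induct) (simp_all add: d_add)

lemma br_sum_left: "br l m (sum f A) b = (\<Sum>x\<in>A. br l m (f x) b)"
  by (induction A rule: infinite_finite_induct) (simp_all add: br_add_left)

lemma br_sum_right: "br l m b (sum f A) = (\<Sum>x\<in>A. br l m b (f x))"
  by (induction A rule: infinite_finite_induct) (simp_all add: br_add_right)

lemma d_minus: "d m (- a) = - d m a"
  using d_scale[of m "-1" a] by simp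

lemma d_diff: "d m (a - b) = d m a - d m b"
  using d_add[of m a "- b"] by (simp add: d_minus)

definition pairing :: "(nat \<Rightarrow> int) \<Rightarrow> (nat set \<Rightarrow> 'b) \<Rightarrow> (nat set \<Rightarrow> 'b) \<Rightarrow> nat set \<Rightarrow> nat set \<Rightarrow> 'b" where
  "pairing n Y Z J K = split_sign n J K *s br (sum n J - 1) (sum n K - 1) (Y J) (Z K)"

text \<open>
  Twice the right-hand side of the formula for the differential: a pair \<open>(J, K)\<close> and its transpose
  contribute equally, and the formula picks the one with the least index in \<open>J\<close>.
\<close>

definition curvature :: "(nat \<Rightarrow> int) \<Rightarrow> (nat set \<Rightarrow> 'b) \<Rightarrow> nat set \<Rightarrow> 'b" where
  "curvature n Y I = (\<Sum>(J, K)\<in>splits I. pairing n Y Y J K)"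

definition mc_at :: "(nat \<Rightarrow> int) \<Rightarrow> (nat set \<Rightarrow> 'b) \<Rightarrow> nat set \<Rightarrow> bool" where
  "mc_at n Y I \<longleftrightarrow> d (sum n I - 1) (Y I) = (1/2) *s curvature n Y I"

text \<open>The entries of a family have degree one less than their monomials. Under this shift the
  sign of graded antisymmetry is exactly the one by which \<open>split_sign\<close> changes when the
  parts are exchanged, so the two cancel.\<close>

lemma pairing_commute:
  assumes "J \<inter> K = {}"
  shows "pairing n Y Z J K = pairing n Z Y K J"
proof -
  have "split_sign n K J = - ((-1) powi ((sum n J - 1) * (sum n K - 1)) * split_sign n J K)"
    using block_sign_commute[OF assms, of n]
    by (auto simp: split_sign_def powi_minus_one)
  then show ?thesis
    unfolding pairing_def
    by (subst br_antisym) (simp add: mult.commute)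
qed

lemma curvature_mem:
  assumes "finite I"
  shows "curvature n Y I \<in> V (sum n I - 2)"
  unfolding curvature_def
proof (rule subspace_sum[OF V_subspace], clarify)
  fix J K assume "(J, K) \<in> splits I"
  then have "sum n I = sum n J + sum n K"
    using assms by (auto simp: splits_def sum.union_disjoint)
  then have "sum n I - 2 = (sum n J - 1) + (sum n K - 1)" by simp
  then show "pairing n Y Y J K \<in> V (sum n I - 2)"
    unfolding pairing_def by (metis br_mem subspace_scale V_subspace)
qed

text \<open>Both parts of a splitting are proper and non-empty, so the curvature at I never sees the
  component at I; this permits recursion over subsets.\<close>

lemma curvature_cong: "(\<And>J. J \<subset> I \<Longrightarrow> J \<noteq> {} \<Longrightarrow> Y J = Z J) \<Longrightarrow> curvature n Y I = curvature n Z I"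
  unfolding curvature_def
proof (intro sum.cong refl, clarify)
  fix J K assume eq: "\<And>J. J \<subset> I \<Longrightarrow> J \<noteq> {} \<Longrightarrow> Y J = Z J" and "(J, K) \<in> splits I"
  then have "Y J = Z J" "Y K = Z K" by (intro eq; auto simp: splits_def)+
  then show "pairing n Y Y J K = pairing n Z Z J K" by (simp add: pairing_def)
qed

end

section \<open>The Bianchi identity\<close>

context total_dgl
begin

text \<open>What a summand of the differential of the curvature becomes once \<open>d\<close> of the
  component at A \<union> B is replaced through the Maurer--Cartan equation. The inner degree is
  written as a sum to match \<open>br_jacobi\<close>.\<close>

definition jacobi_term :: "(nat \<Rightarrow> int) \<Rightarrow> (nat set \<Rightarrow> 'b) \<Rightarrow> nat set \<Rightarrow> nat set \<Rightarrow> nat set \<Rightarrow> 'b" where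
  "jacobi_term n Y A B C = (split_sign n (A \<union> B) C * split_sign n A B) *s
     br (sum n A - 1 + (sum n B - 1)) (sum n C - 1)
       (br (sum n A - 1) (sum n B - 1) (Y A) (Y B)) (Y C)"

text \<open>Antisymmetry brings every double bracket of the graded Jacobi identity into left-nested
  shape. The coefficients then agree up to signs that depend only on the parities of the three
  degrees.\<close>

lemma jacobi_term_cyclic:
  assumes "(A, B, C) \<in> triples I" and "finite I"
  shows "jacobi_term n Y A B C + jacobi_term n Y B C A + jacobi_term n Y C A B = 0"
proof -
  define a b c where abc: "a = sum n A" "b = sum n B" "c = sum n C"
  have fin: "finite A" "finite B" "finite C" using assms by (auto simp: triples_def)
  have dis: "A \<inter> B = {}" "A \<inter> C = {}" "B \<inter> C = {}" "B \<inter> A = {}" "C \<inter> A = {}" "C \<inter> B = {}"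
    using assms by (auto simp: triples_def)
  define W where "W = br (a - 1 + (b - 1)) (c - 1) (br (a - 1) (b - 1) (Y A) (Y B)) (Y C)"
  define W2 where "W2 = br (b - 1 + (c - 1)) (a - 1) (br (b - 1) (c - 1) (Y B) (Y C)) (Y A)"
  define W3 where "W3 = br (c - 1 + (a - 1)) (b - 1) (br (c - 1) (a - 1) (Y C) (Y A)) (Y B)"
  have e1: "br (a - 1) (b - 1 + (c - 1)) (Y A) (br (b - 1) (c - 1) (Y B) (Y C)) =
      (- ((-1) powi ((a - 1) * (b - 1 + (c - 1))))) *s W2"
    unfolding W2_def by (rule br_antisym)
  have e2: "br (a - 1) (c - 1) (Y A) (Y C) =
      (- ((-1) powi ((a - 1) * (c - 1)))) *s br (c - 1) (a - 1) (Y C) (Y A)"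
    by (rule br_antisym)
  have e3: "br (b - 1) (a - 1 + (c - 1)) (Y B) (br (c - 1) (a - 1) (Y C) (Y A)) =
      (- ((-1) powi ((b - 1) * (c - 1 + (a - 1))))) *s W3"
    unfolding W3_def by (subst br_antisym) (simp add: add.commute)
  \<comment> \<open>The Jacobi identity is solved for \<open>W\<close>; the other two double
    brackets become multiples of \<open>W2\<close> and \<open>W3\<close>.\<close>
  have solve: "w = p *s u - (q * r * t) *s v" if "p *s u = w + q *s r *s t *s v" for w u v p q r t
    using that by (simp add: eq_diff_eq mult.assoc)
  note W = solve[OF br_jacobi[of "a - 1" "b - 1" "c - 1" "Y A" "Y B" "Y C",
        unfolded e1 e2 br_scale_right e3, folded W_def]]
  \<comment> \<open>All coefficients are reduced to one product of three block signs: unions split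
    them, and interchanging two blocks costs a power of -1. Only a case distinction on parities is
    left.\<close>
  have signs:
    "split_sign n (A \<union> B) C * split_sign n A B =
       (-1) powi b * block_sign n A C * block_sign n B C * block_sign n A B"
    "split_sign n (B \<union> C) A * split_sign n B C =
       (-1) powi (c + b * a + c * a) * block_sign n A C * block_sign n B C * block_sign n A B"
    "split_sign n (C \<union> A) B * split_sign n C A =
       (-1) powi (a + c * b + c * a) * block_sign n A C * block_sign n B C * block_sign n A B"
    unfolding split_sign_def block_sign_Un_left[OF fin(1,2) dis(1)] block_sign_Un_left[OF fin(2,3) dis(3)]
      block_sign_Un_left[OF fin(3,1) dis(5)] sum.union_disjoint[OF fin(1,2) dis(1)]
      sum.union_disjoint[OF fin(2,3) dis(3)] sum.union_disjoint[OF fin(3,1) dis(5)]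
      block_sign_commute[OF dis(1)] block_sign_commute[OF dis(2)] block_sign_commute[OF dis(3)]
      abc[symmetric]
    unfolding powi_minus_one_parity
    by (cases "even a"; cases "even b"; cases "even c"; simp)+
  define e where "e = block_sign n A C * block_sign n B C * block_sign n A B"
  have combine: "c1 *s w + c2 *s u + c3 *s v = 0"
    if "w = p *s u - q *s v" "c2 = - (c1 * p)" "c3 = c1 * q" for w u v p q c1 c2 c3
    by (simp add: that scale_right_diff_distrib)
  show ?thesis
    unfolding jacobi_term_def signs abc[symmetric] mult.assoc e_def[symmetric, unfolded mult.assoc]
    unfolding W_def[symmetric] W2_def[symmetric] W3_def[symmetric]
    by (rule combine[OF W]; unfold powi_minus_one_parity; cases "even a"; cases "even b"; cases "even c"; simp)
qed

text \<open>By the Leibniz rule each summand splits into two terms that are exchanged by transposing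
  the splitting. The equations on proper subsets turn both into double brackets, whose sum over all
  ordered triples vanishes by the Jacobi identity.\<close>

lemma d_curvature:
  assumes "finite I" and mc: "\<And>J. J \<subset> I \<Longrightarrow> J \<noteq> {} \<Longrightarrow> mc_at n Y J"
  shows "d (sum n I - 2) (curvature n Y I) = 0"
proof -
  \<comment> \<open>The part of the differential of a pairing in which \<open>d\<close> hits the
    first entry; the part in which it hits the second is \<open>U K J\<close>.\<close>
  define U where "U J K = split_sign n J K *s
    br (sum n J - 2) (sum n K - 1) (d (sum n J - 1) (Y J)) (Y K)" for J K
  have dp: "d (sum n I - 2) (pairing n Y Y J K) = U J K + U K J" if JK: "(J, K) \<in> splits I" for J K
  proof -
    have dis: "J \<inter> K = {}" and fin: "finite J" "finite K" and I: "J \<union> K = I"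
      using JK assms(1) by (auto simp: splits_def)
    have deg: "sum n I - 2 = (sum n J - 1) + (sum n K - 1)"
      using fin dis by (simp add: I[symmetric] sum.union_disjoint)
    have "br (sum n J - 1) (sum n K - 2) (Y J) (d (sum n K - 1) (Y K)) =
        (- ((-1) powi ((sum n J - 1) * (sum n K - 2)))) *s
          br (sum n K - 2) (sum n J - 1) (d (sum n K - 1) (Y K)) (Y J)"
      by (rule br_antisym)
    moreover have "split_sign n K J =
        - (split_sign n J K * (-1) powi (sum n J - 1) * (-1) powi ((sum n J - 1) * (sum n K - 2)))"
      using block_sign_commute[OF dis, of n] by (auto simp: split_sign_def powi_minus_one)
    ultimately have "U K J = (split_sign n J K * (-1) powi (sum n J - 1)) *s
        br (sum n J - 1) (sum n K - 2) (Y J) (d (sum n K - 1) (Y K))"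
      by (simp add: U_def mult_ac)
    then show ?thesis
      unfolding pairing_def deg d_scale d_br by (simp add: U_def algebra_simps)
  qed
  have U: "U J K = (1/2) *s (\<Sum>(A, B)\<in>splits J. jacobi_term n Y A B K)"
    if JK: "(J, K) \<in> splits I" for J K
  proof -
    have "mc_at n Y J" using JK by (intro mc) (auto simp: splits_def)
    have "U J K = (1/2) *s (\<Sum>(A, B)\<in>splits J. split_sign n J K *s
        br (sum n J - 2) (sum n K - 1) (pairing n Y Y A B) (Y K))"
      using \<open>mc_at n Y J\<close> by (simp add: mc_at_def U_def curvature_def br_scale_left br_sum_left
          scale_sum_right case_prod_unfold mult.commute)
    also have "(\<Sum>(A, B)\<in>splits J. split_sign n J K *s
        br (sum n J - 2) (sum n K - 1) (pairing n Y Y A B) (Y K)) =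
        (\<Sum>(A, B)\<in>splits J. jacobi_term n Y A B K)"
    proof (intro sum.cong refl, clarify)
      fix A B assume AB: "(A, B) \<in> splits J"
      have "finite J" using JK assms(1) by (auto simp: splits_def)
      then have "sum n J - 2 = (sum n A - 1) + (sum n B - 1)" and "J = A \<union> B"
        using AB by (auto simp: splits_def sum.union_disjoint)
      then show "split_sign n J K *s br (sum n J - 2) (sum n K - 1) (pairing n Y Y A B) (Y K) =
          jacobi_term n Y A B K"
        by (simp add: jacobi_term_def pairing_def br_scale_left)
    qed
    finally show ?thesis .
  qed
  let ?S = "\<Sum>(A, B, C)\<in>triples I. jacobi_term n Y A B C"
  have "d (sum n I - 2) (curvature n Y I) = (\<Sum>(J, K)\<in>splits I. U J K + U K J)"
    unfolding curvature_def d_sum by (intro sum.cong refl) (auto simp: dp)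
  also have "\<dots> = (\<Sum>(J, K)\<in>splits I. U J K) + (\<Sum>(J, K)\<in>splits I. U J K)"
    using sum_splits_commute[of U I] by (simp add: case_prod_unfold sum.distrib)
  also have "(\<Sum>(J, K)\<in>splits I. U J K) =
      (1/2) *s (\<Sum>(J, K)\<in>splits I. \<Sum>(A, B)\<in>splits J. jacobi_term n Y A B K)"
    unfolding scale_sum_right by (intro sum.cong refl) (auto simp: U scale_sum_right)
  also have "\<dots> = (1/2) *s ?S"
    by (simp only: sum_splits_splits[OF assms(1)])
  also have "(1/2) *s ?S + (1/2) *s ?S = ?S"
    by (simp flip: scale_left_distrib)
  also have "?S = 0"
  proof -
    \<comment> \<open>Rotating the triples does not change the sum, so three copies of it add up to
      cyclic Jacobi expressions; the rationals allow division by 3.\<close>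
    have "?S + ?S + ?S = ?S + (\<Sum>(A, B, C)\<in>triples I. jacobi_term n Y B C A) +
        (\<Sum>(A, B, C)\<in>triples I. jacobi_term n Y C A B)"
      using sum_triples_rotate[of "jacobi_term n Y" I]
        sum_triples_rotate[of "\<lambda>A B C. jacobi_term n Y B C A" I] by simp
    also have "\<dots> = (\<Sum>(A, B, C)\<in>triples I.
        jacobi_term n Y A B C + jacobi_term n Y B C A + jacobi_term n Y C A B)"
      by (simp add: sum.distrib case_prod_unfold)
    also have "\<dots> = 0"
      using jacobi_term_cyclic[OF _ assms(1)] by (intro sum.neutral) auto
    finally have "?S + ?S + ?S = 0" .
    moreover have "?S + ?S + ?S = 3 *s ?S"
      using scale_left_distrib[of 2 1 ?S] scale_left_distrib[of 1 1 ?S] by simp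
    ultimately show ?thesis by simp
  qed
  finally show ?thesis .
qed

end

section \<open>Gauge transformations\<close>

context total_dgl
begin

text \<open>
  The gauge transformation by \<open>b \<otimes> v\<close> for the square-zero monomial \<open>v = v\<^bsub>I\<^sub>0\<^esub>\<close>; since \<open>v\<^sup>2 = 0\<close>, its
  exponential series stops after the linear term.
\<close>

definition gauge_change ::
    "(nat \<Rightarrow> int) \<Rightarrow> nat set \<Rightarrow> 'b \<Rightarrow> (nat set \<Rightarrow> 'b) \<Rightarrow> nat set \<Rightarrow> 'b" where
  "gauge_change n I0 b Y J =
     (if I0 \<subset> J then split_sign n I0 (J - I0) *s br (sum n I0) (sum n (J - I0) - 1) b (Y (J - I0))
      else if J = I0 then d (sum n I0) b else 0)"

definition gauge :: "(nat \<Rightarrow> int) \<Rightarrow> nat set \<Rightarrow> 'b \<Rightarrow> (nat set \<Rightarrow> 'b) \<Rightarrow> nat set \<Rightarrow> 'b" where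
  "gauge n I0 b Y J = Y J + gauge_change n I0 b Y J"

lemma pairing_add_left: "pairing n (\<lambda>J. Y J + Y' J) Z J K = pairing n Y Z J K + pairing n Y' Z J K"
  by (simp add: pairing_def br_add_left scale_right_distrib)

lemma pairing_add_right: "pairing n Y (\<lambda>J. Z J + Z' J) J K = pairing n Y Z J K + pairing n Y Z' J K"
  by (simp add: pairing_def br_add_right scale_right_distrib)

text \<open>The quadratic term vanishes because the non-empty set I0 cannot lie in both parts of a
  splitting. The two linear terms have equal sums by symmetry of the pairing.\<close>

lemma curvature_gauge_eq_sum:
  assumes "I0 \<noteq> {}"
  shows "curvature n (gauge n I0 b Y) I = curvature n Y I +
    2 *s (\<Sum>(J, K)\<in>splits I. pairing n (gauge_change n I0 b Y) Y J K)"
proof -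
  let ?G = "gauge_change n I0 b Y"
  let ?S = "\<Sum>(J, K)\<in>splits I. pairing n ?G Y J K"
  have vanish: "pairing n ?G ?G J K = 0" if "(J, K) \<in> splits I" for J K
  proof -
    have "\<not> (I0 \<subseteq> J \<and> I0 \<subseteq> K)"
      using that assms by (auto simp: splits_def)
    then have "?G J = 0 \<or> ?G K = 0"
      by (auto simp: gauge_change_def)
    then show ?thesis by (auto simp: pairing_def)
  qed
  have "curvature n (gauge n I0 b Y) I =
      (\<Sum>(J, K)\<in>splits I. pairing n Y Y J K + pairing n ?G Y J K + pairing n ?G Y K J)"
    unfolding curvature_def
  proof (intro sum.cong refl, clarify)
    fix J K assume JK: "(J, K) \<in> splits I"
    then have "J \<inter> K = {}" by (auto simp: splits_def)
    then show "pairing n (gauge n I0 b Y) (gauge n I0 b Y) J K =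
        pairing n Y Y J K + pairing n ?G Y J K + pairing n ?G Y K J"
      using vanish[OF JK]
      by (simp add: gauge_def[abs_def] pairing_add_left pairing_add_right pairing_commute[of J K n Y ?G])
  qed
  also have "\<dots> = curvature n Y I + (?S + ?S)"
    using sum_splits_commute[of "pairing n ?G Y" I]
    by (simp add: curvature_def sum.distrib case_prod_unfold)
  also have "?S + ?S = 2 *s ?S"
    using scale_left_distrib[of 1 1 ?S] by simp
  finally show ?thesis .
qed

text \<open>The transform alters only components whose index contains I0, and no proper subset of I
  does.\<close>

lemma curvature_gauge_other:
  assumes "I0 \<noteq> {}" and "\<not> I0 \<subset> I"
  shows "curvature n (gauge n I0 b Y) I = curvature n Y I"
  using assms
  by (intro curvature_cong) (auto simp: gauge_def gauge_change_def)

text \<open>The Jacobi identity for b, Y_A and Y_K. Antisymmetry makes its second term the first one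
  with A and K exchanged, so that a sum over all splittings of R becomes symmetric.\<close>

lemma gauge_jacobi:
  assumes AK: "(A, K) \<in> splits R" and fin: "finite R" "finite I0" and "I0 \<inter> R = {}"
  shows "(split_sign n I0 R * (-1) powi sum n I0) *s br (sum n I0) (sum n R - 2) b (pairing n Y Y A K) =
    (split_sign n (I0 \<union> A) K * split_sign n I0 A) *s
      br (sum n I0 + (sum n A - 1)) (sum n K - 1) (br (sum n I0) (sum n A - 1) b (Y A)) (Y K) +
    (split_sign n (I0 \<union> K) A * split_sign n I0 K) *s
      br (sum n I0 + (sum n K - 1)) (sum n A - 1) (br (sum n I0) (sum n K - 1) b (Y K)) (Y A)"
proof -
  define i a c where iac: "i = sum n I0" "a = sum n A" "c = sum n K"
  have R: "R = A \<union> K" and dis: "A \<inter> K = {}" "I0 \<inter> A = {}" "I0 \<inter> K = {}"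
    and fins: "finite A" "finite K"
    using assms by (auto simp: splits_def)
  define W where "W = br (i + (a - 1)) (c - 1) (br i (a - 1) b (Y A)) (Y K)"
  define W' where "W' = br (i + (c - 1)) (a - 1) (br i (c - 1) b (Y K)) (Y A)"
  have deg: "sum n R - 2 = (a - 1) + (c - 1)"
    using fins dis by (simp add: R iac sum.union_disjoint)
  have "br (a - 1) (i + (c - 1)) (Y A) (br i (c - 1) b (Y K)) =
      (- ((-1) powi ((a - 1) * (i + (c - 1))))) *s W'"
    unfolding W'_def by (rule br_antisym)
  then have "br i (a - 1 + (c - 1)) b (br (a - 1) (c - 1) (Y A) (Y K)) =
      W + ((-1) powi (i * (a - 1))) *s (- ((-1) powi ((a - 1) * (i + (c - 1))))) *s W'"
    unfolding W_def by (subst br_jacobi) simp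
  then have "br i (sum n R - 2) b (pairing n Y Y A K) = split_sign n A K *s
      (W + ((-1) powi (i * (a - 1))) *s (- ((-1) powi ((a - 1) * (i + (c - 1))))) *s W')"
    by (simp add: deg pairing_def br_scale_right iac)
  \<comment> \<open>The next two identities match the coefficients of \<open>W\<close> and
    \<open>W'\<close>; the second one requires interchanging the blocks A and K.\<close>
  moreover have "split_sign n I0 R * (-1) powi i * split_sign n A K =
      split_sign n (I0 \<union> A) K * split_sign n I0 A"
    unfolding split_sign_def block_sign_Un_left[OF fin(2) fins(1) dis(2)] R
      block_sign_Un_right[OF fins dis(1)] sum.union_disjoint[OF fin(2) fins(1) dis(2)] iac[symmetric]
      powi_minus_one_parity
    by (cases "even a"; cases "even i"; simp)
  moreover have "split_sign n I0 R * (-1) powi i * split_sign n A K *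
      ((-1) powi (i * (a - 1)) * (- ((-1) powi ((a - 1) * (i + (c - 1)))))) =
      split_sign n (I0 \<union> K) A * split_sign n I0 K"
    unfolding split_sign_def block_sign_Un_left[OF fin(2) fins(2) dis(3)] R
      block_sign_Un_right[OF fins dis(1)] sum.union_disjoint[OF fin(2) fins(2) dis(3)]
      block_sign_commute[OF dis(1)] iac[symmetric] powi_minus_one_parity
    by (cases "even a"; cases "even i"; cases "even c"; simp)
  moreover have "r *s v = r1 *s w + r2 *s w'"
    if "v = q *s (w + p *s p' *s w')" "r * q = r1" "r * q * (p * p') = r2" for v w w' q p p' r r1 r2
    by (simp add: that(1) scale_right_distrib mult.assoc flip: that(2,3))
  ultimately show ?thesis
    unfolding iac[symmetric] W_def[symmetric] W'_def[symmetric] by blast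
qed

text \<open>Write R for I - I0. The linear part consists of [d b, Y_R] and of brackets that the
  Jacobi identity and the equation at R collect into [b, d Y_R]. By the Leibniz rule they form the
  differential of [b, Y_R].\<close>

lemma curvature_gauge:
  assumes "finite I" and "I0 \<noteq> {}" and "I0 \<subset> I" and mc: "mc_at n Y (I - I0)"
  shows "curvature n (gauge n I0 b Y) I =
    curvature n Y I + 2 *s d (sum n I - 1) (gauge_change n I0 b Y I)"
proof -
  define R where "R = I - I0"
  have fin: "finite I0" "finite R" and I: "I = I0 \<union> R" and dis: "I0 \<inter> R = {}" and "R \<noteq> {}"
    using assms finite_subset by (auto simp: R_def)
  let ?G = "gauge_change n I0 b Y"
  define W where "W A K = (split_sign n (I0 \<union> A) K * split_sign n I0 A) *s
      br (sum n I0 + (sum n A - 1)) (sum n K - 1) (br (sum n I0) (sum n A - 1) b (Y A)) (Y K)" for A K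
  have W: "pairing n ?G Y (I0 \<union> A) K = W A K" if "(A, K) \<in> splits R" for A K
  proof -
    have "I0 \<subset> I0 \<union> A" "I0 \<union> A - I0 = A" "sum n (I0 \<union> A) - 1 = sum n I0 + (sum n A - 1)"
      using that dis fin by (auto simp: splits_def intro!: sum.union_disjoint)
    then show ?thesis by (simp add: pairing_def gauge_change_def br_scale_left W_def add_diff_eq)
  qed
  have inj: "inj_on (\<lambda>(A, K). (I0 \<union> A, K)) (splits R)"
    using dis by (intro inj_onI) (auto simp: splits_def)
  \<comment> \<open>Only splittings whose first part contains I0 survive: that part is I0 itself, or
    I0 together with the first half of a splitting of R.\<close>
  have "(\<Sum>(J, K)\<in>splits I. pairing n ?G Y J K) =
      (\<Sum>(J, K)\<in>insert (I0, R) ((\<lambda>(A, K). (I0 \<union> A, K)) ` splits R). pairing n ?G Y J K)"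
  proof (rule sum.mono_neutral_right)
    show "finite (splits I)" by (rule finite_splits) fact
    show "insert (I0, R) ((\<lambda>(A, K). (I0 \<union> A, K)) ` splits R) \<subseteq> splits I"
      using dis \<open>R \<noteq> {}\<close> \<open>I0 \<noteq> {}\<close> by (auto simp: splits_def I)
    show "\<forall>x\<in>splits I - insert (I0, R) ((\<lambda>(A, K). (I0 \<union> A, K)) ` splits R).
        (case x of (J, K) \<Rightarrow> pairing n ?G Y J K) = 0"
    proof
      fix x assume x: "x \<in> splits I - insert (I0, R) ((\<lambda>(A, K). (I0 \<union> A, K)) ` splits R)"
      obtain J K where xJK: "x = (J, K)" by (cases x)
      then have JK: "(J, K) \<in> splits I"
        and notin: "(J, K) \<notin> insert (I0, R) ((\<lambda>(A, K). (I0 \<union> A, K)) ` splits R)"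
        using x by auto
      have "\<not> I0 \<subseteq> J"
      proof
        assume sub: "I0 \<subseteq> J"
        show False
        proof (cases "J = I0")
          case True
          then show False using JK dis notin by (auto simp: splits_def I)
        next
          case False
          have "(J - I0, K) \<in> splits R" using JK False sub dis by (auto simp: splits_def I)
          moreover have "(J, K) = (\<lambda>(A, K). (I0 \<union> A, K)) (J - I0, K)" using sub by auto
          ultimately have "(J, K) \<in> (\<lambda>(A, K). (I0 \<union> A, K)) ` splits R" by (rule rev_image_eqI)
          then show False using notin by simp
        qed
      qed
      then show "(case x of (J, K) \<Rightarrow> pairing n ?G Y J K) = 0"
        by (auto simp: xJK pairing_def gauge_change_def)
    qed
  qed
  also have "\<dots> = pairing n ?G Y I0 R + (\<Sum>(A, K)\<in>splits R. pairing n ?G Y (I0 \<union> A) K)"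
    using finite_splits[OF fin(2)] dis inj
    by (subst sum.insert) (auto simp: sum.reindex splits_def case_prod_unfold inj_def)
  also have "(\<Sum>(A, K)\<in>splits R. pairing n ?G Y (I0 \<union> A) K) = (\<Sum>(A, K)\<in>splits R. W A K)"
    by (intro sum.cong refl) (auto simp: W)
  \<comment> \<open>Symmetrizing in A and K produces both terms of \<open>gauge_jacobi\<close>, and
    the resulting 1/2 is the one in the Maurer--Cartan equation at R.\<close>
  also have "(\<Sum>(A, K)\<in>splits R. W A K) =
      (1/2) *s ((\<Sum>(A, K)\<in>splits R. W A K) + (\<Sum>(A, K)\<in>splits R. W K A))"
    using sum_splits_commute[of W R] scale_left_distrib[of "1/2" "1/2"]
    by (simp add: scale_right_distrib)
  also have "(\<Sum>(A, K)\<in>splits R. W A K) + (\<Sum>(A, K)\<in>splits R. W K A) =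
      (\<Sum>(A, K)\<in>splits R. W A K + W K A)"
    by (simp add: sum.distrib case_prod_unfold)
  also have "\<dots> = (\<Sum>(A, K)\<in>splits R. (split_sign n I0 R * (-1) powi sum n I0) *s
      br (sum n I0) (sum n R - 2) b (pairing n Y Y A K))"
    by (intro sum.cong refl) (auto simp: W_def gauge_jacobi[OF _ fin(2,1) dis])
  also have "\<dots> = (split_sign n I0 R * (-1) powi sum n I0) *s
      br (sum n I0) (sum n R - 2) b (curvature n Y R)"
    by (simp add: curvature_def br_sum_right scale_sum_right case_prod_unfold)
  also have "(1/2) *s \<dots> = (split_sign n I0 R * (-1) powi sum n I0) *s
      br (sum n I0) (sum n R - 2) b (d (sum n R - 1) (Y R))"
    using mc by (simp add: mc_at_def R_def[symmetric] br_scale_right)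
  also have "pairing n ?G Y I0 R + \<dots> = d (sum n I - 1) (?G I)"
  proof -
    have "sum n I - 1 = sum n I0 + (sum n R - 1)"
      using fin dis by (simp add: I sum.union_disjoint)
    then have "d (sum n I - 1) (br (sum n I0) (sum n R - 1) b (Y R)) =
        br (sum n I0 - 1) (sum n R - 1) (d (sum n I0) b) (Y R) +
        ((-1) powi sum n I0) *s br (sum n I0) (sum n R - 2) b (d (sum n R - 1) (Y R))"
      using d_br[of "sum n I0" "sum n R - 1" b "Y R"] by (simp add: add_diff_eq)
    then show ?thesis
      using \<open>I0 \<subset> I\<close> by (simp add: gauge_change_def R_def[symmetric] pairing_def d_scale scale_right_distrib)
  qed
  finally show ?thesis
    using curvature_gauge_eq_sum[OF \<open>I0 \<noteq> {}\<close>] by simp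
qed

text \<open>If I0 is a proper subset of I, the curvature changes by twice the differential of the
  change of the component, and the factor 1/2 balances this. Otherwise the curvature stays the same
  and the change of the component is zero or a boundary.\<close>

lemma mc_at_gauge:
  assumes "finite I" and "I0 \<noteq> {}" and "mc_at n Y I" and "I0 \<subset> I \<Longrightarrow> mc_at n Y (I - I0)"
  shows "mc_at n (gauge n I0 b Y) I"
proof (cases "I0 \<subset> I")
  case True
  then have "curvature n (gauge n I0 b Y) I =
      curvature n Y I + 2 *s d (sum n I - 1) (gauge_change n I0 b Y I)"
    using assms by (intro curvature_gauge)
  then show ?thesis
    using assms(3) by (simp add: mc_at_def gauge_def d_add scale_right_distrib)
next
  case False
  then have "d (sum n I - 1) (gauge_change n I0 b Y I) = 0"
    by (simp add: gauge_change_def d_d)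
  then show ?thesis
    using assms(3) curvature_gauge_other[OF assms(2) False]
    by (simp add: mc_at_def gauge_def d_add)
qed

lemma gauge_mem:
  assumes "finite J" and "Y J \<in> V (sum n J - 1)"
  shows "gauge n I0 b Y J \<in> V (sum n J - 1)"
proof -
  have "br (sum n I0) (sum n (J - I0) - 1) b (Y (J - I0)) \<in> V (sum n J - 1)" if "I0 \<subset> J"
  proof -
    have "sum n J - 1 = sum n I0 + (sum n (J - I0) - 1)"
      using that assms(1) by (simp add: sum.subset_diff[of I0 J] psubset_imp_subset)
    then show ?thesis by (metis br_mem)
  qed
  then have "gauge_change n I0 b Y J \<in> V (sum n J - 1)"
    by (auto simp: gauge_change_def d_mem intro: subspace_scale[OF V_subspace] subspace_0[OF V_subspace])
  then show ?thesis
    unfolding gauge_def using assms(2) by (intro subspace_add[OF V_subspace])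
qed

end

definition (in total_dgl) solution :: "(nat \<Rightarrow> int) \<Rightarrow> nat set \<Rightarrow> (nat set \<Rightarrow> 'b) \<Rightarrow> bool" where
  "solution n T Y \<longleftrightarrow> (\<forall>J. J \<subset> T \<longrightarrow> J \<noteq> {} \<longrightarrow> Y J \<in> V (sum n J - 1) \<and> mc_at n Y J)"

lemma (in total_dgl) solution_gauge:
  assumes "solution n T Y" and "finite T" and "I0 \<noteq> {}"
  shows "solution n T (gauge n I0 b Y)"
  unfolding solution_def
proof (intro allI impI conjI)
  fix J assume J: "J \<subset> T" "J \<noteq> {}"
  then have fin: "finite J" using assms finite_subset by blast
  show "gauge n I0 b Y J \<in> V (sum n J - 1)"
    using assms J fin by (intro gauge_mem) (auto simp: solution_def)
  have "mc_at n Y (J - I0)" if "I0 \<subset> J"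
  proof -
    have "J - I0 \<subset> T" "J - I0 \<noteq> {}" using that J by auto
    then show ?thesis using assms(1) by (simp add: solution_def)
  qed
  then show "mc_at n (gauge n I0 b Y) J"
    using assms J fin by (intro mc_at_gauge) (auto simp: solution_def)
qed

section \<open>Lifting solutions along quasi-isomorphisms\<close>

locale total_dgl_map =
  L: total_dgl scaleL VL brL dL + M: total_dgl scaleM VM brM dM
  for scaleL :: "rat \<Rightarrow> 'b \<Rightarrow> 'b :: ab_group_add" and VL brL dL
    and scaleM :: "rat \<Rightarrow> 'c \<Rightarrow> 'c :: ab_group_add" and VM brM dM +
  fixes f :: "int \<Rightarrow> 'b \<Rightarrow> 'c"
  assumes f_mem: "f m a \<in> VM m"
    and f_add: "f m (a + b) = f m a + f m b"
    and f_scale: "f m (scaleL r a) = scaleM r (f m a)"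
    and f_br: "f (l + m) (brL l m a b) = brM l m (f l a) (f m b)"
    and f_d: "f (m - 1) (dL m a) = dM m (f m a)"
begin

lemma f_zero [simp]: "f m 0 = 0"
  using f_scale[of m 0 0] by simp

lemma f_sum: "f m (sum g A) = (\<Sum>x\<in>A. f m (g x))"
  by (induction A rule: infinite_finite_induct) (simp_all add: f_add)

lemma f_diff: "f m (a - b) = f m a - f m b"
  using f_add[of m "a - b" b] by (simp add: eq_diff_eq)

lemma f_curvature:
  assumes "finite I"
  shows "f (sum n I - 2) (L.curvature n Y I) = M.curvature n (\<lambda>J. f (sum n J - 1) (Y J)) I"
  unfolding L.curvature_def M.curvature_def f_sum
proof (intro sum.cong refl, clarify)
  fix J K assume "(J, K) \<in> splits I"
  then have "sum n I - 2 = (sum n J - 1) + (sum n K - 1)"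
    using assms by (auto simp: splits_def sum.union_disjoint)
  then show "f (sum n I - 2) (L.pairing n Y Y J K) =
      M.pairing n (\<lambda>J. f (sum n J - 1) (Y J)) (\<lambda>J. f (sum n J - 1) (Y J)) J K"
    by (simp only: L.pairing_def M.pairing_def f_scale f_br)
qed

end

text \<open>Injectivity and surjectivity on homology, phrased for elements. The primitives
  \<open>c\<close> and \<open>e\<close> in the target range over the whole type, as
  \<open>dM\<close> does.\<close>

locale total_quasi_iso = total_dgl_map +
  assumes f_reflects_boundary: "a \<in> VL m \<Longrightarrow> dL m a = 0 \<Longrightarrow> f m a = dM (m + 1) c \<Longrightarrow>
      \<exists>e. e \<in> VL (m + 1) \<and> a = dL (m + 1) e"
    and f_hits_cycle: "c \<in> VM m \<Longrightarrow> dM m c = 0 \<Longrightarrow>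
      \<exists>a e. a \<in> VL m \<and> dL m a = 0 \<and> f m a = c + dM (m + 1) e"
begin

text \<open>Half the curvature of Y at I is a cycle by the Bianchi identity, and its image bounds Z
  I. Injectivity on homology makes it a boundary, which solves the equation for the new
  component.\<close>

lemma lift_step:
  assumes "finite I"
    and Y: "\<And>J. J \<subset> I \<Longrightarrow> J \<noteq> {} \<Longrightarrow> L.mc_at n Y J \<and> f (sum n J - 1) (Y J) = Z J"
    and Z: "Z I \<in> VM (sum n I - 1)" "M.mc_at n Z I"
  shows "\<exists>a b. a \<in> VL (sum n I - 1) \<and> dL (sum n I - 1) a = scaleL (1/2) (L.curvature n Y I) \<and>
    f (sum n I - 1) a = Z I + dM (sum n I) b"
proof -
  define m where "m = sum n I - 1"
  have m: "sum n I - 1 = m" "sum n I - 2 = m - 1" "sum n I = m + 1" by (auto simp: m_def)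
  define w where "w = scaleL (1/2) (L.curvature n Y I)"
  have "w \<in> VL (m - 1)"
    unfolding w_def using L.curvature_mem[OF assms(1), of n Y] m by (simp add: L.subspace_scale L.V_subspace)
  moreover have "dL (m - 1) w = 0"
    using L.d_curvature[OF assms(1), of n Y] Y m by (simp add: w_def L.d_scale)
  moreover have "f (m - 1) w = dM (m - 1 + 1) (Z I)"
  proof -
    have "f (m - 1) w = scaleM (1/2) (M.curvature n (\<lambda>J. f (sum n J - 1) (Y J)) I)"
      using f_curvature[OF assms(1), of n Y] m by (simp add: w_def f_scale)
    also have "M.curvature n (\<lambda>J. f (sum n J - 1) (Y J)) I = M.curvature n Z I"
      using Y by (intro M.curvature_cong) auto
    finally show ?thesis using Z(2) m by (simp add: M.mc_at_def)
  qed
  ultimately obtain e where e: "e \<in> VL m" "w = dL m e"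
    using f_reflects_boundary[of w "m - 1" "Z I"] by auto
  \<comment> \<open>The first solution \<open>e\<close> may miss Z I by a cycle that is no boundary.
    Surjectivity on homology supplies a cycle of the source by which \<open>e\<close> is corrected,
    leaving only a boundary as error.\<close>
  have "f m e - Z I \<in> VM m"
    using Z(1) m by (simp add: M.subspace_diff M.V_subspace f_mem)
  moreover have "dM m (f m e - Z I) = 0"
    using \<open>f (m - 1) w = _\<close> by (simp add: M.d_diff e(2) f_d)
  ultimately obtain a' e' where a': "a' \<in> VL m" "dL m a' = 0" "f m a' = f m e - Z I + dM (m + 1) e'"
    using f_hits_cycle by blast
  have "e - a' \<in> VL m" "dL m (e - a') = w"
    using e a' by (simp_all add: L.subspace_diff L.V_subspace L.d_diff)
  moreover have "f m (e - a') = Z I + dM (m + 1) (- e')"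
    by (simp add: f_diff a'(3) M.d_minus)
  ultimately show ?thesis unfolding m(1) w_def m(3)[symmetric] by blast
qed

text \<open>Induction over downward closed sets of indices on which the lift is exact. Both Y and
  the target change along the way: Z' stays in the gauge orbit of Z, so its obstruction and its
  values on singletons move by boundaries only.\<close>

lemma lift_solution_partial:
  assumes T: "finite T" and Z: "M.solution n T Z"
    and z: "\<And>i. i \<in> T \<Longrightarrow> z i \<in> VL (n i - 1) \<and> dL (n i - 1) (z i) = 0"
    and zZ: "\<And>i. i \<in> T \<Longrightarrow> \<exists>b. f (n i - 1) (z i) = Z {i} + dM (n i) b"
    and S: "\<And>J. J \<in> S \<Longrightarrow> J \<subset> T \<and> J \<noteq> {}" "\<And>J K. J \<in> S \<Longrightarrow> K \<subseteq> J \<Longrightarrow> K \<noteq> {} \<Longrightarrow> K \<in> S"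
  shows "\<exists>Y Z'. M.solution n T Z' \<and>
    (\<forall>J\<in>S. Y J \<in> VL (sum n J - 1) \<and> L.mc_at n Y J \<and> f (sum n J - 1) (Y J) = Z' J) \<and>
    (\<forall>i. {i} \<in> S \<longrightarrow> Y {i} = z i) \<and>
    (\<forall>i\<in>T. \<exists>b. f (n i - 1) (z i) = Z' {i} + dM (n i) b) \<and>
    (\<exists>c. M.curvature n Z T = M.curvature n Z' T + dM (sum n T - 1) c)"
  using S
proof (induction "card S" arbitrary: S)
  case 0
  have "finite S"
    using T 0(2) by (intro finite_subset[of S "Pow T"]) auto
  then have "S = {}" using 0 by simp
  then show ?case
    using Z zZ M.d_zero[of "sum n T - 1"]
    by (intro exI[of _ "\<lambda>_. 0"] exI[of _ Z] conjI exI[of _ 0]) simp_all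
next
  case (Suc N)
  have "finite S"
    using T Suc(3) by (intro finite_subset[of S "Pow T"]) auto
  moreover have "S \<noteq> {}" using Suc(2) by auto
  \<comment> \<open>A member of maximal size is lifted last: no other member contains it, so the
    gauge transformation at I leaves the components already matched untouched.\<close>
  ultimately have "Max (card ` S) \<in> card ` S" by (intro Max_in) auto
  then obtain I where I: "I \<in> S" and "card I = Max (card ` S)" by force
  then have max: "card J \<le> card I" if "J \<in> S" for J
    using \<open>finite S\<close> that by simp
  have fins: "finite J" if "J \<in> S" for J
    using Suc(3)[OF that] T finite_subset by blast
  have notsub: "\<not> I \<subseteq> J" if "J \<in> S - {I}" for J
    using max[of J] that fins[of J] card_seteq[of J I] by auto
  have IT: "I \<subset> T" "I \<noteq> {}" using Suc(3)[OF I] by auto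
  have sub: "J \<in> S - {I}" if "J \<subset> I" "J \<noteq> {}" for J
    using Suc(4)[OF I, of J] that by auto
  have "N = card (S - {I})" using Suc(2) I by simp
  moreover have "J \<subset> T \<and> J \<noteq> {}" if "J \<in> S - {I}" for J
    using Suc(3)[of J] that by simp
  moreover have "K \<in> S - {I}" if "J \<in> S - {I}" "K \<subseteq> J" "K \<noteq> {}" for J K
    using Suc(4)[of J K] that notsub[OF that(1)] by auto
  ultimately obtain Y Z' where IH: "M.solution n T Z' \<and>
      (\<forall>J\<in>S - {I}. Y J \<in> VL (sum n J - 1) \<and> L.mc_at n Y J \<and> f (sum n J - 1) (Y J) = Z' J) \<and>
      (\<forall>i. {i} \<in> S - {I} \<longrightarrow> Y {i} = z i) \<and>
      (\<forall>i\<in>T. \<exists>b. f (n i - 1) (z i) = Z' {i} + dM (n i) b) \<and>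
      (\<exists>c. M.curvature n Z T = M.curvature n Z' T + dM (sum n T - 1) c)"
    using Suc(1)[of "S - {I}"] by blast
  then obtain c where c: "M.curvature n Z T = M.curvature n Z' T + dM (sum n T - 1) c"
    by blast
  from IH have Z': "M.solution n T Z'" by blast
  from IH have Y: "\<And>J. J \<in> S - {I} \<Longrightarrow>
      Y J \<in> VL (sum n J - 1) \<and> L.mc_at n Y J \<and> f (sum n J - 1) (Y J) = Z' J"
    by blast
  from IH have Yz: "\<And>i. {i} \<in> S - {I} \<Longrightarrow> Y {i} = z i" by blast
  from IH have zZ': "\<And>i. i \<in> T \<Longrightarrow> \<exists>b. f (n i - 1) (z i) = Z' {i} + dM (n i) b" by blast
  have Z'I: "Z' I \<in> VM (sum n I - 1)" "M.mc_at n Z' I"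
    using Z' IT by (auto simp: M.solution_def)
  \<comment> \<open>At a singleton the prescribed cycle must be taken; it solves the equation
    because a singleton has no splitting. All other components come from
    \<open>lift_step\<close>.\<close>
  have "\<exists>a b. a \<in> VL (sum n I - 1) \<and> dL (sum n I - 1) a = scaleL (1/2) (L.curvature n Y I) \<and>
    f (sum n I - 1) a = Z' I + dM (sum n I) b \<and> (\<forall>i. I = {i} \<longrightarrow> a = z i)"
  proof (cases "\<exists>i. I = {i}")
    case True
    then obtain i where i: "I = {i}" by auto
    have "splits {i} = {}" by (auto simp: splits_def Un_singleton_iff)
    then have "L.curvature n Y I = 0" by (simp add: L.curvature_def i)
    then show ?thesis using z[of i] zZ'[of i] IT by (intro exI[of _ "z i"]) (auto simp: i)
  next
    case False
    have "finite I" using fins I by auto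
    have "\<exists>a b. a \<in> VL (sum n I - 1) \<and> dL (sum n I - 1) a = scaleL (1/2) (L.curvature n Y I) \<and>
        f (sum n I - 1) a = Z' I + dM (sum n I) b"
      using Y[OF sub] by (intro lift_step \<open>finite I\<close> Z'I) simp
    then show ?thesis using False by metis
  qed
  then obtain a b where a: "a \<in> VL (sum n I - 1)"
      "dL (sum n I - 1) a = scaleL (1/2) (L.curvature n Y I)"
      "f (sum n I - 1) a = Z' I + dM (sum n I) b" "\<And>i. I = {i} \<Longrightarrow> a = z i"
    by blast
  \<comment> \<open>The gauge transformation by b adds exactly the error dM b to the component at
    I.\<close>
  define Z'' where "Z'' = M.gauge n I b Z'"
  define Y' where "Y' = Y(I := a)"
  have Z''I: "Z'' I = f (sum n I - 1) a"
    by (simp add: Z''_def M.gauge_def M.gauge_change_def a)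
  have Z''J: "Z'' J = Z' J" if "\<not> I \<subseteq> J" for J
    using that by (auto simp: Z''_def M.gauge_def M.gauge_change_def)
  have curv: "L.curvature n Y' J = L.curvature n Y J" if "J \<in> S" for J
  proof (rule L.curvature_cong)
    fix K assume "K \<subset> J" "K \<noteq> {}"
    then have "K \<noteq> I" using notsub[of J] that by (cases "J = I") auto
    then show "Y' K = Y K" by (simp add: Y'_def)
  qed
  show ?case
  proof (intro exI[of _ Y'] exI[of _ Z''] conjI ballI allI impI)
    show "M.solution n T Z''"
      unfolding Z''_def using Z' T IT by (intro M.solution_gauge)
  next
    fix J assume J: "J \<in> S"
    show "Y' J \<in> VL (sum n J - 1)"
      using Y[of J] a(1) J by (cases "J = I") (simp_all add: Y'_def)
    show "L.mc_at n Y' J"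
    proof (cases "J = I")
      case True
      then show ?thesis using curv[OF J] a(2) by (simp add: L.mc_at_def Y'_def)
    next
      case False
      then show ?thesis using curv[OF J] Y[of J] J by (simp add: L.mc_at_def Y'_def)
    qed
    show "f (sum n J - 1) (Y' J) = Z'' J"
      using Y[of J] J Z''I Z''J[OF notsub, of J] by (cases "J = I") (simp_all add: Y'_def)
  next
    fix i assume "{i} \<in> S"
    then show "Y' {i} = z i"
      using Yz[of i] a(4)[of i] by (cases "I = {i}") (simp_all add: Y'_def)
  next
    fix i assume "i \<in> T"
    then obtain b0 where b0: "f (n i - 1) (z i) = Z' {i} + dM (n i) b0" using zZ' by blast
    show "\<exists>b. f (n i - 1) (z i) = Z'' {i} + dM (n i) b"
    proof (cases "I = {i}")
      case True
      then have "f (n i - 1) (z i) = Z'' {i} + dM (n i) (b0 - b)"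
        unfolding Z''_def using b0 by (simp add: M.gauge_def M.gauge_change_def M.d_diff)
      then show ?thesis by blast
    next
      case False
      then have "\<not> I \<subseteq> {i}" using IT by auto
      then show ?thesis using b0 Z''J by auto
    qed
  next
    \<comment> \<open>The equation at T - I, which is a proper non-empty subset, is what makes the
      obstruction at T change by a boundary.\<close>
    have "I \<subset> T" "T - I \<subset> T" "T - I \<noteq> {}" using IT by auto
    then have "M.curvature n Z'' T = M.curvature n Z' T +
        scaleM 2 (dM (sum n T - 1) (M.gauge_change n I b Z' T))"
      unfolding Z''_def using Z' T IT by (intro M.curvature_gauge) (auto simp: M.solution_def)
    then have "M.curvature n Z T = M.curvature n Z'' T +
        dM (sum n T - 1) (c - scaleM 2 (M.gauge_change n I b Z' T))"
      using c by (simp add: M.d_diff M.d_scale)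
    then show "\<exists>c. M.curvature n Z T = M.curvature n Z'' T + dM (sum n T - 1) c" by blast
  qed
qed

text \<open>All proper non-empty subsets of T are lifted; since T is no singleton, every {i} is
  among them.\<close>

lemma lift_solution:
  assumes T: "finite T" "\<And>i. T \<noteq> {i}" and Z: "M.solution n T Z"
    and z: "\<And>i. i \<in> T \<Longrightarrow> z i \<in> VL (n i - 1) \<and> dL (n i - 1) (z i) = 0"
    and zZ: "\<And>i. i \<in> T \<Longrightarrow> \<exists>b. f (n i - 1) (z i) = Z {i} + dM (n i) b"
  shows "\<exists>Y c. L.solution n T Y \<and> (\<forall>i\<in>T. Y {i} = z i) \<and>
    M.curvature n Z T = f (sum n T - 2) (L.curvature n Y T) + dM (sum n T - 1) c"
proof -
  obtain Y Z' c where Y: "\<forall>J\<in>{J. J \<subset> T \<and> J \<noteq> {}}.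
      Y J \<in> VL (sum n J - 1) \<and> L.mc_at n Y J \<and> f (sum n J - 1) (Y J) = Z' J"
    and Yz: "\<And>i. {i} \<in> {J. J \<subset> T \<and> J \<noteq> {}} \<Longrightarrow> Y {i} = z i"
    and c: "M.curvature n Z T = M.curvature n Z' T + dM (sum n T - 1) c"
    using lift_solution_partial[OF T(1) Z z zZ, of "{J. J \<subset> T \<and> J \<noteq> {}}"] by blast
  have "f (sum n T - 2) (L.curvature n Y T) = M.curvature n Z' T"
    unfolding f_curvature[OF T(1)] using Y by (intro M.curvature_cong) auto
  moreover have "Y {i} = z i" if "i \<in> T" for i
    using that T(2)[of i] by (intro Yz) auto
  moreover have "L.solution n T Y"
    using Y by (auto simp: L.solution_def)
  ultimately show ?thesis using c by (intro exI[of _ Y] exI[of _ c]) simp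
qed

end

section \<open>Embedding of modules over the rationals\<close>

definition pscale :: "rat \<Rightarrow> ('g \<Rightarrow>\<^sub>0 rat) \<Rightarrow> ('g \<Rightarrow>\<^sub>0 rat)" where
  "pscale c p = Poly_Mapping.map ((*) c) p"

lemma comb_scale_eq: "comb_scale = pscale"
  by (simp add: fun_eq_iff comb_scale_def pscale_def)

lemma lookup_pscale [simp]: "Poly_Mapping.lookup (pscale c p) x = c * Poly_Mapping.lookup p x"
  by (simp add: pscale_def Poly_Mapping.map.rep_eq when_def)

lemma vector_space_pscale: "vector_space pscale"
  by unfold_locales (rule poly_mapping_eqI, simp add: lookup_add algebra_simps)+

lemma pscale_single: "pscale c (Poly_Mapping.single x r) = Poly_Mapping.single x (c * r)"
  by (rule poly_mapping_eqI) (simp add: lookup_single when_def)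

lemma keys_pscale: "Poly_Mapping.keys (pscale c p) \<subseteq> Poly_Mapping.keys p"
  by (auto simp: in_keys_iff)

text \<open>The linear map on the free vector space that is given by \<open>h\<close> on the
  basis.\<close>

definition lext :: "(rat \<Rightarrow> 'b \<Rightarrow> 'b) \<Rightarrow> ('g \<Rightarrow> 'b) \<Rightarrow> ('g \<Rightarrow>\<^sub>0 rat) \<Rightarrow> 'b :: comm_monoid_add" where
  "lext s h p = (\<Sum>x\<in>Poly_Mapping.keys p. s (Poly_Mapping.lookup p x) (h x))"

context
  fixes s :: "rat \<Rightarrow> 'b \<Rightarrow> 'b :: ab_group_add"
  assumes vs: "vector_space s"
begin

interpretation vector_space s by (fact vs)

lemma lext_superset:
  "finite S \<Longrightarrow> Poly_Mapping.keys p \<subseteq> S \<Longrightarrow> lext s h p = (\<Sum>x\<in>S. s (Poly_Mapping.lookup p x) (h x))"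
  unfolding lext_def by (rule sum.mono_neutral_left) (auto simp: in_keys_iff)

lemma lext_add: "lext s h (p + q) = lext s h p + lext s h q"
proof -
  let ?S = "Poly_Mapping.keys p \<union> Poly_Mapping.keys q"
  have "Poly_Mapping.keys (p + q) \<subseteq> ?S" by (rule keys_add)
  then have "lext s h r = (\<Sum>x\<in>?S. s (Poly_Mapping.lookup r x) (h x))" if "r \<in> {p, q, p + q}" for r
    using that by (intro lext_superset) auto
  then show ?thesis
    by (simp add: lookup_add scale_left_distrib sum.distrib)
qed

lemma lext_pscale: "lext s h (pscale c p) = s c (lext s h p)"
  by (subst lext_superset[of "Poly_Mapping.keys p"])
    (simp_all add: keys_pscale lext_def scale_sum_right)

lemma lext_single: "lext s h (Poly_Mapping.single x c) = s c (h x)"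
  by (subst lext_superset[of "{x}"]) simp_all

lemma lext_zero: "lext s h 0 = 0"
  by (simp add: lext_def)

lemma lext_sum: "lext s h (sum g A) = (\<Sum>a\<in>A. lext s h (g a))"
  by (induction A rule: infinite_finite_induct) (simp_all add: lext_add lext_zero)

lemma lext_uminus: "lext s h (- p) = - lext s h p"
  using lext_add[of h p "- p"] lext_zero[of h] by (simp add: eq_neg_iff_add_eq_0 add.commute)

lemma lext_diff: "lext s h (p - q) = lext s h p - lext s h q"
  using lext_add[of h p "- q"] by (simp add: lext_uminus)

end

lemma lext_single_one: "lext pscale (\<lambda>x. Poly_Mapping.single x 1) p = p"
  by (rule poly_mapping_eqI) (auto simp: lext_def lookup_sum lookup_single when_def
      sum.delta in_keys_iff if_distrib cong: if_cong)

lemma rat_field_simps [simp]: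
  "carrier rat_field = UNIV" "a \<otimes>\<^bsub>rat_field\<^esub> b = a * b" "a \<oplus>\<^bsub>rat_field\<^esub> b = a + b"
  "\<one>\<^bsub>rat_field\<^esub> = 1" "\<zero>\<^bsub>rat_field\<^esub> = 0"
  by (simp_all add: ring_of_type_algebra_def)

context
  fixes M :: "(rat, 'a) module"
  assumes M: "module rat_field M"
begin

interpretation M: module rat_field M by (fact M)

text \<open>Basis vectors outside the carrier are dropped, so that evaluation is a total linear map
  whose values always lie in the carrier.\<close>

definition evaluate :: "('a \<Rightarrow>\<^sub>0 rat) \<Rightarrow> 'a" where
  "evaluate p = (\<Oplus>\<^bsub>M\<^esub>a\<in>Poly_Mapping.keys p \<inter> carrier M. Poly_Mapping.lookup p a \<odot>\<^bsub>M\<^esub> a)"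

lemma evaluate_superset:
  assumes "finite S" and "Poly_Mapping.keys p \<subseteq> S"
  shows "evaluate p = (\<Oplus>\<^bsub>M\<^esub>a\<in>S \<inter> carrier M. Poly_Mapping.lookup p a \<odot>\<^bsub>M\<^esub> a)"
  unfolding evaluate_def
  by (rule M.add.finprod_mono_neutral_cong_left)
    (use assms in \<open>auto simp: in_keys_iff M.smult_l_null[simplified]\<close>)

lemma evaluate_mem: "evaluate p \<in> carrier M"
  unfolding evaluate_def by (rule M.finsum_closed) auto

lemma evaluate_add: "evaluate (p + q) = evaluate p \<oplus>\<^bsub>M\<^esub> evaluate q"
proof -
  let ?S = "Poly_Mapping.keys p \<union> Poly_Mapping.keys q"
  have "Poly_Mapping.keys (p + q) \<subseteq> ?S" by (rule keys_add)
  then have *: "evaluate r = (\<Oplus>\<^bsub>M\<^esub>a\<in>?S \<inter> carrier M. Poly_Mapping.lookup r a \<odot>\<^bsub>M\<^esub> a)"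
    if "r \<in> {p, q, p + q}" for r
    using that by (intro evaluate_superset) auto
  have "evaluate (p + q) =
      (\<Oplus>\<^bsub>M\<^esub>a\<in>?S \<inter> carrier M. Poly_Mapping.lookup (p + q) a \<odot>\<^bsub>M\<^esub> a)"
    by (intro * ) simp
  also have "\<dots> = (\<Oplus>\<^bsub>M\<^esub>a\<in>?S \<inter> carrier M.
      (Poly_Mapping.lookup p a \<odot>\<^bsub>M\<^esub> a) \<oplus>\<^bsub>M\<^esub> (Poly_Mapping.lookup q a \<odot>\<^bsub>M\<^esub> a))"
    by (rule M.finsum_cong') (auto simp: lookup_add M.smult_l_distr[simplified])
  also have "\<dots> = evaluate p \<oplus>\<^bsub>M\<^esub> evaluate q"
    by (subst M.finsum_addf) (auto simp: * )
  finally show ?thesis .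
qed

lemma evaluate_pscale: "evaluate (pscale c p) = c \<odot>\<^bsub>M\<^esub> evaluate p"
proof -
  have "evaluate (pscale c p) =
      (\<Oplus>\<^bsub>M\<^esub>a\<in>Poly_Mapping.keys p \<inter> carrier M. c \<odot>\<^bsub>M\<^esub> (Poly_Mapping.lookup p a \<odot>\<^bsub>M\<^esub> a))"
    by (subst evaluate_superset[of "Poly_Mapping.keys p"])
      (auto simp: keys_pscale M.smult_assoc1[simplified] intro!: M.finsum_cong')
  then show ?thesis
    unfolding evaluate_def
    by (subst M.finsum_smult_ldistr) auto
qed

lemma evaluate_single: "a \<in> carrier M \<Longrightarrow> evaluate (Poly_Mapping.single a 1) = a"
  by (subst evaluate_superset[of "{a}"]) (auto simp: M.smult_one[simplified])

text \<open>
  \<open>\<iota>\<close> is the restriction to the elements of \<open>M\<close> of a projection of the free vector space on \<open>M\<close>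
  whose kernel is that of the evaluation.
\<close>

lemma embedding_exists:
  "\<exists>\<iota>. (\<forall>a\<in>carrier M. evaluate (\<iota> a) = a) \<and>
    (\<forall>a\<in>carrier M. \<forall>b\<in>carrier M. \<iota> (a \<oplus>\<^bsub>M\<^esub> b) = \<iota> a + \<iota> b) \<and>
    (\<forall>c. \<forall>a\<in>carrier M. \<iota> (c \<odot>\<^bsub>M\<^esub> a) = (pscale c (\<iota> a) :: 'a \<Rightarrow>\<^sub>0 rat))"
proof -
  interpret F: vector_space "pscale :: rat \<Rightarrow> ('a \<Rightarrow>\<^sub>0 rat) \<Rightarrow> _" by (rule vector_space_pscale)
  interpret FF: vector_space_pair "pscale :: rat \<Rightarrow> ('a \<Rightarrow>\<^sub>0 rat) \<Rightarrow> _" "pscale :: rat \<Rightarrow> ('a \<Rightarrow>\<^sub>0 rat) \<Rightarrow> _" ..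
  define Z where "Z = {p. evaluate p = \<zero>\<^bsub>M\<^esub>}"
  have zero: "evaluate 0 = \<zero>\<^bsub>M\<^esub>" by (simp add: evaluate_def)
  have sub: "F.subspace Z"
    unfolding F.subspace_def by (auto simp: Z_def zero evaluate_add evaluate_pscale M.smult_r_null[simplified])
  have "Vector_Spaces.linear pscale pscale (\<lambda>p :: 'a \<Rightarrow>\<^sub>0 rat. p)" by (rule F.linear_ident)
  \<comment> \<open>A left inverse, with range in \<open>Z\<close>, of the identity restricted to
    \<open>Z\<close> is a projection of the whole space onto \<open>Z\<close>.\<close>
  from FF.linear_exists_left_inverse_on[OF this sub]
  obtain g where g: "range g \<subseteq> Z" "Vector_Spaces.linear pscale pscale g" "\<And>p. p \<in> Z \<Longrightarrow> g p = p"
    by auto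
  interpret g: Vector_Spaces.linear pscale pscale g by (fact g(2))
  define \<iota> where "\<iota> a = Poly_Mapping.single a 1 - g (Poly_Mapping.single a 1)" for a
  have ev_g: "evaluate (g p) = \<zero>\<^bsub>M\<^esub>" for p using g(1) by (auto simp: Z_def)
  have ev_minus: "evaluate (- p) = \<ominus>\<^bsub>M\<^esub> evaluate p" for p
    using evaluate_add[of "- p" p] by (simp add: zero evaluate_mem M.minus_equality)
  \<comment> \<open>The difference of p and its projection depends only on the evaluation of p,
    since g fixes the kernel. Linearity of the embedding is thereby inherited from the
    evaluation.\<close>
  have eqI: "p - g p = q - g q" if "evaluate p = evaluate q" for p q
  proof -
    have "evaluate (p - q) = \<zero>\<^bsub>M\<^esub>"
      using evaluate_add[of p "- q"] that by (simp add: ev_minus evaluate_mem M.r_neg)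
    then have "g (p - q) = p - q" by (intro g(3)) (simp add: Z_def)
    then show ?thesis by (simp add: g.diff algebra_simps)
  qed
  show ?thesis
  proof (intro exI[of _ \<iota>] conjI allI ballI)
    fix a assume a: "a \<in> carrier M"
    show "evaluate (\<iota> a) = a"
      using evaluate_add[of "Poly_Mapping.single a 1" "- g (Poly_Mapping.single a 1)"] a
      by (simp add: \<iota>_def ev_minus ev_g evaluate_single)
    show "\<iota> (a \<oplus>\<^bsub>M\<^esub> b) = \<iota> a + \<iota> b" if "b \<in> carrier M" for b
      using eqI[of "Poly_Mapping.single (a \<oplus>\<^bsub>M\<^esub> b) 1" "Poly_Mapping.single a 1 + Poly_Mapping.single b 1"] a that
      by (simp add: \<iota>_def evaluate_single evaluate_add g.add)
    show "\<iota> (c \<odot>\<^bsub>M\<^esub> a) = pscale c (\<iota> a)" for c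
      using eqI[of "Poly_Mapping.single (c \<odot>\<^bsub>M\<^esub> a) 1" "pscale c (Poly_Mapping.single a 1)"] a
      by (simp add: \<iota>_def evaluate_single evaluate_pscale g.scale F.scale_right_diff_distrib)
  qed
qed

end

definition embed :: "(rat, 'a) module \<Rightarrow> 'a \<Rightarrow> 'a \<Rightarrow>\<^sub>0 rat" where
  "embed M = (SOME \<iota>. (\<forall>a\<in>carrier M. evaluate M (\<iota> a) = a) \<and>
    (\<forall>a\<in>carrier M. \<forall>b\<in>carrier M. \<iota> (a \<oplus>\<^bsub>M\<^esub> b) = \<iota> a + \<iota> b) \<and>
    (\<forall>c. \<forall>a\<in>carrier M. \<iota> (c \<odot>\<^bsub>M\<^esub> a) = pscale c (\<iota> a)))"

lemma
  assumes "module rat_field M"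
  shows evaluate_embed: "a \<in> carrier M \<Longrightarrow> evaluate M (embed M a) = a"
    and embed_add: "a \<in> carrier M \<Longrightarrow> b \<in> carrier M \<Longrightarrow> embed M (a \<oplus>\<^bsub>M\<^esub> b) = embed M a + embed M b"
    and embed_smult: "a \<in> carrier M \<Longrightarrow> embed M (c \<odot>\<^bsub>M\<^esub> a) = pscale c (embed M a)"
  using someI_ex[OF embedding_exists[OF assms]] unfolding embed_def[symmetric] by blast+

section \<open>Totalization of a differential graded Lie algebra\<close>

abbreviation ev :: "'a dg_data \<Rightarrow> int \<Rightarrow> ('a \<Rightarrow>\<^sub>0 rat) \<Rightarrow> 'a" where
  "ev L m \<equiv> evaluate (piece L m)"

abbreviation em :: "'a dg_data \<Rightarrow> int \<Rightarrow> 'a \<Rightarrow> 'a \<Rightarrow>\<^sub>0 rat" where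
  "em L m \<equiv> embed (piece L m)"

definition total_piece :: "'a dg_data \<Rightarrow> int \<Rightarrow> ('a \<Rightarrow>\<^sub>0 rat) set" where
  "total_piece L m = em L m ` carrier (piece L m)"

text \<open>Evaluating the arguments first makes the operation bilinear on the whole free vector
  space, also off the embedded components.\<close>

definition total_bracket :: "'a dg_data \<Rightarrow> int \<Rightarrow> int \<Rightarrow> ('a \<Rightarrow>\<^sub>0 rat) \<Rightarrow> ('a \<Rightarrow>\<^sub>0 rat) \<Rightarrow> 'a \<Rightarrow>\<^sub>0 rat" where
  "total_bracket L l m p q = em L (l + m) (bracket L l m (ev L l p) (ev L m q))"

definition total_diff :: "'a dg_data \<Rightarrow> int \<Rightarrow> ('a \<Rightarrow>\<^sub>0 rat) \<Rightarrow> 'a \<Rightarrow>\<^sub>0 rat" where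
  "total_diff L m p = em L (m - 1) (diff L m (ev L m p))"

lemma linear_mapD:
  assumes "linear_map M N f"
  shows "a \<in> carrier M \<Longrightarrow> f a \<in> carrier N"
    and "a \<in> carrier M \<Longrightarrow> b \<in> carrier M \<Longrightarrow> f (a \<oplus>\<^bsub>M\<^esub> b) = f a \<oplus>\<^bsub>N\<^esub> f b"
    and "a \<in> carrier M \<Longrightarrow> f (c \<odot>\<^bsub>M\<^esub> a) = c \<odot>\<^bsub>N\<^esub> f a"
  using assms by (auto simp: linear_map_def)

context dgl
begin

lemma abelian_group_piece: "abelian_group (piece L m)"
  using vector_space[of m] by (simp add: module_def)

lemmas ev_mem = evaluate_mem[OF vector_space]
  and ev_add = evaluate_add[OF vector_space]
  and ev_pscale = evaluate_pscale[OF vector_space]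
  and ev_em = evaluate_embed[OF vector_space]
  and em_add = embed_add[OF vector_space]
  and em_smult = embed_smult[OF vector_space]

lemmas add_mem = abelian_monoid.a_closed[OF abelian_group.axioms(1)[OF abelian_group_piece]]
  and zero_mem = abelian_monoid.zero_closed[OF abelian_group.axioms(1)[OF abelian_group_piece]]

lemma smult_mem: "a \<in> carrier (piece L m) \<Longrightarrow> c \<odot>\<^bsub>piece L m\<^esub> a \<in> carrier (piece L m)"
  using module.smult_closed[OF vector_space] by simp

lemmas bracket_mem = linear_mapD(1)[OF bracket_linear_right]
  and diff_mem = linear_mapD(1)[OF diff_linear]

lemma ev_zero: "ev L m 0 = \<zero>\<^bsub>piece L m\<^esub>"
  by (simp add: evaluate_def[OF vector_space] abelian_monoid.finsum_empty[OF abelian_group.axioms(1)[OF abelian_group_piece]])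

lemma em_zero: "em L m \<zero>\<^bsub>piece L m\<^esub> = 0"
  using em_add[OF zero_mem zero_mem, of m]
  by (simp add: abelian_monoid.l_zero[OF abelian_group.axioms(1)[OF abelian_group_piece]] zero_mem)

lemma em_eq_iff: "a \<in> carrier (piece L m) \<Longrightarrow> b \<in> carrier (piece L m) \<Longrightarrow> em L m a = em L m b \<longleftrightarrow> a = b"
  using ev_em by metis

text \<open>The composite of evaluation and embedding is idempotent, so membership in the embedded
  component becomes an equation.\<close>

lemma total_piece_iff: "p \<in> total_piece L m \<longleftrightarrow> em L m (ev L m p) = p"
proof
  show "em L m (ev L m p) = p" if "p \<in> total_piece L m"
    using that by (auto simp: total_piece_def ev_em)
  show "p \<in> total_piece L m" if "em L m (ev L m p) = p"
    unfolding total_piece_def using imageI[OF ev_mem[of m p], of "em L m"] that by simp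
qed

lemma em_mem: "a \<in> carrier (piece L m) \<Longrightarrow> em L m a \<in> total_piece L m"
  by (simp add: total_piece_def)

text \<open>Evaluation undoes the embedding, so nested total operations collapse to a single
  embedding of the nested operations of L, and every identity reduces to the axiom for L.\<close>

lemma total_dgl: "total_dgl pscale (total_piece L) (total_bracket L) (total_diff L)"
proof -
  interpret vector_space "pscale :: rat \<Rightarrow> ('a \<Rightarrow>\<^sub>0 rat) \<Rightarrow> _" by (rule vector_space_pscale)
  note br = bracket_mem ev_mem ev_em em_add em_smult add_mem smult_mem diff_mem
  show ?thesis
  proof
    show "subspace (total_piece L m)" for m
      unfolding subspace_def
    proof (intro conjI ballI allI)
      show "0 \<in> total_piece L m" using em_mem[OF zero_mem] by (simp add: em_zero)
      show "p + q \<in> total_piece L m" if "p \<in> total_piece L m" "q \<in> total_piece L m" for p q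
        using that by (simp add: total_piece_iff ev_add em_add ev_mem)
      show "pscale c p \<in> total_piece L m" if "p \<in> total_piece L m" for c p
        using that by (simp add: total_piece_iff ev_pscale em_smult ev_mem)
    qed
    show "total_bracket L l m a b \<in> total_piece L (l + m)" for l m a b
      unfolding total_bracket_def by (intro em_mem br)
    show "total_bracket L l m (a + a') b = total_bracket L l m a b + total_bracket L l m a' b"
      for l m a a' b
      unfolding total_bracket_def
      by (simp add: ev_add linear_mapD(2)[OF bracket_linear_left] br)
    show "total_bracket L l m a (b + b') = total_bracket L l m a b + total_bracket L l m a b'"
      for l m a b b'
      unfolding total_bracket_def
      by (simp add: ev_add linear_mapD(2)[OF bracket_linear_right] br)
    show "total_bracket L l m (pscale r a) b = pscale r (total_bracket L l m a b)" for l m r a b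
      unfolding total_bracket_def
      by (simp add: ev_pscale linear_mapD(3)[OF bracket_linear_left] br)
    show "total_bracket L l m a (pscale r b) = pscale r (total_bracket L l m a b)" for l m r a b
      unfolding total_bracket_def
      by (simp add: ev_pscale linear_mapD(3)[OF bracket_linear_right] br)
    show "total_bracket L l m a b = pscale (- ((-1) powi (l * m))) (total_bracket L m l b a)" for l m a b
    proof -
      have "bracket L m l (ev L m b) (ev L l a) \<in> carrier (piece L (l + m))"
        using bracket_mem[OF ev_mem[of m b] ev_mem[of l a]] by (simp only: add.commute)
      then show ?thesis
        unfolding total_bracket_def add.commute[of m l]
        by (simp only: antisymmetry[OF ev_mem[of l a] ev_mem[of m b]] em_smult)
    qed
    show "total_bracket L j (l + m) a (total_bracket L l m b c) =
      total_bracket L (j + l) m (total_bracket L j l a b) c +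
      pscale ((-1) powi (j * l)) (total_bracket L l (j + m) b (total_bracket L j m a c))" for j l m a b c
    proof -
      \<comment> \<open>The axiom mentions one degree in several groupings; components are indexed
        by degrees, so carriers and embeddings are first rewritten to a common one.\<close>
      have deg: "l + (j + m) = j + l + m" "j + (l + m) = j + l + m" by auto
      have 1: "bracket L (j + l) m (bracket L j l (ev L j a) (ev L l b)) (ev L m c) \<in> carrier (piece L (j + l + m))"
        by (intro bracket_mem ev_mem)
      have 2: "bracket L l (j + m) (ev L l b) (bracket L j m (ev L j a) (ev L m c)) \<in> carrier (piece L (j + l + m))"
        using bracket_mem[OF ev_mem[of l b] bracket_mem[OF ev_mem[of j a] ev_mem[of m c]]] by (simp only: deg)
      show ?thesis
        unfolding total_bracket_def ev_em[OF bracket_mem[OF ev_mem ev_mem]] deg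
        unfolding jacobi[OF ev_mem[of j a] ev_mem[of l b] ev_mem[of m c]]
        by (simp only: em_add[OF 1 smult_mem[OF 2]] em_smult[OF 2])
    qed
    show "total_diff L m a \<in> total_piece L (m - 1)" for m a
      unfolding total_diff_def by (intro em_mem br)
    show "total_diff L m (a + b) = total_diff L m a + total_diff L m b" for m a b
      unfolding total_diff_def by (simp add: ev_add linear_mapD(2)[OF diff_linear] br)
    show "total_diff L m (pscale r a) = pscale r (total_diff L m a)" for m r a
      unfolding total_diff_def by (simp add: ev_pscale linear_mapD(3)[OF diff_linear] br)
    show "total_diff L (m - 1) (total_diff L m a) = 0" for m a
      unfolding total_diff_def using em_zero[of "m - 2"] by (simp add: br diff_diff)
    show "total_diff L (l + m) (total_bracket L l m a b) = total_bracket L (l - 1) m (total_diff L l a) b +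
      pscale ((-1) powi l) (total_bracket L l (m - 1) a (total_diff L m b))" for l m a b
    proof -
      have deg: "l - 1 + m = l + m - 1" "l + (m - 1) = l + m - 1" by auto
      have 1: "bracket L (l - 1) m (diff L l (ev L l a)) (ev L m b) \<in> carrier (piece L (l + m - 1))"
        using bracket_mem[OF diff_mem[OF ev_mem[of l a]] ev_mem[of m b]] by (simp only: deg)
      have 2: "bracket L l (m - 1) (ev L l a) (diff L m (ev L m b)) \<in> carrier (piece L (l + m - 1))"
        using bracket_mem[OF ev_mem[of l a] diff_mem[OF ev_mem[of m b]]] by (simp only: deg)
      show ?thesis
        unfolding total_bracket_def total_diff_def ev_em[OF bracket_mem[OF ev_mem ev_mem]]
          ev_em[OF diff_mem[OF ev_mem]] deg
        unfolding leibniz[OF ev_mem[of l a] ev_mem[of m b]]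
        by (simp only: em_add[OF 1 smult_mem[OF 2]] em_smult[OF 2])
    qed
  qed
qed

end

sublocale dgl \<subseteq> T: total_dgl pscale "total_piece L" "total_bracket L" "total_diff L"
  by (rule total_dgl)

section \<open>Shuffles and splittings\<close>

lemma sorted_list_of_set_strict: "sorted_wrt (<) (xs :: nat list) \<Longrightarrow> sorted_list_of_set (set xs) = xs"
  by (simp add: strict_sorted_iff sorted_list_of_set.idem_if_sorted_distinct)

lemma wh_deg_eq: "sorted_wrt (<) I \<Longrightarrow> wh_deg n I = sum n (set I) - 1"
  by (simp add: wh_deg_def strict_sorted_iff sum_list_distinct_conv_sum_set)

lemma wh_deg_sorted_list: "finite J \<Longrightarrow> wh_deg n (sorted_list_of_set J) = sum n J - 1"
  by (simp add: wh_deg_eq)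

context
  fixes I :: "nat list"
  assumes I: "sorted_wrt (<) I"
begin

lemma nth_less_iff: "a < length I \<Longrightarrow> b < length I \<Longrightarrow> I ! a < I ! b \<longleftrightarrow> a < b"
  using I unfolding sorted_wrt_iff_nth_less by (metis less_asym' not_less_iff_gr_or_eq)

lemma nth_eq_iff: "a < length I \<Longrightarrow> b < length I \<Longrightarrow> I ! a = I ! b \<longleftrightarrow> a = b"
  using I by (simp add: strict_sorted_iff nth_eq_iff_index_eq)

context
  fixes p :: nat and \<sigma> :: "nat \<Rightarrow> nat"
  assumes p: "p \<in> {1..<length I}" and \<sigma>: "\<sigma> \<in> pointed_shuffles p (length I - p)"
begin

lemma shuffle_permutes: "\<sigma> permutes {..<length I}"
  using p \<sigma> by (simp add: pointed_shuffles_def)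

lemma shuffle_less: "j < length I \<Longrightarrow> \<sigma> j < length I"
  using permutes_in_image[OF shuffle_permutes, of j] by simp

lemma shuffle_inj: "\<sigma> a = \<sigma> b \<longleftrightarrow> a = b"
  using permutes_inj[OF shuffle_permutes] by (auto simp: inj_def)

lemma shuffle_mono_left: "a < b \<Longrightarrow> b < p \<Longrightarrow> \<sigma> a < \<sigma> b"
  using \<sigma> by (auto simp: pointed_shuffles_def strict_mono_on_def)

lemma shuffle_mono_right: "p \<le> a \<Longrightarrow> a < b \<Longrightarrow> b < length I \<Longrightarrow> \<sigma> a < \<sigma> b"
  using p \<sigma> by (auto simp: pointed_shuffles_def strict_mono_on_def)

lemma sorted_left: "sorted_wrt (<) (map (\<lambda>j. I ! \<sigma> j) [0..<p])"
  using p by (auto simp: sorted_wrt_iff_nth_less nth_less_iff shuffle_less shuffle_mono_left)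

lemma sorted_right: "sorted_wrt (<) (map (\<lambda>j. I ! \<sigma> j) [p..<length I])"
  using p by (auto simp: sorted_wrt_iff_nth_less nth_less_iff shuffle_less shuffle_mono_right)

lemma shuffle_splits:
  "((\<lambda>j. I ! \<sigma> j) ` {0..<p}, (\<lambda>j. I ! \<sigma> j) ` {p..<length I}) \<in> splits (set I)"
  "hd I \<in> (\<lambda>j. I ! \<sigma> j) ` {0..<p}"
proof -
  have "(\<lambda>j. I ! \<sigma> j) ` {0..<p} \<union> (\<lambda>j. I ! \<sigma> j) ` {p..<length I} = (\<lambda>j. I ! \<sigma> j) ` {..<length I}"
    using p by (auto simp flip: image_Un simp: ivl_disj_un lessThan_atLeast0)
  also have "\<dots> = (!) I ` (\<sigma> ` {..<length I})" by (simp add: image_image)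
  also have "\<sigma> ` {..<length I} = {..<length I}" using shuffle_permutes by (rule permutes_image)
  also have "(!) I ` {..<length I} = set I" by (auto simp: set_conv_nth)
  finally show "((\<lambda>j. I ! \<sigma> j) ` {0..<p}, (\<lambda>j. I ! \<sigma> j) ` {p..<length I}) \<in> splits (set I)"
    using p by (auto simp: splits_def nth_eq_iff shuffle_less shuffle_inj)
  have "\<sigma> 0 = 0" using \<sigma> by (simp add: pointed_shuffles_def)
  moreover have "I \<noteq> []" using p by auto
  ultimately have "hd I = I ! \<sigma> 0" by (simp add: hd_conv_nth)
  then show "hd I \<in> (\<lambda>j. I ! \<sigma> j) ` {0..<p}" using p by auto
qed

text \<open>As I is strictly increasing, inversions of positions are inversions of indices, and all
  of them occur between the two blocks.\<close>

lemma koszul_sign_eq: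
  "koszul_sign n I \<sigma> =
    block_sign n ((\<lambda>j. I ! \<sigma> j) ` {0..<p}) ((\<lambda>j. I ! \<sigma> j) ` {p..<length I})" (is "_ = block_sign n ?J ?K")
proof -
  have "block_sign n ?J ?K =
      (\<Prod>(j, l)\<in>?J \<times> ?K. if l < j then (-1) powi (n j * n l) else 1)"
    by (simp add: block_sign_def prod.cartesian_product)
  also have "\<dots> = (\<Prod>(j, l)\<in>{(j, l) \<in> ?J \<times> ?K. l < j}. (-1) powi (n j * n l))"
    by (rule prod.mono_neutral_cong_right) (auto split: if_splits)
  also have "\<dots> = (\<Prod>x\<in>{(a, b). a < b \<and> b < length I \<and> \<sigma> b < \<sigma> a}.
      (\<lambda>(j, l). (-1) powi (n j * n l)) ((\<lambda>(a, b). (I ! \<sigma> a, I ! \<sigma> b)) x))"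
  proof (rule prod.reindex_bij_betw[symmetric])
    let ?P = "{(a, b). a < b \<and> b < length I \<and> \<sigma> b < \<sigma> a}"
    \<comment> \<open>The shuffle increases on each block, so an inversion starts in the left block
      and ends in the right one.\<close>
    have P: "a < p \<and> p \<le> b" if "a < b" "b < length I" "\<sigma> b < \<sigma> a" for a b
      using that shuffle_mono_left[of a b] shuffle_mono_right[of a b] by (meson leI less_asym)
    show "bij_betw (\<lambda>(a, b). (I ! \<sigma> a, I ! \<sigma> b)) ?P {(j, l) \<in> ?J \<times> ?K. l < j}"
    proof (rule bij_betwI')
      fix x y assume "x \<in> ?P" "y \<in> ?P"
      then show "((\<lambda>(a, b). (I ! \<sigma> a, I ! \<sigma> b)) x = (\<lambda>(a, b). (I ! \<sigma> a, I ! \<sigma> b)) y) = (x = y)"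
        by (auto simp: nth_eq_iff shuffle_less shuffle_inj)
    next
      fix x assume "x \<in> ?P"
      then show "(\<lambda>(a, b). (I ! \<sigma> a, I ! \<sigma> b)) x \<in> {(j, l) \<in> ?J \<times> ?K. l < j}"
        using P p by (auto simp: nth_less_iff shuffle_less)
    next
      fix y assume "y \<in> {(j, l) \<in> ?J \<times> ?K. l < j}"
      then obtain a b where "a < p" "p \<le> b" "b < length I" "y = (I ! \<sigma> a, I ! \<sigma> b)"
        "I ! \<sigma> b < I ! \<sigma> a"
        by auto
      moreover then have "\<sigma> b < \<sigma> a" by (simp add: nth_less_iff shuffle_less)
      ultimately show "\<exists>x\<in>?P. y = (\<lambda>(a, b). (I ! \<sigma> a, I ! \<sigma> b)) x"
        by (intro bexI[of _ "(a, b)"]) auto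
    qed
  qed
  finally show ?thesis by (simp add: koszul_sign_def case_prod_unfold)
qed

end

text \<open>The shuffle is read off from the concatenation of the sorted lists of J and K, each
  entry being sent to its position in I.\<close>

lemma shuffle_exists:
  assumes JK: "(J, K) \<in> splits (set I)" and hd: "hd I \<in> J"
  shows "\<exists>p\<in>{1..<length I}. \<exists>\<sigma>\<in>pointed_shuffles p (length I - p).
    J = (\<lambda>j. I ! \<sigma> j) ` {0..<p} \<and> K = (\<lambda>j. I ! \<sigma> j) ` {p..<length I}"
proof -
  have fin: "finite J" "finite K" and un: "J \<union> K = set I" and dis: "J \<inter> K = {}"
    and ne: "J \<noteq> {}" "K \<noteq> {}"
    using JK by (auto simp: splits_def intro: finite_subset[of _ "set I"])
  define xs where "xs = sorted_list_of_set J @ sorted_list_of_set K"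
  define p where "p = card J"
  have dist: "distinct xs" "distinct I" and set: "set xs = set I"
    using fin un dis I by (auto simp: xs_def strict_sorted_iff)
  have len: "length xs = length I"
    using dist set by (metis distinct_card)
  have lenp: "length I = p + card K" using fin len by (simp add: xs_def p_def)
  have p: "p \<in> {1..<length I}" using ne fin by (simp add: lenp p_def Suc_le_eq card_gt_0_iff)
  \<comment> \<open>The identity beyond the length of I is what \<open>permutes\<close> asks
    for.\<close>
  define \<sigma> where "\<sigma> j = (if j < length I then inv_into {..<length I} ((!) I) (xs ! j) else j)" for j
  have bijI: "bij_betw ((!) I) {..<length I} (set I)" by (rule bij_betw_nth) (use dist in auto)
  have bijx: "bij_betw ((!) xs) {..<length I} (set I)" by (rule bij_betw_nth) (use dist len set in auto)
  have nth: "I ! \<sigma> j = xs ! j" if "j < length I" for j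
  proof -
    have "xs ! j \<in> set I" using that len set nth_mem by metis
    then show ?thesis using that bijI by (simp add: \<sigma>_def bij_betw_inv_into_right)
  qed
  have "bij_betw (inv_into {..<length I} ((!) I) \<circ> (!) xs) {..<length I} {..<length I}"
    by (rule bij_betw_trans[OF bijx bij_betw_inv_into[OF bijI]])
  then have "bij_betw \<sigma> {..<length I} {..<length I}"
    by (rule bij_betw_cong[THEN iffD1, rotated]) (simp add: \<sigma>_def)
  then have perm: "\<sigma> permutes {..<length I}"
    by (rule bij_imp_permutes) (simp add: \<sigma>_def)
  have less: "\<sigma> j < length I" if "j < length I" for j
    using permutes_in_image[OF perm, of j] that by simp
  have mono: "\<sigma> a < \<sigma> b" if "xs ! a < xs ! b" "a < length I" "b < length I" for a b
    using that by (simp add: nth_less_iff[symmetric] less nth)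
  have xl: "xs ! j = sorted_list_of_set J ! j" if "j < p" for j
    using that by (simp add: xs_def p_def nth_append)
  have xr: "xs ! j = sorted_list_of_set K ! (j - p)" if "p \<le> j" for j
    using that by (simp add: xs_def p_def nth_append)
  have sJ: "sorted_wrt (<) (sorted_list_of_set J)" and sK: "sorted_wrt (<) (sorted_list_of_set K)"
    by auto
  have "strict_mono_on {..<p} \<sigma>"
  proof (rule strict_mono_onI)
    fix a b assume "a \<in> {..<p}" "b \<in> {..<p}" "a < b"
    then show "\<sigma> a < \<sigma> b"
      using sJ p by (intro mono) (auto simp: xl sorted_wrt_iff_nth_less p_def)
  qed
  moreover have "strict_mono_on {p..<length I} \<sigma>"
  proof (rule strict_mono_onI)
    fix a b assume "a \<in> {p..<length I}" "b \<in> {p..<length I}" "a < b"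
    then show "\<sigma> a < \<sigma> b"
      using sK p lenp by (intro mono) (auto simp: xr sorted_wrt_iff_nth_less)
  qed
  \<comment> \<open>The head of I is the least element of the whole list and belongs to J, hence it
    is also the first entry of the sorted list of J.\<close>
  moreover have "\<sigma> 0 = 0"
  proof -
    have I0: "I \<noteq> []" "0 < length I" using p by auto
    have min: "I ! 0 \<le> y" if y: "y \<in> set I" for y
    proof -
      obtain j where "j < length I" "y = I ! j" using y by (auto simp: in_set_conv_nth)
      then show ?thesis using nth_less_iff[of 0 j] I0 by (cases "j = 0") auto
    qed
    have "I ! 0 = Min J"
    proof (rule sym, rule Min_eqI[OF fin(1)])
      show "I ! 0 \<le> y" if "y \<in> J" for y using that un by (intro min) auto
      show "I ! 0 \<in> J" using hd I0 by (simp add: hd_conv_nth)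
    qed
    moreover have "sorted_list_of_set J ! 0 = Min J"
      using fin ne by (subst sorted_list_of_set_nonempty) auto
    ultimately have "I ! \<sigma> 0 = I ! 0" using nth[of 0] xl[of 0] p I0 by simp
    then show ?thesis using nth_eq_iff[of "\<sigma> 0" 0] less[of 0] I0 by simp
  qed
  ultimately have "\<sigma> \<in> pointed_shuffles p (length I - p)"
    using perm p by (simp add: pointed_shuffles_def)
  moreover have "J = (\<lambda>j. I ! \<sigma> j) ` {0..<p}"
  proof -
    have "(\<lambda>j. I ! \<sigma> j) ` {0..<p} = (!) (sorted_list_of_set J) ` {0..<p}"
      using p by (intro image_cong) (auto simp: nth xl)
    also have "\<dots> = set (sorted_list_of_set J)"
      using nth_image[of p "sorted_list_of_set J"] by (simp add: p_def)
    finally show ?thesis using fin by simp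
  qed
  moreover have "K = (\<lambda>j. I ! \<sigma> j) ` {p..<length I}"
  proof -
    have "(\<lambda>j. I ! \<sigma> j) ` {p..<length I} = (\<lambda>j. sorted_list_of_set K ! (j - p)) ` {p..<length I}"
      using p by (intro image_cong) (auto simp: nth xr)
    also have "\<dots> = (!) (sorted_list_of_set K) ` ((\<lambda>j. j - p) ` {p..<length I})"
      by (simp add: image_image)
    also have "(\<lambda>j. j - p) ` {p..<length I} = {0..<card K}"
      using lenp image_minus_const_atLeastLessThan_nat[of p p "length I"] by auto
    also have "(!) (sorted_list_of_set K) ` {0..<card K} = set (sorted_list_of_set K)"
      using nth_image[of "card K" "sorted_list_of_set K"] by simp
    finally show ?thesis using fin by simp
  qed
  ultimately show ?thesis using p by blast
qed

text \<open>Both blocks are strictly increasing lists and therefore determined by their sets of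
  entries.\<close>

lemma shuffle_unique:
  assumes p: "p \<in> {1..<length I}" "\<sigma> \<in> pointed_shuffles p (length I - p)"
    and q: "q \<in> {1..<length I}" "\<tau> \<in> pointed_shuffles q (length I - q)"
    and J: "(\<lambda>j. I ! \<sigma> j) ` {0..<p} = (\<lambda>j. I ! \<tau> j) ` {0..<q}"
    and K: "(\<lambda>j. I ! \<sigma> j) ` {p..<length I} = (\<lambda>j. I ! \<tau> j) ` {q..<length I}"
  shows "p = q \<and> \<sigma> = \<tau>"
proof -
  have 1: "map (\<lambda>j. I ! \<sigma> j) [0..<p] = map (\<lambda>j. I ! \<tau> j) [0..<q]"
    using sorted_list_of_set_strict[OF sorted_left[OF p]] sorted_list_of_set_strict[OF sorted_left[OF q]] J
    by simp
  have 2: "map (\<lambda>j. I ! \<sigma> j) [p..<length I] = map (\<lambda>j. I ! \<tau> j) [q..<length I]"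
    using sorted_list_of_set_strict[OF sorted_right[OF p]] sorted_list_of_set_strict[OF sorted_right[OF q]] K
    by simp
  have "p = q" using arg_cong[OF 1, of length] by simp
  have "I ! \<sigma> j = I ! \<tau> j" if "j < length I" for j
    using 1 2 that unfolding \<open>p = q\<close> by (cases "j < q") auto
  then have "\<sigma> j = \<tau> j" if "j < length I" for j
    using that by (simp add: nth_eq_iff shuffle_less[OF p] shuffle_less[OF q])
  moreover have "\<sigma> j = \<tau> j" if "\<not> j < length I" for j
    using that permutes_not_in[OF shuffle_permutes[OF p], of j] permutes_not_in[OF shuffle_permutes[OF q], of j]
    by simp
  ultimately show ?thesis using \<open>p = q\<close> by blast
qed

text \<open>Shuffles that fix the first position correspond to splittings whose first part contains
  the head of I. From here on, subsets replace lists and permutations.\<close>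

lemma wh_diff_eq_sum_splits:
  "wh_diff n I = (\<Sum>(J, K)\<in>{(J, K) \<in> splits (set I). hd I \<in> J}.
     Poly_Mapping.single (Br (Gen (sorted_list_of_set J)) (Gen (sorted_list_of_set K))) (split_sign n J K))"
proof -
  define h where "h = (\<lambda>(p, \<sigma>). ((\<lambda>j. I ! \<sigma> j) ` {0..<p}, (\<lambda>j. I ! \<sigma> j) ` {p..<length I}))"
  define F :: "nat set \<times> nat set \<Rightarrow> nat list word_comb" where
    "F = (\<lambda>(J, K). Poly_Mapping.single (Br (Gen (sorted_list_of_set J)) (Gen (sorted_list_of_set K)))
      (split_sign n J K))"
  let ?S = "SIGMA p : {1..<length I}. pointed_shuffles p (length I - p)"
  have fin: "finite (pointed_shuffles p q)" for p q
    by (rule finite_subset[of _ "{\<sigma>. \<sigma> permutes {..<p + q}}"])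
      (auto simp: pointed_shuffles_def finite_permutations)
  have "wh_diff n I = (\<Sum>p = 1..<length I. \<Sum>\<sigma>\<in>pointed_shuffles p (length I - p). F (h (p, \<sigma>)))"
    unfolding wh_diff_def
  proof (intro sum.cong refl)
    fix p \<sigma> assume p: "p \<in> {1..<length I}" "\<sigma> \<in> pointed_shuffles p (length I - p)"
    show "(let J = map (\<lambda>j. I ! \<sigma> j) [0..<p]; K = map (\<lambda>j. I ! \<sigma> j) [p..<length I]
        in Poly_Mapping.single (Br (Gen J) (Gen K)) ((-1) powi wh_deg n J * koszul_sign n I \<sigma>)) =
      F (h (p, \<sigma>))"
      using sorted_list_of_set_strict[OF sorted_left[OF p]] sorted_list_of_set_strict[OF sorted_right[OF p]]
      by (simp add: F_def h_def split_sign_def koszul_sign_eq[OF p] wh_deg_eq[OF sorted_left[OF p]])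
  qed
  also have "\<dots> = (\<Sum>x\<in>?S. F (h x))"
    using fin by (simp add: sum.Sigma case_prod_unfold)
  also have "\<dots> = (\<Sum>y\<in>{(J, K) \<in> splits (set I). hd I \<in> J}. F y)"
  proof (rule sum.reindex_bij_betw)
    show "bij_betw h ?S {(J, K) \<in> splits (set I). hd I \<in> J}"
    proof (rule bij_betwI')
      fix x y assume "x \<in> ?S" "y \<in> ?S"
      then show "h x = h y \<longleftrightarrow> x = y"
        using shuffle_unique by (auto simp: h_def)
    next
      fix x assume "x \<in> ?S"
      then show "h x \<in> {(J, K) \<in> splits (set I). hd I \<in> J}"
        using shuffle_splits by (auto simp: h_def)
    next
      fix y assume "y \<in> {(J, K) \<in> splits (set I). hd I \<in> J}"
      then obtain J K where y: "y = (J, K)" "(J, K) \<in> splits (set I)" "hd I \<in> J" by auto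
      obtain p \<sigma> where p: "p \<in> {1..<length I}" "\<sigma> \<in> pointed_shuffles p (length I - p)"
        and "J = (\<lambda>j. I ! \<sigma> j) ` {0..<p}" "K = (\<lambda>j. I ! \<sigma> j) ` {p..<length I}"
        using shuffle_exists[OF y(2,3)] by blast
      then have "y = h (p, \<sigma>)" by (simp add: y h_def)
      with p show "\<exists>x\<in>?S. y = h x" by blast
    qed
  qed
  finally show ?thesis by (simp add: F_def)
qed

end

section \<open>Quotients by graded ideals\<close>

text \<open>Lets closure under scalars account for closure under negation.\<close>

lemma rat_module_minus:
  assumes "module rat_field M" and a: "a \<in> carrier M"
  shows "(-1) \<odot>\<^bsub>M\<^esub> a = \<ominus>\<^bsub>M\<^esub> a"
proof -
  interpret M: module rat_field M by fact
  have "(-1) \<odot>\<^bsub>M\<^esub> a \<oplus>\<^bsub>M\<^esub> 1 \<odot>\<^bsub>M\<^esub> a = \<zero>\<^bsub>M\<^esub>"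
    using M.smult_l_distr[of "-1" 1 a] M.smult_l_null[of a] a by simp
  then show ?thesis
    using M.minus_equality[of "(-1) \<odot>\<^bsub>M\<^esub> a" a] M.smult_closed[of "-1" a] M.smult_one[of a] a by simp
qed

text \<open>Common ground of two quotients: cycles modulo boundaries, and the free non-associative
  algebra modulo the Lie relations. The bracket of the latter is only bilinear before passing to the
  quotient.\<close>

locale dg_ideal =
  fixes N :: "'a dg_data" and B :: "int \<Rightarrow> 'a set"
  assumes N_module: "module rat_field (piece N m)"
    and N_bracket_left: "c \<in> carrier (piece N m) \<Longrightarrow>
      linear_map (piece N l) (piece N (l + m)) (\<lambda>a. bracket N l m a c)"
    and N_bracket_right: "a \<in> carrier (piece N l) \<Longrightarrow>
      linear_map (piece N m) (piece N (l + m)) (\<lambda>c. bracket N l m a c)"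
    and N_diff: "linear_map (piece N m) (piece N (m - 1)) (diff N m)"
    and B_sub: "b \<in> B m \<Longrightarrow> b \<in> carrier (piece N m)"
    and B_zero: "\<zero>\<^bsub>piece N m\<^esub> \<in> B m"
    and B_add: "b \<in> B m \<Longrightarrow> b' \<in> B m \<Longrightarrow> b \<oplus>\<^bsub>piece N m\<^esub> b' \<in> B m"
    and B_smult: "b \<in> B m \<Longrightarrow> r \<odot>\<^bsub>piece N m\<^esub> b \<in> B m"
    and B_bracket_left: "b \<in> B l \<Longrightarrow> c \<in> carrier (piece N m) \<Longrightarrow> bracket N l m b c \<in> B (l + m)"
    and B_bracket_right: "a \<in> carrier (piece N l) \<Longrightarrow> b \<in> B m \<Longrightarrow> bracket N l m a b \<in> B (l + m)"
    and B_diff: "b \<in> B m \<Longrightarrow> diff N m b \<in> B (m - 1)"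
begin

definition cls :: "int \<Rightarrow> 'a \<Rightarrow> 'a set" where
  "cls m a = B m +>\<^bsub>piece N m\<^esub> a"

lemma N_group: "abelian_group (piece N m)"
  using N_module[of m] by (simp add: module_def)

lemma N_smult_mem: "a \<in> carrier (piece N m) \<Longrightarrow> r \<odot>\<^bsub>piece N m\<^esub> a \<in> carrier (piece N m)"
  using module.smult_closed[OF N_module] by simp

lemmas N_add_mem = abelian_monoid.a_closed[OF abelian_group.axioms(1)[OF N_group]]

lemma mem_cls: "x \<in> cls m a \<longleftrightarrow> (\<exists>b\<in>B m. x = b \<oplus>\<^bsub>piece N m\<^esub> a)"
  by (auto simp: cls_def a_r_coset_def')

lemma cls_nonempty: "cls m a \<noteq> {}"
  using B_zero[of m] mem_cls by blast

lemma self_mem_cls: "a \<in> carrier (piece N m) \<Longrightarrow> a \<in> cls m a"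
  using B_zero[of m] abelian_monoid.l_zero[OF abelian_group.axioms(1)[OF N_group], of a m]
  by (auto simp: mem_cls intro!: bexI[of _ "\<zero>\<^bsub>piece N m\<^esub>"])

lemma mem_cls_carrier: "x \<in> cls m a \<Longrightarrow> a \<in> carrier (piece N m) \<Longrightarrow> x \<in> carrier (piece N m)"
  by (auto simp: mem_cls B_sub N_add_mem)

lemma cls_eqI:
  assumes a: "a \<in> carrier (piece N m)" and x: "x \<in> cls m a"
  shows "cls m x = cls m a"
proof -
  interpret module rat_field "piece N m" by (rule N_module)
  obtain b where b: "b \<in> B m" "x = b \<oplus>\<^bsub>piece N m\<^esub> a" using x by (auto simp: mem_cls)
  define b' where "b' = (-1) \<odot>\<^bsub>piece N m\<^esub> b"
  have b': "b' \<in> B m" "b' = \<ominus>\<^bsub>piece N m\<^esub> b"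
    using B_smult[OF b(1), of "-1"] by (simp_all add: b'_def rat_module_minus[OF N_module B_sub[OF b(1)]])
  have "b'' \<oplus>\<^bsub>piece N m\<^esub> x \<in> cls m a" if "b'' \<in> B m" for b''
    unfolding b(2) mem_cls using that b a by (intro bexI[of _ "b'' \<oplus>\<^bsub>piece N m\<^esub> b"] B_add) (auto simp: a_assoc B_sub)
  moreover have "b'' \<oplus>\<^bsub>piece N m\<^esub> a \<in> cls m x" if b'': "b'' \<in> B m" for b''
  proof -
    have "b'' \<oplus>\<^bsub>piece N m\<^esub> a = (b'' \<oplus>\<^bsub>piece N m\<^esub> b') \<oplus>\<^bsub>piece N m\<^esub> x"
      using B_sub[OF b''] B_sub[OF b(1)] a by (simp add: b(2) b'(2) a_assoc r_neg1)
    then show ?thesis unfolding mem_cls using B_add[OF b'' b'(1)] by blast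
  qed
  ultimately show ?thesis
    by (intro equalityI subsetI) (metis mem_cls)+
qed

lemma Union_cls_eq:
  assumes "A \<noteq> {}" and "\<And>a. a \<in> A \<Longrightarrow> g a \<in> cls m c" and "c \<in> carrier (piece N m)"
  shows "(\<Union>a\<in>A. cls m (g a)) = cls m c"
  using assms cls_eqI by auto

lemma quot_carrier: "carrier (piece (dg_quot N B) m) = cls m ` carrier (piece N m)"
  by (auto simp: dg_quot_def quot_module_def cls_def A_RCOSETS_def' )

lemma quot_zero: "\<zero>\<^bsub>piece (dg_quot N B) m\<^esub> = cls m \<zero>\<^bsub>piece N m\<^esub>"
proof -
  interpret module rat_field "piece N m" by (rule N_module)
  show ?thesis
    by (auto simp: dg_quot_def quot_module_def mem_cls B_sub)
qed

lemma quot_add: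
  assumes a: "a \<in> carrier (piece N m)" and c: "c \<in> carrier (piece N m)"
  shows "cls m a \<oplus>\<^bsub>piece (dg_quot N B) m\<^esub> cls m c = cls m (a \<oplus>\<^bsub>piece N m\<^esub> c)"
proof -
  interpret module rat_field "piece N m" by (rule N_module)
  have "cls m a \<oplus>\<^bsub>piece (dg_quot N B) m\<^esub> cls m c =
      {x \<oplus>\<^bsub>piece N m\<^esub> y | x y. x \<in> cls m a \<and> y \<in> cls m c}"
    by (auto simp: dg_quot_def quot_module_def set_add_def')
  also have "\<dots> = cls m (a \<oplus>\<^bsub>piece N m\<^esub> c)"
  proof (intro equalityI subsetI)
    fix z assume "z \<in> {x \<oplus>\<^bsub>piece N m\<^esub> y | x y. x \<in> cls m a \<and> y \<in> cls m c}"
    then obtain b b' where b: "b \<in> B m" "b' \<in> B m"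
      and "z = (b \<oplus>\<^bsub>piece N m\<^esub> a) \<oplus>\<^bsub>piece N m\<^esub> (b' \<oplus>\<^bsub>piece N m\<^esub> c)"
      by (auto simp: mem_cls)
    then have "z = (b \<oplus>\<^bsub>piece N m\<^esub> b') \<oplus>\<^bsub>piece N m\<^esub> (a \<oplus>\<^bsub>piece N m\<^esub> c)"
      using a c B_sub by (simp add: a_ac)
    then show "z \<in> cls m (a \<oplus>\<^bsub>piece N m\<^esub> c)" using b B_add by (auto simp: mem_cls)
  next
    fix z assume "z \<in> cls m (a \<oplus>\<^bsub>piece N m\<^esub> c)"
    then obtain b where "b \<in> B m" "z = b \<oplus>\<^bsub>piece N m\<^esub> (a \<oplus>\<^bsub>piece N m\<^esub> c)" by (auto simp: mem_cls)
    then have "z = (b \<oplus>\<^bsub>piece N m\<^esub> a) \<oplus>\<^bsub>piece N m\<^esub> c" "b \<oplus>\<^bsub>piece N m\<^esub> a \<in> cls m a"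
      using a c B_sub by (auto simp: a_assoc mem_cls)
    then show "z \<in> {x \<oplus>\<^bsub>piece N m\<^esub> y | x y. x \<in> cls m a \<and> y \<in> cls m c}"
      using self_mem_cls[OF c] by blast
  qed
  finally show ?thesis .
qed

lemma quot_smult:
  assumes a: "a \<in> carrier (piece N m)"
  shows "r \<odot>\<^bsub>piece (dg_quot N B) m\<^esub> cls m a = cls m (r \<odot>\<^bsub>piece N m\<^esub> a)"
proof -
  interpret module rat_field "piece N m" by (rule N_module)
  have "(\<Union>x\<in>cls m a. cls m (r \<odot>\<^bsub>piece N m\<^esub> x)) = cls m (r \<odot>\<^bsub>piece N m\<^esub> a)"
  proof (rule Union_cls_eq[OF cls_nonempty])
    fix x assume "x \<in> cls m a"
    then obtain b where b: "b \<in> B m" "x = b \<oplus>\<^bsub>piece N m\<^esub> a" by (auto simp: mem_cls)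
    then have "r \<odot>\<^bsub>piece N m\<^esub> x = r \<odot>\<^bsub>piece N m\<^esub> b \<oplus>\<^bsub>piece N m\<^esub> r \<odot>\<^bsub>piece N m\<^esub> a"
      using a B_sub by (simp add: smult_r_distr[simplified])
    then show "r \<odot>\<^bsub>piece N m\<^esub> x \<in> cls m (r \<odot>\<^bsub>piece N m\<^esub> a)"
      unfolding mem_cls using B_smult[OF b(1)] by blast
  qed (use a in \<open>simp add: N_smult_mem\<close>)
  then show ?thesis by (simp add: dg_quot_def quot_module_def cls_def)
qed

lemma quot_bracket:
  assumes a: "a \<in> carrier (piece N l)" and c: "c \<in> carrier (piece N m)"
  shows "bracket (dg_quot N B) l m (cls l a) (cls m c) = cls (l + m) (bracket N l m a c)"
proof -
  interpret module rat_field "piece N (l + m)" by (rule N_module)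
  \<comment> \<open>With x = b + a and y = b' + c the bracket is [b, y] + [a, b'] + [a, c], and the
    first two terms lie in the ideal.\<close>
  have *: "bracket N l m x y \<in> cls (l + m) (bracket N l m a c)" if x: "x \<in> cls l a" and y: "y \<in> cls m c" for x y
  proof -
    obtain b b' where b: "b \<in> B l" "b' \<in> B m" and xy: "x = b \<oplus>\<^bsub>piece N l\<^esub> a" "y = b' \<oplus>\<^bsub>piece N m\<^esub> c"
      using x y by (auto simp: mem_cls)
    have yc: "y \<in> carrier (piece N m)" using mem_cls_carrier y c by blast
    have "bracket N l m x y = bracket N l m b y \<oplus>\<^bsub>piece N (l + m)\<^esub> bracket N l m a y"
      unfolding xy(1) using linear_mapD(2)[OF N_bracket_left[OF yc]] B_sub b a by blast
    also have "bracket N l m a y = bracket N l m a b' \<oplus>\<^bsub>piece N (l + m)\<^esub> bracket N l m a c"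
      unfolding xy(2) using linear_mapD(2)[OF N_bracket_right[OF a]] B_sub b c by blast
    finally have "bracket N l m x y =
        (bracket N l m b y \<oplus>\<^bsub>piece N (l + m)\<^esub> bracket N l m a b') \<oplus>\<^bsub>piece N (l + m)\<^esub> bracket N l m a c"
      using B_sub[OF B_bracket_left[OF b(1) yc]] B_sub[OF B_bracket_right[OF a b(2)]]
        linear_mapD(1)[OF N_bracket_right[OF a] c]
      by (simp add: a_assoc)
    then show ?thesis
      unfolding mem_cls using B_add[OF B_bracket_left[OF b(1) yc] B_bracket_right[OF a b(2)]] by blast
  qed
  have "(\<Union>x\<in>cls l a. \<Union>y\<in>cls m c. cls (l + m) (bracket N l m x y)) = cls (l + m) (bracket N l m a c)"
    using cls_eqI[OF linear_mapD(1)[OF N_bracket_right[OF a] c] * ] cls_nonempty[of l a] cls_nonempty[of m c]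
    by auto
  then show ?thesis by (simp add: dg_quot_def cls_def)
qed

lemma quot_diff:
  assumes a: "a \<in> carrier (piece N m)"
  shows "diff (dg_quot N B) m (cls m a) = cls (m - 1) (diff N m a)"
proof -
  have "(\<Union>x\<in>cls m a. cls (m - 1) (diff N m x)) = cls (m - 1) (diff N m a)"
  proof (rule Union_cls_eq[OF cls_nonempty])
    show "diff N m x \<in> cls (m - 1) (diff N m a)" if x: "x \<in> cls m a" for x
    proof -
      obtain b where b: "b \<in> B m" "x = b \<oplus>\<^bsub>piece N m\<^esub> a" using x by (auto simp: mem_cls)
      then have "diff N m x = diff N m b \<oplus>\<^bsub>piece N (m - 1)\<^esub> diff N m a"
        using a B_sub linear_mapD(2)[OF N_diff] by blast
      then show ?thesis unfolding mem_cls using B_diff[OF b(1)] by blast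
    qed
    show "diff N m a \<in> carrier (piece N (m - 1))" using a linear_mapD(1)[OF N_diff] by blast
  qed
  then show ?thesis by (simp add: dg_quot_def cls_def)
qed

end

section \<open>Homology\<close>

context dgl
begin

lemma total_diff_em: "a \<in> carrier (piece L m) \<Longrightarrow> total_diff L m (em L m a) = em L (m - 1) (diff L m a)"
  by (simp add: total_diff_def ev_em)

lemma total_bracket_em:
  "a \<in> carrier (piece L l) \<Longrightarrow> b \<in> carrier (piece L m) \<Longrightarrow>
    total_bracket L l m (em L l a) (em L m b) = em L (l + m) (bracket L l m a b)"
  by (simp add: total_bracket_def ev_em)

lemma total_diff_ev: "total_diff L m (em L m (ev L m p)) = total_diff L m p"
  by (simp add: total_diff_def ev_em ev_mem)

lemma cycles_iff: "a \<in> cycles L m \<longleftrightarrow> a \<in> carrier (piece L m) \<and> total_diff L m (em L m a) = 0"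
  using em_eq_iff[OF diff_mem zero_mem, of a m] by (auto simp: cycles_def total_diff_em em_zero)

text \<open>\<open>p\<close> may be arbitrary because \<open>total_diff\<close> evaluates it, and
  evaluations lie in the carrier.\<close>

lemma boundaries_iff:
  "a \<in> boundaries L m \<longleftrightarrow> a \<in> carrier (piece L m) \<and> (\<exists>p. em L m a = total_diff L (m + 1) p)"
proof
  assume "a \<in> boundaries L m"
  then obtain c where c: "c \<in> carrier (piece L (m + 1))" "a = diff L (m + 1) c"
    by (auto simp: boundaries_def)
  then show "a \<in> carrier (piece L m) \<and> (\<exists>p. em L m a = total_diff L (m + 1) p)"
    using diff_mem[OF c(1)] total_diff_em[OF c(1)] by (auto intro!: exI[of _ "em L (m + 1) c"])
next
  assume a: "a \<in> carrier (piece L m) \<and> (\<exists>p. em L m a = total_diff L (m + 1) p)"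
  then obtain p where "em L m a = total_diff L (m + 1) p" by blast
  then have "em L m a = em L m (diff L (m + 1) (ev L (m + 1) p))" by (simp add: total_diff_def)
  then have "a = diff L (m + 1) (ev L (m + 1) p)"
    using a em_eq_iff[of a m "diff L (m + 1) (ev L (m + 1) p)"] diff_mem[OF ev_mem[of "m + 1" p]] by simp
  then show "a \<in> boundaries L m" by (simp add: boundaries_def ev_mem)
qed

lemma cycle_algebra_simps:
  "carrier (piece (cycle_algebra L) m) = cycles L m"
  "a \<oplus>\<^bsub>piece (cycle_algebra L) m\<^esub> b = a \<oplus>\<^bsub>piece L m\<^esub> b"
  "r \<odot>\<^bsub>piece (cycle_algebra L) m\<^esub> a = r \<odot>\<^bsub>piece L m\<^esub> a"
  "\<zero>\<^bsub>piece (cycle_algebra L) m\<^esub> = \<zero>\<^bsub>piece L m\<^esub>"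
  "bracket (cycle_algebra L) = bracket L"
  "diff (cycle_algebra L) = diff L"
  by (simp_all add: cycle_algebra_def)

lemma cycles_carrier: "a \<in> cycles L m \<Longrightarrow> a \<in> carrier (piece L m)"
  by (simp add: cycles_def)

lemma cycles_zero: "\<zero>\<^bsub>piece L m\<^esub> \<in> cycles L m"
  by (simp add: cycles_iff zero_mem em_zero)

lemma cycles_add: "a \<in> cycles L m \<Longrightarrow> b \<in> cycles L m \<Longrightarrow> a \<oplus>\<^bsub>piece L m\<^esub> b \<in> cycles L m"
  by (simp add: cycles_iff add_mem em_add T.d_add)

lemma cycles_smult: "a \<in> cycles L m \<Longrightarrow> r \<odot>\<^bsub>piece L m\<^esub> a \<in> cycles L m"
  by (simp add: cycles_iff smult_mem em_smult T.d_scale)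

lemma cycles_bracket:
  "a \<in> cycles L l \<Longrightarrow> b \<in> cycles L m \<Longrightarrow> bracket L l m a b \<in> cycles L (l + m)"
  by (simp add: cycles_iff bracket_mem total_bracket_em[symmetric] T.d_br)

lemma cycles_diff: "a \<in> carrier (piece L m) \<Longrightarrow> diff L m a \<in> cycles L (m - 1)"
  by (simp add: cycles_iff diff_mem total_diff_em[symmetric] T.d_d)

lemma boundaries_cycles: "b \<in> boundaries L m \<Longrightarrow> b \<in> cycles L m"
  using cycles_diff[of _ "m + 1"] by (auto simp: boundaries_def)

text \<open>If c is a cycle, then [d p, c] is the differential of [p, c].\<close>

lemma boundaries_bracket_left:
  assumes "b \<in> boundaries L l" and "c \<in> cycles L m"
  shows "bracket L l m b c \<in> boundaries L (l + m)"
proof -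
  obtain p where p: "em L l b = total_diff L (l + 1) p" and b: "b \<in> carrier (piece L l)"
    using assms(1) by (auto simp: boundaries_iff)
  have c: "c \<in> carrier (piece L m)" "total_diff L m (em L m c) = 0"
    using assms(2) by (auto simp: cycles_iff)
  have "em L (l + m) (bracket L l m b c) =
      total_diff L (l + m + 1) (total_bracket L (l + 1) m p (em L m c))"
    using T.d_br[of "l + 1" m p "em L m c"] b c
    by (simp add: total_bracket_em[symmetric] p add.commute add.left_commute)
  then show ?thesis using bracket_mem[OF b c(1)] by (auto simp: boundaries_iff)
qed

lemma boundaries_bracket_right:
  assumes "a \<in> cycles L l" and "b \<in> boundaries L m"
  shows "bracket L l m a b \<in> boundaries L (l + m)"
proof -
  obtain p where p: "em L m b = total_diff L (m + 1) p" and b: "b \<in> carrier (piece L m)"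
    using assms(2) by (auto simp: boundaries_iff)
  have a: "a \<in> carrier (piece L l)" "total_diff L l (em L l a) = 0"
    using assms(1) by (auto simp: cycles_iff)
  \<comment> \<open>The scalar compensates the sign that the Leibniz rule puts on the second
    term.\<close>
  have "total_diff L (l + m + 1) (pscale ((-1) powi l) (total_bracket L l (m + 1) (em L l a) p)) =
      em L (l + m) (bracket L l m a b)"
    using T.d_br[of l "m + 1" "em L l a" p] a b
    by (simp add: total_bracket_em[symmetric] p T.d_scale powi_minus_one add.commute add.left_commute)
  then show ?thesis using bracket_mem[OF a(1) b] by (metis boundaries_iff)
qed

lemma cycle_ideal: "dg_ideal (cycle_algebra L) (boundaries L)"
proof (rule dg_ideal.intro; (unfold cycle_algebra_simps)?)
  show "module rat_field (piece (cycle_algebra L) m)" for m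
  proof -
    interpret M: module rat_field "piece L m" by (rule vector_space)
    have "submodule (cycles L m) rat_field (piece L m)"
    proof (rule M.submoduleI)
      show "\<ominus>\<^bsub>piece L m\<^esub> a \<in> cycles L m" if "a \<in> cycles L m" for a
        using cycles_smult[OF that, of "-1"] cycles_carrier[OF that]
        by (simp add: rat_module_minus[OF vector_space])
    qed (auto simp: cycles_zero cycles_add cycles_smult cycles_carrier)
    then show ?thesis
      using submodule.submodule_is_module[OF _ vector_space] by (simp add: cycle_algebra_def)
  qed
  show "linear_map (piece (cycle_algebra L) l) (piece (cycle_algebra L) (l + m)) (\<lambda>a. bracket L l m a c)"
    if "c \<in> cycles L m" for c l m
    using that linear_mapD[OF bracket_linear_left[OF cycles_carrier[OF that], of l]]
    by (auto simp: linear_map_def cycle_algebra_simps cycles_bracket cycles_carrier)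
  show "linear_map (piece (cycle_algebra L) m) (piece (cycle_algebra L) (l + m)) (\<lambda>c. bracket L l m a c)"
    if "a \<in> cycles L l" for a l m
    using that linear_mapD[OF bracket_linear_right[OF cycles_carrier[OF that], of m]]
    by (auto simp: linear_map_def cycle_algebra_simps cycles_bracket cycles_carrier)
  show "linear_map (piece (cycle_algebra L) m) (piece (cycle_algebra L) (m - 1)) (diff L m)" for m
    using linear_mapD[OF diff_linear[of m]]
    by (auto simp: linear_map_def cycle_algebra_simps cycles_diff cycles_carrier)
  show "b \<in> cycles L m" if "b \<in> boundaries L m" for b m
    using that by (rule boundaries_cycles)
  show "\<zero>\<^bsub>piece L m\<^esub> \<in> boundaries L m" for m
    by (auto simp: boundaries_iff zero_mem em_zero intro!: exI[of _ 0])
  show "b \<oplus>\<^bsub>piece L m\<^esub> b' \<in> boundaries L m" if "b \<in> boundaries L m" "b' \<in> boundaries L m" for b b' m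
    using that by (auto simp: boundaries_iff add_mem em_add T.d_add[symmetric])
  show "r \<odot>\<^bsub>piece L m\<^esub> b \<in> boundaries L m" if "b \<in> boundaries L m" for b m r
    using that by (auto simp: boundaries_iff smult_mem em_smult T.d_scale[symmetric])
  show "diff L m b \<in> boundaries L (m - 1)" if "b \<in> boundaries L m" for b m
    using that boundaries_cycles[OF that] \<open>\<And>m. \<zero>\<^bsub>piece L m\<^esub> \<in> boundaries L m\<close> by (simp add: cycles_def)
qed (simp_all add: boundaries_bracket_left boundaries_bracket_right)

end

sublocale dgl \<subseteq> H: dg_ideal "cycle_algebra L" "boundaries L"
  by (rule cycle_ideal)

context dgl
begin

lemma homology_class_eq: "homology_class L m a = H.cls m a"
  by (simp add: homology_class_def H.cls_def a_r_coset_def' cycle_algebra_simps)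

lemma homology_carrier: "carrier (piece (homology L) m) = homology_class L m ` cycles L m"
  using H.quot_carrier[of m] by (simp add: homology_def homology_class_eq[abs_def] cycle_algebra_simps)

lemma homology_zero: "\<zero>\<^bsub>piece (homology L) m\<^esub> = homology_class L m \<zero>\<^bsub>piece L m\<^esub>"
  using H.quot_zero[of m] by (simp add: homology_def homology_class_eq cycle_algebra_simps)

lemma homology_add:
  "a \<in> cycles L m \<Longrightarrow> b \<in> cycles L m \<Longrightarrow>
    homology_class L m a \<oplus>\<^bsub>piece (homology L) m\<^esub> homology_class L m b =
      homology_class L m (a \<oplus>\<^bsub>piece L m\<^esub> b)"
  using H.quot_add[of a m b] by (simp add: homology_def homology_class_eq cycle_algebra_simps)

lemma homology_smult:
  "a \<in> cycles L m \<Longrightarrow>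
    r \<odot>\<^bsub>piece (homology L) m\<^esub> homology_class L m a = homology_class L m (r \<odot>\<^bsub>piece L m\<^esub> a)"
  using H.quot_smult[of a m r] by (simp add: homology_def homology_class_eq cycle_algebra_simps)

lemma homology_bracket:
  "a \<in> cycles L l \<Longrightarrow> b \<in> cycles L m \<Longrightarrow>
    bracket (homology L) l m (homology_class L l a) (homology_class L m b) =
      homology_class L (l + m) (bracket L l m a b)"
  using H.quot_bracket[of a l b m] by (simp add: homology_def homology_class_eq cycle_algebra_simps)

lemma homology_diff: "diff (homology L) m A = \<zero>\<^bsub>piece (homology L) (m - 1)\<^esub>"
  by (simp add: homology_def dg_quot_def quot_module_def)

text \<open>Homologous cycles in the form in which the lifting results produce them, as an equation
  between total elements.\<close>

lemma homology_class_eq_iff: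
  assumes "a \<in> cycles L m" and "b \<in> cycles L m"
  shows "homology_class L m a = homology_class L m b \<longleftrightarrow>
    (\<exists>p. em L m a = em L m b + total_diff L (m + 1) p)"
proof
  assume "homology_class L m a = homology_class L m b"
  then have "a \<in> H.cls m b"
    using assms(1) H.self_mem_cls[of a m] by (simp add: homology_class_eq cycle_algebra_simps)
  then obtain c where "c \<in> boundaries L m" "a = c \<oplus>\<^bsub>piece L m\<^esub> b"
    by (auto simp: H.mem_cls cycle_algebra_simps)
  then show "\<exists>p. em L m a = em L m b + total_diff L (m + 1) p"
    using assms by (auto simp: boundaries_iff em_add cycles_carrier)
next
  assume "\<exists>p. em L m a = em L m b + total_diff L (m + 1) p"
  then obtain p where p: "em L m a = em L m b + total_diff L (m + 1) p" by blast
  define c where "c = diff L (m + 1) (ev L (m + 1) p)"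
  have c: "c \<in> boundaries L m" by (simp add: c_def boundaries_def ev_mem)
  have "em L m (c \<oplus>\<^bsub>piece L m\<^esub> b) = em L m a"
    using p assms boundaries_cycles[OF c] by (simp add: em_add cycles_carrier c_def total_diff_def)
  then have "a = c \<oplus>\<^bsub>piece L m\<^esub> b"
    using assms boundaries_cycles[OF c] by (simp add: em_eq_iff add_mem cycles_carrier)
  then have "a \<in> H.cls m b" using c by (auto simp: H.mem_cls cycle_algebra_simps)
  then show "homology_class L m a = homology_class L m b"
    using assms H.cls_eqI[of b m a] by (simp add: homology_class_eq cycle_algebra_simps)
qed

lemma mem_homology_class:
  assumes "x \<in> homology_class L m a" and "a \<in> cycles L m"
  shows "x \<in> cycles L m" and "homology_class L m x = homology_class L m a"
  using assms H.mem_cls_carrier[of x m a] H.cls_eqI[of a m x]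
  by (simp_all add: homology_class_eq cycle_algebra_simps)

lemma self_mem_homology_class: "a \<in> cycles L m \<Longrightarrow> a \<in> homology_class L m a"
  using H.self_mem_cls[of a m] by (simp add: homology_class_eq cycle_algebra_simps)

end

section \<open>Free graded Lie algebras\<close>

interpretation pvs: vector_space "pscale :: rat \<Rightarrow> ('g \<Rightarrow>\<^sub>0 rat) \<Rightarrow> 'g \<Rightarrow>\<^sub>0 rat"
  by (rule vector_space_pscale)

lemma lext_fun_add:
  "lext pscale (\<lambda>x. f x + g x) p = lext pscale f p + (lext pscale g p :: 'g \<Rightarrow>\<^sub>0 rat)"
  by (simp add: lext_def pvs.scale_right_distrib sum.distrib)

lemma lext_fun_scale:
  "lext pscale (\<lambda>x. pscale c (f x)) p = pscale c (lext pscale f p :: 'g \<Rightarrow>\<^sub>0 rat)"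
  by (simp add: lext_def pvs.scale_sum_right mult.commute)

lemma comb_mult_eq:
  "p \<star> q = lext pscale (\<lambda>s. lext pscale (\<lambda>t. Poly_Mapping.single (Br s t) 1) q) p"
  by (simp add: comb_mult_def lext_def pvs.scale_sum_right pscale_single)

lemma comb_mult_add_left: "(p + p') \<star> q = p \<star> q + p' \<star> q"
  by (simp add: comb_mult_eq lext_add[OF vector_space_pscale])

lemma comb_mult_add_right: "p \<star> (q + q') = p \<star> q + p \<star> q'"
  by (simp add: comb_mult_eq lext_add[OF vector_space_pscale] lext_fun_add)

lemma comb_mult_scale_left: "pscale c p \<star> q = pscale c (p \<star> q)"
  by (simp add: comb_mult_eq lext_pscale[OF vector_space_pscale])

lemma comb_mult_scale_right: "p \<star> pscale c q = pscale c (p \<star> q)"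
  by (simp add: comb_mult_eq lext_pscale[OF vector_space_pscale] lext_fun_scale)

lemma comb_mult_single: "Poly_Mapping.single s a \<star> Poly_Mapping.single t b = Poly_Mapping.single (Br s t) (a * b)"
  by (simp add: comb_mult_eq lext_single[OF vector_space_pscale] pscale_single)

lemma comb_mult_zero_left: "0 \<star> q = 0"
  by (simp add: comb_mult_eq lext_def)

lemma comb_mult_zero_right: "p \<star> 0 = 0"
  by (simp add: comb_mult_eq lext_def)

lemma single_eq_pscale: "Poly_Mapping.single t c = pscale c (Poly_Mapping.single t 1)"
  by (simp add: pscale_single)

text \<open>Only words from \<open>K\<close> are added, so a restriction on degrees and generators
  is available at every step.\<close>

lemma comb_induct [consumes 1, case_names zero add]:
  assumes "Poly_Mapping.keys p \<subseteq> K" and "P 0"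
    and add: "\<And>t c q. t \<in> K \<Longrightarrow> P q \<Longrightarrow> P (Poly_Mapping.single t (c :: rat) + q)"
  shows "P p"
proof -
  have "P (\<Sum>t\<in>S. Poly_Mapping.single t (Poly_Mapping.lookup p t))" if "finite S" "S \<subseteq> K" for S
    using that by (induction S rule: finite_induct) (use assms(2) add in auto)
  from this[OF _ assms(1)] have "P (\<Sum>t\<in>Poly_Mapping.keys p. Poly_Mapping.single t (Poly_Mapping.lookup p t))"
    by simp
  then show ?thesis
    using lext_single_one[of p] by (simp add: lext_def pscale_single)
qed

lemma comb_piece_iff:
  "p \<in> comb_piece G gdeg m \<longleftrightarrow>
    Poly_Mapping.keys p \<subseteq> {t. set_word t \<subseteq> G \<and> word_deg gdeg t = m}"
  by (auto simp: comb_piece_def)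

lemma comb_piece_zero: "0 \<in> comb_piece G gdeg m"
  by (simp add: comb_piece_iff)

lemma comb_piece_add:
  "p \<in> comb_piece G gdeg m \<Longrightarrow> q \<in> comb_piece G gdeg m \<Longrightarrow> p + q \<in> comb_piece G gdeg m"
  using keys_add[of p q] unfolding comb_piece_iff by blast

lemma comb_piece_scale: "p \<in> comb_piece G gdeg m \<Longrightarrow> pscale c p \<in> comb_piece G gdeg m"
  using keys_pscale[of c p] unfolding comb_piece_iff by blast

lemma comb_piece_uminus: "p \<in> comb_piece G gdeg m \<Longrightarrow> - p \<in> comb_piece G gdeg m"
  using comb_piece_scale[of p G gdeg m "-1"] by simp

lemma comb_piece_diff:
  "p \<in> comb_piece G gdeg m \<Longrightarrow> q \<in> comb_piece G gdeg m \<Longrightarrow> p - q \<in> comb_piece G gdeg m"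
  using comb_piece_add[of p G gdeg m "- q"] comb_piece_uminus[of q G gdeg m] by simp

lemma comb_piece_single:
  "set_word t \<subseteq> G \<Longrightarrow> word_deg gdeg t = m \<Longrightarrow> Poly_Mapping.single t c \<in> comb_piece G gdeg m"
  by (auto simp: comb_piece_iff)

lemma comb_piece_mult:
  assumes "p \<in> comb_piece G gdeg l" and q: "q \<in> comb_piece G gdeg m"
  shows "p \<star> q \<in> comb_piece G gdeg (l + m)"
  using assms(1)[unfolded comb_piece_iff]
proof (induction p rule: comb_induct)
  case zero
  then show ?case by (simp add: comb_mult_zero_left comb_piece_zero)
next
  case (add s c p)
  have "Poly_Mapping.single s c \<star> q \<in> comb_piece G gdeg (l + m)"
    using q[unfolded comb_piece_iff]
  proof (induction q rule: comb_induct)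
    case zero
    then show ?case by (simp add: comb_mult_zero_right comb_piece_zero)
  next
    case (add t b q)
    then show ?case
      using \<open>s \<in> _\<close>
      by (auto simp: comb_mult_add_right comb_mult_single intro!: comb_piece_add comb_piece_single)
  qed
  with add show ?case by (simp add: comb_mult_add_left comb_piece_add)
qed

lemma lie_relation_comb_piece: "lie_relation G gdeg m p \<Longrightarrow> p \<in> comb_piece G gdeg m"
proof (induction rule: lie_relation.induct)
  case (antisymmetry p l q m)
  then show ?case
    using comb_piece_mult[of p G gdeg l q m] comb_piece_mult[of q G gdeg m p l]
    by (simp add: comb_scale_eq comb_piece_add comb_piece_scale add.commute)
next
  case (jacobi p l q m r n)
  have "p \<star> (q \<star> r) \<in> comb_piece G gdeg (l + (m + n))" "p \<star> q \<star> r \<in> comb_piece G gdeg (l + m + n)"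
    "q \<star> (p \<star> r) \<in> comb_piece G gdeg (m + (l + n))"
    by (intro comb_piece_mult jacobi)+
  then show ?case
    by (simp add: comb_scale_eq comb_piece_diff comb_piece_scale add.commute add.left_commute)
qed (simp_all add: comb_piece_zero comb_piece_add comb_scale_eq comb_piece_scale comb_piece_mult)

lemma comb_diff_eq: "comb_diff gdeg d p = lext pscale (word_diff gdeg d) p"
  by (simp add: comb_diff_def lext_def comb_scale_eq)

lemmas comb_diff_add = lext_add[OF vector_space_pscale, of "word_diff gdeg d" for gdeg d, folded comb_diff_eq]
  and comb_diff_scale = lext_pscale[OF vector_space_pscale, of "word_diff gdeg d" for gdeg d, folded comb_diff_eq]
  and comb_diff_single = lext_single[OF vector_space_pscale, of "word_diff gdeg d" for gdeg d, folded comb_diff_eq]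
  and comb_diff_diff = lext_diff[OF vector_space_pscale, of "word_diff gdeg d" for gdeg d, folded comb_diff_eq]

lemma comb_diff_zero: "comb_diff gdeg d 0 = 0"
  by (simp add: comb_diff_def)

lemma comb_diff_mult:
  assumes "p \<in> comb_piece G gdeg m"
  shows "comb_diff gdeg d (p \<star> q) =
    comb_diff gdeg d p \<star> q + pscale ((-1) powi m) (p \<star> comb_diff gdeg d q)"
  using assms[unfolded comb_piece_iff]
proof (induction p rule: comb_induct)
  case zero
  then show ?case by (simp add: comb_mult_zero_left comb_diff_zero)
next
  case (add s c p)
  have "comb_diff gdeg d (Poly_Mapping.single s c \<star> q) = comb_diff gdeg d (Poly_Mapping.single s c) \<star> q +
      pscale ((-1) powi m) (Poly_Mapping.single s c \<star> comb_diff gdeg d q)"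
    using subset_UNIV[of "Poly_Mapping.keys q"]
  proof (induction q rule: comb_induct)
    case (add t b q)
    have "comb_diff gdeg d (Poly_Mapping.single s c \<star> Poly_Mapping.single t b) =
        comb_diff gdeg d (Poly_Mapping.single s c) \<star> Poly_Mapping.single t b +
        pscale ((-1) powi m) (Poly_Mapping.single s c \<star> comb_diff gdeg d (Poly_Mapping.single t b))"
      using \<open>s \<in> _\<close>
      by (simp add: comb_mult_single comb_diff_single comb_diff_scale comb_scale_eq comb_mult_scale_left
          comb_mult_scale_right pvs.scale_right_distrib mult_ac
          single_eq_pscale[of t b] single_eq_pscale[of s c] del: pscale_single)
    with add show ?case
      by (simp add: comb_mult_add_right comb_diff_add pvs.scale_right_distrib)
  qed (simp_all add: comb_mult_zero_right comb_diff_zero)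
  with add show ?case
    by (simp add: comb_mult_add_left comb_diff_add pvs.scale_right_distrib)
qed

section \<open>Substituting elements for generators\<close>

context total_dgl
begin

primrec word_val :: "('g \<Rightarrow> int) \<Rightarrow> ('g \<Rightarrow> 'b) \<Rightarrow> 'g word \<Rightarrow> 'b" where
  "word_val gdeg Y (Gen g) = Y g"
| "word_val gdeg Y (Br s t) =
     br (word_deg gdeg s) (word_deg gdeg t) (word_val gdeg Y s) (word_val gdeg Y t)"

definition comb_val :: "('g \<Rightarrow> int) \<Rightarrow> ('g \<Rightarrow> 'b) \<Rightarrow> 'g word_comb \<Rightarrow> 'b" where
  "comb_val gdeg Y p = lext scale (word_val gdeg Y) p"

lemma vector_space_scale: "vector_space scale"
  by unfold_locales

lemmas comb_val_add = lext_add[OF vector_space_scale, of "word_val gdeg Y" for gdeg Y, folded comb_val_def]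
  and comb_val_scale = lext_pscale[OF vector_space_scale, of "word_val gdeg Y" for gdeg Y, folded comb_val_def]
  and comb_val_single = lext_single[OF vector_space_scale, of "word_val gdeg Y" for gdeg Y, folded comb_val_def]
  and comb_val_diff = lext_diff[OF vector_space_scale, of "word_val gdeg Y" for gdeg Y, folded comb_val_def]
  and comb_val_zero = lext_zero[OF vector_space_scale, of "word_val gdeg Y" for gdeg Y, folded comb_val_def]
  and comb_val_sum = lext_sum[OF vector_space_scale, of "word_val gdeg Y" for gdeg Y, folded comb_val_def]

text \<open>All words of p have degree l and all words of q degree m, hence the degree parameters of
  \<open>br\<close> are the same in every term.\<close>

lemma comb_val_mult:
  assumes "p \<in> comb_piece G gdeg l" and q: "q \<in> comb_piece G gdeg m"
  shows "comb_val gdeg Y (p \<star> q) = br l m (comb_val gdeg Y p) (comb_val gdeg Y q)"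
  using assms(1)[unfolded comb_piece_iff]
proof (induction p rule: comb_induct)
  case zero
  then show ?case by (simp add: comb_mult_zero_left comb_val_zero)
next
  case (add s c p)
  have "comb_val gdeg Y (Poly_Mapping.single s c \<star> q) =
      br l m (comb_val gdeg Y (Poly_Mapping.single s c)) (comb_val gdeg Y q)"
    using q[unfolded comb_piece_iff]
  proof (induction q rule: comb_induct)
    case zero
    then show ?case by (simp add: comb_mult_zero_right comb_val_zero)
  next
    case (add t b q)
    then show ?case
      using \<open>s \<in> _\<close>
      by (auto simp: comb_mult_add_right comb_val_add comb_mult_single comb_val_single br_add_right
          br_scale_left br_scale_right)
  qed
  with add show ?case by (simp add: comb_mult_add_left comb_val_add br_add_left)
qed

text \<open>The relations are instances of identities that \<open>total_dgl\<close> imposes on all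
  arguments, so every substitution annihilates the ideal they generate.\<close>

lemma comb_val_lie_relation: "lie_relation G gdeg m p \<Longrightarrow> comb_val gdeg Y p = 0"
proof (induction rule: lie_relation.induct)
  case (mult_left p l m q)
  then show ?case by (simp add: comb_val_mult[OF mult_left(1) lie_relation_comb_piece[OF mult_left(2)]])
next
  case (mult_right l p q m)
  then show ?case by (simp add: comb_val_mult[OF lie_relation_comb_piece[OF mult_right(1)] mult_right(2)])
next
  case (antisymmetry p l q m)
  then show ?case
    using br_antisym[of l m "comb_val gdeg Y p" "comb_val gdeg Y q"]
    by (simp add: comb_val_add comb_scale_eq comb_val_scale comb_val_mult)
next
  case (jacobi p l q m r n)
  then show ?case
    using br_jacobi[of l m n "comb_val gdeg Y p" "comb_val gdeg Y q" "comb_val gdeg Y r"]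
    by (simp add: comb_val_diff comb_scale_eq comb_val_scale comb_val_mult
        comb_val_mult[OF jacobi(1) comb_piece_mult[OF jacobi(2,3)]]
        comb_val_mult[OF comb_piece_mult[OF jacobi(1,2)] jacobi(3)]
        comb_val_mult[OF jacobi(2) comb_piece_mult[OF jacobi(1,3)]])
qed (simp_all add: comb_val_zero comb_val_add comb_scale_eq comb_val_scale)

lemma word_val_mem:
  assumes "\<And>g. g \<in> G \<Longrightarrow> Y g \<in> V (gdeg g)"
  shows "set_word t \<subseteq> G \<Longrightarrow> word_val gdeg Y t \<in> V (word_deg gdeg t)"
  by (cases t) (auto simp: assms br_mem)

lemma comb_val_mem:
  assumes "\<And>g. g \<in> G \<Longrightarrow> Y g \<in> V (gdeg g)" and "p \<in> comb_piece G gdeg m"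
  shows "comb_val gdeg Y p \<in> V m"
  unfolding comb_val_def lext_def
proof (intro subspace_sum[OF V_subspace] subspace_scale[OF V_subspace])
  fix t assume "t \<in> Poly_Mapping.keys p"
  then have "set_word t \<subseteq> G" "word_deg gdeg t = m" using assms(2) by (auto simp: comb_piece_def)
  then show "word_val gdeg Y t \<in> V m" using word_val_mem[of G Y gdeg t] assms(1) by blast
qed

end

lemma word_diff_mem:
  assumes d: "\<And>g. g \<in> G \<Longrightarrow> \<delta> g \<in> comb_piece G gdeg (gdeg g - 1)"
  shows "set_word t \<subseteq> G \<Longrightarrow> word_diff gdeg \<delta> t \<in> comb_piece G gdeg (word_deg gdeg t - 1)"
proof (induction t)
  case (Br s t)
  have "word_diff gdeg \<delta> s \<star> Poly_Mapping.single t 1 \<in> comb_piece G gdeg (word_deg gdeg s - 1 + word_deg gdeg t)"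
    "Poly_Mapping.single s 1 \<star> word_diff gdeg \<delta> t \<in> comb_piece G gdeg (word_deg gdeg s + (word_deg gdeg t - 1))"
    using Br by (auto intro!: comb_piece_mult comb_piece_single)
  then show ?case
    by (simp add: comb_scale_eq algebra_simps comb_piece_add comb_piece_scale)
qed (simp add: d)

lemma word_algebra_simps:
  "carrier (piece (word_algebra G gdeg \<delta>) m) = comb_piece G gdeg m"
  "p \<oplus>\<^bsub>piece (word_algebra G gdeg \<delta>) m\<^esub> q = p + q"
  "r \<odot>\<^bsub>piece (word_algebra G gdeg \<delta>) m\<^esub> p = pscale r p"
  "\<zero>\<^bsub>piece (word_algebra G gdeg \<delta>) m\<^esub> = 0"
  "bracket (word_algebra G gdeg \<delta>) l m p q = p \<star> q"
  "diff (word_algebra G gdeg \<delta>) m p = comb_diff gdeg \<delta> p"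
  by (simp_all add: word_algebra_def comb_scale_eq)

section \<open>Stability of the Lie relations under the derivation\<close>

context
  fixes G :: "'g set" and gdeg :: "'g \<Rightarrow> int" and \<delta> :: "'g \<Rightarrow> 'g word_comb"
  assumes \<delta>: "\<And>g. g \<in> G \<Longrightarrow> \<delta> g \<in> comb_piece G gdeg (gdeg g - 1)"
begin

lemma comb_diff_mem:
  assumes "p \<in> comb_piece G gdeg m"
  shows "comb_diff gdeg \<delta> p \<in> comb_piece G gdeg (m - 1)"
  using assms[unfolded comb_piece_iff]
  by (induction p rule: comb_induct)
    (auto simp: comb_diff_zero comb_piece_zero comb_diff_add comb_diff_single
      intro!: comb_piece_add comb_piece_scale word_diff_mem[OF \<delta>])

lemma lie_relation_scale: "lie_relation G gdeg m p \<Longrightarrow> lie_relation G gdeg m (pscale c p)"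
  using lie_relation.scale[of G gdeg m p c] by (simp add: comb_scale_eq)

text \<open>A derivation acts on one argument at a time. The derivative of an antisymmetry or Jacobi
  expression is a signed sum of expressions of the same type, with the degree of one argument
  lowered.\<close>

lemma lie_relation_diff: "lie_relation G gdeg m p \<Longrightarrow> lie_relation G gdeg (m - 1) (comb_diff gdeg \<delta> p)"
proof (induction rule: lie_relation.induct)
  case (zero m)
  then show ?case by (simp add: comb_diff_zero lie_relation.zero)
next
  case (add m p q)
  then show ?case by (simp add: comb_diff_add lie_relation.add)
next
  case (scale m p c)
  then show ?case by (simp add: comb_scale_eq comb_diff_scale lie_relation_scale)
next
  case (mult_left p l m q)
  have "lie_relation G gdeg (l - 1 + m) (comb_diff gdeg \<delta> p \<star> q)"
    "lie_relation G gdeg (l + (m - 1)) (p \<star> comb_diff gdeg \<delta> q)"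
    using mult_left by (auto intro!: lie_relation.mult_left comb_diff_mem)
  then show ?case
    by (simp add: comb_diff_mult[OF mult_left(1)] algebra_simps lie_relation.add lie_relation_scale)
next
  case (mult_right l p q m)
  have "lie_relation G gdeg (l - 1 + m) (comb_diff gdeg \<delta> p \<star> q)"
    "lie_relation G gdeg (l + (m - 1)) (p \<star> comb_diff gdeg \<delta> q)"
    using mult_right by (auto intro!: lie_relation.mult_right comb_diff_mem)
  then show ?case
    by (simp add: comb_diff_mult[OF lie_relation_comb_piece[OF mult_right(1)]] algebra_simps
        lie_relation.add lie_relation_scale)
next
  case (antisymmetry p l q m)
  let ?d = "comb_diff gdeg \<delta>"
  have "lie_relation G gdeg (l - 1 + m) (?d p \<star> q + comb_scale ((-1) powi ((l - 1) * m)) (q \<star> ?d p))"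
    "lie_relation G gdeg (l + (m - 1)) (p \<star> ?d q + comb_scale ((-1) powi (l * (m - 1))) (?d q \<star> p))"
    using antisymmetry by (auto intro!: lie_relation.antisymmetry comb_diff_mem)
  moreover have "?d (p \<star> q + comb_scale ((-1) powi (l * m)) (q \<star> p)) =
      (?d p \<star> q + comb_scale ((-1) powi ((l - 1) * m)) (q \<star> ?d p)) +
      pscale ((-1) powi l) (p \<star> ?d q + comb_scale ((-1) powi (l * (m - 1))) (?d q \<star> p))"
    unfolding comb_diff_add comb_scale_eq comb_diff_scale comb_diff_mult[OF antisymmetry(1)]
      comb_diff_mult[OF antisymmetry(2)] pvs.scale_right_distrib pvs.scale_scale powi_minus_one_parity
    by (cases "even l"; cases "even m"; simp)
  ultimately show ?case
    by (simp only: lie_relation.add lie_relation_scale add_diff_eq diff_add_eq)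
next
  case (jacobi p l q m r n)
  let ?d = "comb_diff gdeg \<delta>"
  let ?J = "\<lambda>l m p q r. p \<star> (q \<star> r) - (p \<star> q) \<star> r - comb_scale ((-1) powi (l * m)) (q \<star> (p \<star> r))"
  have "lie_relation G gdeg (l - 1 + m + n) (?J (l - 1) m (?d p) q r)"
    "lie_relation G gdeg (l + (m - 1) + n) (?J l (m - 1) p (?d q) r)"
    "lie_relation G gdeg (l + m + (n - 1)) (?J l m p q (?d r))"
    using jacobi by (auto intro!: lie_relation.jacobi comb_diff_mem)
  moreover have "?d (?J l m p q r) = ?J (l - 1) m (?d p) q r + pscale ((-1) powi l) (?J l (m - 1) p (?d q) r) +
      pscale ((-1) powi (l + m)) (?J l m p q (?d r))"
    unfolding comb_diff_diff comb_scale_eq comb_diff_scale comb_diff_mult[OF jacobi(1)]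
      comb_diff_mult[OF jacobi(2)] comb_diff_mult[OF comb_piece_mult[OF jacobi(1,2)]]
      comb_mult_add_left comb_mult_add_right comb_mult_scale_left comb_mult_scale_right
      pvs.scale_right_distrib pvs.scale_right_diff_distrib pvs.scale_scale powi_minus_one_parity
    by (cases "even l"; cases "even m"; simp)
  moreover have "l - 1 + m + n = l + m + n - 1" "l + (m - 1) + n = l + m + n - 1"
    "l + m + (n - 1) = l + m + n - 1" by auto
  ultimately show ?case
    by (simp only: lie_relation.add lie_relation_scale)
qed

lemma lie_dg_ideal: "dg_ideal (word_algebra G gdeg \<delta>) (lie_ideal G gdeg)"
proof (rule dg_ideal.intro; (unfold word_algebra_simps)?)
  show "module rat_field (piece (word_algebra G gdeg \<delta>) m)" for m
  proof (rule moduleI)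
    show "cring rat_field" by (rule cring_from_type_algebra)
    show "abelian_group (piece (word_algebra G gdeg \<delta>) m)"
    proof (rule abelian_groupI, unfold word_algebra_simps)
      show "\<exists>q\<in>comb_piece G gdeg m. q + p = 0" if "p \<in> comb_piece G gdeg m" for p
        using comb_piece_uminus[OF that] by (intro bexI[of _ "- p"]) simp_all
    qed (simp_all add: comb_piece_zero comb_piece_add add_ac)
  qed (simp_all add: word_algebra_simps comb_piece_scale pvs.scale_left_distrib pvs.scale_right_distrib)
  show "linear_map (piece (word_algebra G gdeg \<delta>) l) (piece (word_algebra G gdeg \<delta>) (l + m)) (\<lambda>p. p \<star> q)"
    if "q \<in> comb_piece G gdeg m" for q l m
    using that by (auto simp: linear_map_def word_algebra_simps comb_piece_mult comb_mult_add_left comb_mult_scale_left)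
  show "linear_map (piece (word_algebra G gdeg \<delta>) m) (piece (word_algebra G gdeg \<delta>) (l + m)) ((\<star>) p)"
    if "p \<in> comb_piece G gdeg l" for p l m
    using that by (auto simp: linear_map_def word_algebra_simps comb_piece_mult comb_mult_add_right comb_mult_scale_right)
  show "linear_map (piece (word_algebra G gdeg \<delta>) m) (piece (word_algebra G gdeg \<delta>) (m - 1))
      (comb_diff gdeg \<delta>)" for m
    by (auto simp: linear_map_def word_algebra_simps comb_diff_mem comb_diff_add comb_diff_scale)
qed (auto simp: lie_ideal_def lie_relation_comb_piece lie_relation_scale lie_relation_diff
    intro: lie_relation.intros)

end

text \<open>Substituting after differentiating and differentiating after substituting obey the same
  Leibniz rule, so agreement on generators propagates to words.\<close>

lemma (in total_dgl) comb_val_word_diff: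
  assumes \<delta>: "\<And>g. g \<in> G \<Longrightarrow> \<delta> g \<in> comb_piece G gdeg (gdeg g - 1)"
    and Y: "\<And>g. g \<in> G \<Longrightarrow> comb_val gdeg Y (\<delta> g) = d (gdeg g) (Y g)"
  shows "set_word t \<subseteq> G \<Longrightarrow> comb_val gdeg Y (word_diff gdeg \<delta> t) = d (word_deg gdeg t) (word_val gdeg Y t)"
proof (induction t)
  case (Br s t)
  then have st: "set_word s \<subseteq> G" "set_word t \<subseteq> G" by auto
  have "comb_val gdeg Y (word_diff gdeg \<delta> s \<star> Poly_Mapping.single t 1) =
      br (word_deg gdeg s - 1) (word_deg gdeg t) (d (word_deg gdeg s) (word_val gdeg Y s)) (word_val gdeg Y t)"
    using Br st by (subst comb_val_mult[OF word_diff_mem[OF \<delta> st(1)] comb_piece_single[OF st(2) refl]])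
      (simp_all add: comb_val_single)
  moreover have "comb_val gdeg Y (Poly_Mapping.single s 1 \<star> word_diff gdeg \<delta> t) =
      br (word_deg gdeg s) (word_deg gdeg t - 1) (word_val gdeg Y s) (d (word_deg gdeg t) (word_val gdeg Y t))"
    using Br st by (subst comb_val_mult[OF comb_piece_single[OF st(1) refl] word_diff_mem[OF \<delta> st(2)]])
      (simp_all add: comb_val_single)
  ultimately show ?case
    by (simp add: comb_val_add comb_scale_eq comb_val_scale d_br)
qed (simp add: Y)

lemma (in total_dgl) comb_val_comb_diff:
  assumes \<delta>: "\<And>g. g \<in> G \<Longrightarrow> \<delta> g \<in> comb_piece G gdeg (gdeg g - 1)"
    and Y: "\<And>g. g \<in> G \<Longrightarrow> comb_val gdeg Y (\<delta> g) = d (gdeg g) (Y g)"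
    and p: "p \<in> comb_piece G gdeg m"
  shows "comb_val gdeg Y (comb_diff gdeg \<delta> p) = d m (comb_val gdeg Y p)"
  using p[unfolded comb_piece_iff]
proof (induction p rule: comb_induct)
  case zero
  then show ?case by (simp add: comb_diff_zero comb_val_zero)
next
  case (add t c q)
  then show ?case
    using comb_val_word_diff[of G \<delta> gdeg Y t, OF \<delta> Y]
    by (auto simp: comb_diff_add comb_diff_single comb_val_add comb_val_scale comb_val_single d_add d_scale)
qed

section \<open>Morphisms out of a free differential graded Lie algebra\<close>

context
  fixes G :: "'g set" and gdeg :: "'g \<Rightarrow> int" and \<delta> :: "'g \<Rightarrow> 'g word_comb" and L :: "'a dg_data"
  assumes \<delta>: "\<And>g. g \<in> G \<Longrightarrow> \<delta> g \<in> comb_piece G gdeg (gdeg g - 1)"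
    and L: "dgl L"
begin

interpretation L: dgl L by (fact L)

interpretation W: dg_ideal "word_algebra G gdeg \<delta>" "lie_ideal G gdeg"
  using \<delta> by (rule lie_dg_ideal)

private abbreviation "F \<equiv> free_dgl G gdeg \<delta>"

private abbreviation "cl \<equiv> free_class G gdeg \<delta>"

lemma free_class_eq: "cl m p = W.cls m p"
  by (simp add: free_class_def W.cls_def)

lemmas free_carrier = W.quot_carrier[folded free_dgl_def, unfolded word_algebra_simps, folded free_class_eq[abs_def]]
  and free_add = W.quot_add[folded free_dgl_def, unfolded word_algebra_simps, folded free_class_eq]
  and free_smult = W.quot_smult[folded free_dgl_def, unfolded word_algebra_simps, folded free_class_eq]
  and free_bracket = W.quot_bracket[folded free_dgl_def, unfolded word_algebra_simps, folded free_class_eq]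
  and free_diff = W.quot_diff[folded free_dgl_def, unfolded word_algebra_simps, folded free_class_eq]

lemma free_class_mem: "p \<in> comb_piece G gdeg m \<Longrightarrow> cl m p \<in> carrier (piece F m)"
  by (simp add: free_carrier)

context
  fixes \<phi>
  assumes \<phi>: "dgl_hom F L \<phi>"
begin

definition generator_values :: "'g \<Rightarrow> 'a \<Rightarrow>\<^sub>0 rat" where
  "generator_values g = em L (gdeg g) (\<phi> (gdeg g) (cl (gdeg g) (Poly_Mapping.single (Gen g) 1)))"

lemma hom_linear: "linear_map (piece F m) (piece L m) (\<phi> m)"
  using \<phi> by (simp add: dgl_hom_def)

lemma hom_mem: "p \<in> comb_piece G gdeg m \<Longrightarrow> \<phi> m (cl m p) \<in> carrier (piece L m)"
  using linear_mapD(1)[OF hom_linear] free_class_mem by blast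

lemma hom_word:
  "set_word t \<subseteq> G \<Longrightarrow> em L (word_deg gdeg t)
     (\<phi> (word_deg gdeg t) (cl (word_deg gdeg t) (Poly_Mapping.single t 1))) =
   L.T.word_val gdeg generator_values t"
proof (induction t)
  case (Gen g)
  then show ?case by (simp add: generator_values_def)
next
  case (Br s t)
  have s: "Poly_Mapping.single s 1 \<in> comb_piece G gdeg (word_deg gdeg s)"
    and t: "Poly_Mapping.single t 1 \<in> comb_piece G gdeg (word_deg gdeg t)"
    using Br by (auto intro: comb_piece_single)
  have "cl (word_deg gdeg (Br s t)) (Poly_Mapping.single (Br s t) 1) =
      bracket F (word_deg gdeg s) (word_deg gdeg t)
        (cl (word_deg gdeg s) (Poly_Mapping.single s 1))
        (cl (word_deg gdeg t) (Poly_Mapping.single t 1))"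
    by (simp add: free_bracket[OF s t] comb_mult_single)
  then have "\<phi> (word_deg gdeg (Br s t)) (cl (word_deg gdeg (Br s t)) (Poly_Mapping.single (Br s t) 1)) =
      bracket L (word_deg gdeg s) (word_deg gdeg t)
        (\<phi> (word_deg gdeg s) (cl (word_deg gdeg s) (Poly_Mapping.single s 1)))
        (\<phi> (word_deg gdeg t) (cl (word_deg gdeg t) (Poly_Mapping.single t 1)))"
    using \<phi> free_class_mem[OF s] free_class_mem[OF t] by (simp add: dgl_hom_def)
  then show ?case
    using Br by (simp add: L.total_bracket_em[OF hom_mem[OF s] hom_mem[OF t], symmetric])
qed

lemma hom_value:
  assumes "p \<in> comb_piece G gdeg m"
  shows "em L m (\<phi> m (cl m p)) = L.T.comb_val gdeg generator_values p"
proof -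
  \<comment> \<open>Membership is carried along because the induction rule does not provide it for
    the remaining sum.\<close>
  have "p \<in> comb_piece G gdeg m \<and>
      em L m (\<phi> m (cl m p)) = L.T.comb_val gdeg generator_values p"
    using assms[unfolded comb_piece_iff]
  proof (induction p rule: comb_induct)
    case zero
    \<comment> \<open>Zero is written as a scalar multiple by 0, which a linear map is known to
      respect.\<close>
    have "\<phi> m (cl m (pscale 0 0)) = 0 \<odot>\<^bsub>piece L m\<^esub> \<phi> m (cl m 0)"
      unfolding free_smult[OF comb_piece_zero, symmetric]
      by (rule linear_mapD(3)[OF hom_linear free_class_mem[OF comb_piece_zero]])
    then show ?case
      using L.em_smult[OF hom_mem[OF comb_piece_zero], of m 0] by (simp add: comb_piece_zero L.T.comb_val_zero)
  next
    case (add t c q)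
    have t: "set_word t \<subseteq> G" "word_deg gdeg t = m" using add by auto
    have t1: "Poly_Mapping.single t 1 \<in> comb_piece G gdeg m" using t by (rule comb_piece_single)
    have q: "q \<in> comb_piece G gdeg m" using add by simp
    have "cl m (Poly_Mapping.single t c + q) =
        c \<odot>\<^bsub>piece F m\<^esub> cl m (Poly_Mapping.single t 1)
        \<oplus>\<^bsub>piece F m\<^esub> cl m q"
      using free_add[OF comb_piece_scale[OF t1] q, of c] by (simp add: free_smult[OF t1] pscale_single)
    moreover have "c \<odot>\<^bsub>piece F m\<^esub> cl m (Poly_Mapping.single t 1)
        \<in> carrier (piece F m)"
      unfolding free_smult[OF t1] by (intro free_class_mem comb_piece_scale t1)
    ultimately have "\<phi> m (cl m (Poly_Mapping.single t c + q)) =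
        c \<odot>\<^bsub>piece L m\<^esub> \<phi> m (cl m (Poly_Mapping.single t 1)) \<oplus>\<^bsub>piece L m\<^esub>
          \<phi> m (cl m q)"
      using linear_mapD(2,3)[OF hom_linear] free_class_mem[OF q] free_class_mem[OF t1] by metis
    then have "em L m (\<phi> m (cl m (Poly_Mapping.single t c + q))) =
        pscale c (em L m (\<phi> m (cl m (Poly_Mapping.single t 1)))) +
          em L m (\<phi> m (cl m q))"
      by (simp add: L.em_add[OF L.smult_mem[OF hom_mem[OF t1]] hom_mem[OF q]] L.em_smult[OF hom_mem[OF t1]])
    moreover have "em L m (\<phi> m (cl m (Poly_Mapping.single t 1))) =
        L.T.word_val gdeg generator_values t"
      using hom_word[OF t(1)] t(2) by simp
    ultimately have "em L m (\<phi> m (cl m (Poly_Mapping.single t c + q))) =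
        L.T.comb_val gdeg generator_values (Poly_Mapping.single t c + q)"
      using add by (simp add: L.T.comb_val_add L.T.comb_val_single)
    then show ?case using q t by (auto intro!: comb_piece_add comb_piece_single)
  qed
  then show ?thesis ..
qed

lemma generator_values_mem: "g \<in> G \<Longrightarrow> generator_values g \<in> total_piece L (gdeg g)"
  unfolding generator_values_def by (intro L.em_mem hom_mem comb_piece_single) auto

lemma generator_values_diff:
  assumes "g \<in> G"
  shows "L.T.comb_val gdeg generator_values (\<delta> g) = total_diff L (gdeg g) (generator_values g)"
proof -
  have g: "Poly_Mapping.single (Gen g) 1 \<in> comb_piece G gdeg (gdeg g)"
    using assms by (intro comb_piece_single) auto
  have "cl (gdeg g - 1) (\<delta> g) =
      diff F (gdeg g) (cl (gdeg g) (Poly_Mapping.single (Gen g) 1))"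
    by (simp add: free_diff[OF g] comb_diff_single)
  then have "\<phi> (gdeg g - 1) (cl (gdeg g - 1) (\<delta> g)) =
      diff L (gdeg g) (\<phi> (gdeg g) (cl (gdeg g) (Poly_Mapping.single (Gen g) 1)))"
    using \<phi> free_class_mem[OF g] by (simp add: dgl_hom_def)
  then show ?thesis
    using hom_value[OF \<delta>[OF assms]] L.total_diff_em[OF hom_mem[OF g]]
    by (simp add: generator_values_def)
qed

end

lemma free_hom_exists:
  assumes Y: "\<And>g. g \<in> G \<Longrightarrow> Y g \<in> total_piece L (gdeg g)"
    and dY: "\<And>g. g \<in> G \<Longrightarrow> L.T.comb_val gdeg Y (\<delta> g) = total_diff L (gdeg g) (Y g)"
  shows "\<exists>\<phi>. dgl_hom F L \<phi> \<and>
    (\<forall>m. \<forall>p\<in>comb_piece G gdeg m. em L m (\<phi> m (cl m p)) = L.T.comb_val gdeg Y p)"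
proof -
  let ?c = "L.T.comb_val gdeg Y"
  \<comment> \<open>Any representative serves: two of them differ by a Lie relation, on which the
    substitution vanishes.\<close>
  define \<phi> where "\<phi> m A = ev L m (?c (SOME p. p \<in> A))" for m A
  have \<phi>: "\<phi> m (cl m p) = ev L m (?c p)" for m p
  proof -
    have "?c q = ?c p" if "q \<in> W.cls m p" for q
      using that by (auto simp: W.mem_cls word_algebra_simps lie_ideal_def L.T.comb_val_add
          L.T.comb_val_lie_relation)
    then have "?c (SOME q. q \<in> W.cls m p) = ?c p"
      using W.cls_nonempty[of m p] by (metis ex_in_conv someI_ex)
    then show ?thesis by (simp add: \<phi>_def free_class_eq)
  qed
  have em: "em L m (ev L m (?c p)) = ?c p" if "p \<in> comb_piece G gdeg m" for m p
    using L.T.comb_val_mem[of G Y gdeg p m] Y that by (simp add: L.total_piece_iff)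
  have "dgl_hom F L \<phi>"
    unfolding dgl_hom_def linear_map_def
  proof (intro conjI allI ballI)
    show "\<phi> m \<in> carrier (piece F m) \<rightarrow> carrier (piece L m)" for m
      by (auto simp: \<phi>_def L.ev_mem)
  next
    fix m A C assume "A \<in> carrier (piece F m)" "C \<in> carrier (piece F m)"
    then obtain p q where "p \<in> comb_piece G gdeg m" "q \<in> comb_piece G gdeg m"
      "A = cl m p" "C = cl m q"
      by (auto simp: free_carrier)
    then show "\<phi> m (A \<oplus>\<^bsub>piece F m\<^esub> C) = \<phi> m A \<oplus>\<^bsub>piece L m\<^esub> \<phi> m C"
      by (simp add: free_add \<phi> L.T.comb_val_add L.ev_add)
  next
    fix m c A assume "A \<in> carrier (piece F m)"
    then obtain p where "p \<in> comb_piece G gdeg m" "A = cl m p"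
      by (auto simp: free_carrier)
    then show "\<phi> m (c \<odot>\<^bsub>piece F m\<^esub> A) = c \<odot>\<^bsub>piece L m\<^esub> \<phi> m A"
      by (simp add: free_smult \<phi> L.T.comb_val_scale L.ev_pscale)
  next
    fix l m A C assume "A \<in> carrier (piece F l)" "C \<in> carrier (piece F m)"
    then obtain p q where pq: "p \<in> comb_piece G gdeg l" "q \<in> comb_piece G gdeg m"
      and AC: "A = cl l p" "C = cl m q"
      by (auto simp: free_carrier)
    have "total_bracket L l m (?c p) (?c q) = em L (l + m) (bracket L l m (ev L l (?c p)) (ev L m (?c q)))"
      by (simp add: total_bracket_def)
    then show "\<phi> (l + m) (bracket F l m A C) = bracket L l m (\<phi> l A) (\<phi> m C)"
      using pq by (simp add: AC free_bracket \<phi> L.T.comb_val_mult L.ev_em[OF L.bracket_mem[OF L.ev_mem L.ev_mem]])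
  next
    fix m A assume "A \<in> carrier (piece F m)"
    then obtain p where p: "p \<in> comb_piece G gdeg m" and A: "A = cl m p"
      by (auto simp: free_carrier)
    have "?c (comb_diff gdeg \<delta> p) = em L (m - 1) (diff L m (ev L m (?c p)))"
      using L.T.comb_val_comb_diff[of G \<delta> gdeg Y p m] \<delta> dY p by (simp add: total_diff_def)
    then show "\<phi> (m - 1) (diff F m A) = diff L m (\<phi> m A)"
      using p by (simp add: A free_diff \<phi> L.ev_em[OF L.diff_mem[OF L.ev_mem]])
  qed
  then show ?thesis using em by (intro exI[of _ \<phi>]) (simp add: \<phi>)
qed

end

section \<open>Whitehead sets and Maurer--Cartan solutions\<close>

lemma comb_piece_sum: "(\<And>x. x \<in> A \<Longrightarrow> f x \<in> comb_piece G gdeg m) \<Longrightarrow> sum f A \<in> comb_piece G gdeg m"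
  by (induction A rule: infinite_finite_induct) (simp_all add: comb_piece_zero comb_piece_add)

lemma sorted_list_wh_index:
  assumes "J \<subset> {1..k}" and "J \<noteq> {}"
  shows "sorted_list_of_set J \<in> wh_index k"
proof -
  have "finite J" using assms finite_subset by blast
  moreover have "card J < k" using psubset_card_mono[OF _ assms(1)] by simp
  ultimately show ?thesis
    using assms by (auto simp: wh_index_def Suc_le_eq card_gt_0_iff)
qed

lemma wh_indexD:
  assumes "I \<in> wh_index k"
  shows "sorted_wrt (<) I" and "set I \<subset> {1..k}" and "set I \<noteq> {}"
proof -
  show "sorted_wrt (<) I" using assms by (simp add: wh_index_def)
  then have "card (set I) = length I" by (simp add: strict_sorted_iff distinct_card)
  then show "set I \<subset> {1..k}" using assms by (auto simp: wh_index_def)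
  show "set I \<noteq> {}" using assms by (auto simp: wh_index_def)
qed

lemma wh_diff_mem:
  assumes I: "sorted_wrt (<) I" and "set I \<subseteq> {1..k}"
  shows "wh_diff n I \<in> comb_piece (wh_index k) (wh_deg n) (sum n (set I) - 2)"
  unfolding wh_diff_eq_sum_splits[OF I]
proof (rule comb_piece_sum, clarify)
  fix J K assume JK: "(J, K) \<in> splits (set I)"
  then have "J \<subset> {1..k}" "J \<noteq> {}" "K \<subset> {1..k}" "K \<noteq> {}"
    using assms(2) by (auto simp: splits_def)
  moreover have "finite J" "finite K" and "J \<union> K = set I" "J \<inter> K = {}"
    using JK by (auto simp: splits_def intro: finite_subset[of _ "set I"])
  moreover from this have "sum n (set I) = sum n J + sum n K"
    using sum.union_disjoint[of J K n] by simp
  ultimately show "Poly_Mapping.single (Br (Gen (sorted_list_of_set J)) (Gen (sorted_list_of_set K)))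
      (split_sign n J K) \<in> comb_piece (wh_index k) (wh_deg n) (sum n (set I) - 2)"
    by (intro comb_piece_single) (auto simp: wh_deg_sorted_list sorted_list_wh_index)
qed

text \<open>The differential sums over the splittings with the head of I on the left, the curvature
  over all of them. The transposed splittings contribute equally, which accounts for the factor
  1/2.\<close>

lemma (in total_dgl) comb_val_wh_diff:
  assumes I: "sorted_wrt (<) I"
  shows "comb_val (wh_deg n) Y (wh_diff n I) = (1/2) *s curvature n (\<lambda>J. Y (sorted_list_of_set J)) (set I)"
proof (cases "I = []")
  case True
  \<comment> \<open>The empty list has no meaningful head, so it is kept apart; both sides are empty
    sums.\<close>
  have "splits ({} :: nat set) = {}" by (auto simp: splits_def)
  then show ?thesis
    using True by (simp add: wh_diff_eq_sum_splits curvature_def comb_val_zero)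
next
  case False
  let ?Y = "\<lambda>J. Y (sorted_list_of_set J)"
  let ?P = "{(J, K) \<in> splits (set I). hd I \<in> J}" and ?Q = "{(J, K) \<in> splits (set I). hd I \<in> K}"
  have fin: "finite (splits (set I))" by (simp add: finite_splits)
  have "comb_val (wh_deg n) Y (wh_diff n I) = (\<Sum>(J, K)\<in>?P. pairing n ?Y ?Y J K)"
    unfolding wh_diff_eq_sum_splits[OF I] comb_val_sum
  proof (intro sum.cong refl, clarify)
    fix J K assume "(J, K) \<in> splits (set I)"
    then have "finite J" "finite K" by (auto simp: splits_def intro: finite_subset[of _ "set I"])
    then show "comb_val (wh_deg n) Y (Poly_Mapping.single
        (Br (Gen (sorted_list_of_set J)) (Gen (sorted_list_of_set K))) (split_sign n J K)) = pairing n ?Y ?Y J K"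
      by (simp add: comb_val_single pairing_def wh_deg_sorted_list)
  qed
  moreover have "curvature n ?Y (set I) =
      (\<Sum>(J, K)\<in>?P. pairing n ?Y ?Y J K) + (\<Sum>(J, K)\<in>?P. pairing n ?Y ?Y J K)"
  proof -
    have U: "splits (set I) = ?P \<union> ?Q"
      using False hd_in_set[of I] by (auto simp: splits_def)
    have D: "?P \<inter> ?Q = {}"
      by (auto simp: splits_def)
    have F: "finite ?P" "finite ?Q" using fin by (auto intro: finite_subset[of _ "splits (set I)"])
    have "curvature n ?Y (set I) = (\<Sum>(J, K)\<in>?P \<union> ?Q. pairing n ?Y ?Y J K)"
      unfolding curvature_def by (rule sum.cong[OF U refl])
    also have "\<dots> = (\<Sum>(J, K)\<in>?P. pairing n ?Y ?Y J K) + (\<Sum>(J, K)\<in>?Q. pairing n ?Y ?Y J K)"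
      by (rule sum.union_disjoint[OF F D])
    also have "(\<Sum>(J, K)\<in>?Q. pairing n ?Y ?Y J K) = (\<Sum>(J, K)\<in>?P. pairing n ?Y ?Y J K)"
      by (rule sum.reindex_bij_witness[of _ "\<lambda>(J, K). (K, J)" "\<lambda>(J, K). (K, J)"])
        (auto simp: splits_def intro!: pairing_commute)
    finally show ?thesis .
  qed
  ultimately show ?thesis
    by (simp add: scale_right_distrib flip: scale_left_distrib)
qed

context dgl
begin

abbreviation obstruction :: "(nat \<Rightarrow> int) \<Rightarrow> nat \<Rightarrow> (nat set \<Rightarrow> 'a \<Rightarrow>\<^sub>0 rat) \<Rightarrow> 'a" where
  "obstruction n k Y \<equiv> ev L (sum n {1..k} - 2) (pscale (1/2) (T.curvature n Y {1..k}))"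

lemma ev_curvature:
  assumes "T.solution n {1..k} Y"
  shows "em L (sum n {1..k} - 2) (obstruction n k Y) =
      pscale (1/2) (T.curvature n Y {1..k})"
    and "obstruction n k Y \<in> cycles L (sum n {1..k} - 2)"
proof -
  have "pscale (1/2) (T.curvature n Y {1..k}) \<in> total_piece L (sum n {1..k} - 2)"
    by (intro T.subspace_scale T.V_subspace T.curvature_mem) simp
  then show 1: "em L (sum n {1..k} - 2) (obstruction n k Y) =
      pscale (1/2) (T.curvature n Y {1..k})"
    by (simp add: total_piece_iff)
  have "total_diff L (sum n {1..k} - 2) (T.curvature n Y {1..k}) = 0"
    using assms by (intro T.d_curvature) (auto simp: T.solution_def)
  then show "obstruction n k Y \<in> cycles L (sum n {1..k} - 2)"
    unfolding cycles_iff 1 by (simp add: ev_mem T.d_scale)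
qed

text \<open>\<open>comb_val_wh_diff\<close> serves twice: on generators it turns compatibility with
  the differential into the Maurer--Cartan equation, and at the top it evaluates the cycle w as half
  the curvature.\<close>

lemma whitehead_set_eq:
  assumes k: "2 \<le> k" and z: "\<And>i. i \<in> {1..k} \<Longrightarrow> z i \<in> carrier (piece L (n i - 1))"
  shows "whitehead_set L k n z =
    {homology_class L (sum n {1..k} - 2) (obstruction n k Y) | Y.
      T.solution n {1..k} Y \<and> (\<forall>i\<in>{1..k}. Y {i} = em L (n i - 1) (z i))}" (is "_ = ?S")
proof -
  let ?G = "wh_index k" and ?g = "wh_deg n" and ?N = "sum n {1..k} - 2" and ?t = "[1..<Suc k]"
  have \<delta>: "wh_diff n I \<in> comb_piece ?G ?g (?g I - 1)" if "I \<in> ?G" for I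
    using wh_diff_mem[of I k n] wh_indexD[OF that] wh_deg_eq[of I n] by auto
  have top: "sorted_wrt (<) ?t" "set ?t = {1..k}" by (auto simp del: upt_Suc)
  have top_mem: "wh_diff n ?t \<in> comb_piece ?G ?g ?N"
    using wh_diff_mem[OF top(1), of k n] top(2) by simp
  \<comment> \<open>Indices of generators are shorter than k, so singletons occur among them because
    k is at least 2.\<close>
  have single: "[i] \<in> ?G" "?g [i] = n i - 1" if "i \<in> {1..k}" for i
    using that k by (auto simp: wh_index_def wh_deg_def)
  have gen: "Poly_Mapping.single (Gen I) 1 \<in> comb_piece ?G ?g (?g I)" if "I \<in> ?G" for I
    using that by (intro comb_piece_single) auto
  show ?thesis
  proof (intro equalityI subsetI)
    fix A assume "A \<in> whitehead_set L k n z"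
    then obtain \<phi> where \<phi>: "dgl_hom (wh_algebra k n) L \<phi>"
      and \<phi>z: "\<And>i. i \<in> {1..k} \<Longrightarrow> \<phi> (n i - 1) (wh_generator k n [i]) = z i"
      and A: "A = homology_class L ?N (\<phi> ?N (wh_cycle k n))"
      by (auto simp: whitehead_set_def)
    note hom = \<delta> dgl_axioms \<phi>[unfolded wh_algebra_def]
    define Y where "Y = generator_values ?G ?g (wh_diff n) L \<phi>"
    have Y: "Y I \<in> total_piece L (?g I)" "T.comb_val ?g Y (wh_diff n I) = total_diff L (?g I) (Y I)"
      if "I \<in> ?G" for I
      using generator_values_mem[of ?G "wh_diff n" ?g L \<phi>, OF hom] generator_values_diff[of ?G "wh_diff n" ?g L \<phi>, OF hom] that
      unfolding Y_def by blast+
    let ?Y = "\<lambda>J. Y (sorted_list_of_set J)"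
    have "T.solution n {1..k} ?Y"
      unfolding T.solution_def
    proof (intro allI impI conjI)
      fix J assume J: "J \<subset> {1..k}" "J \<noteq> {}"
      then have fin: "finite J" using finite_subset by blast
      note I = sorted_list_wh_index[OF J]
      show "?Y J \<in> total_piece L (sum n J - 1)"
        using Y(1)[OF I] fin by (simp add: wh_deg_sorted_list)
      show "T.mc_at n ?Y J"
        using Y(2)[OF I] fin T.comb_val_wh_diff[OF wh_indexD(1)[OF I], of n Y]
        by (simp add: T.mc_at_def wh_deg_sorted_list)
    qed
    moreover have "?Y {i} = em L (n i - 1) (z i)" if "i \<in> {1..k}" for i
      using \<phi>z[OF that] single[OF that]
      by (simp add: Y_def generator_values_def[of ?G "wh_diff n" ?g L \<phi>, OF hom] wh_generator_def)
    moreover have "\<phi> ?N (wh_cycle k n) = obstruction n k ?Y"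
    proof -
      have "em L ?N (\<phi> ?N (wh_cycle k n)) = T.comb_val ?g Y (wh_diff n ?t)"
        using hom_value[of ?G "wh_diff n" ?g L \<phi>, OF hom top_mem] by (simp add: wh_cycle_def Y_def)
      moreover have "\<phi> ?N (wh_cycle k n) \<in> carrier (piece L ?N)"
        using hom_mem[of ?G "wh_diff n" ?g L \<phi>, OF hom top_mem] by (simp add: wh_cycle_def)
      ultimately show ?thesis
        using T.comb_val_wh_diff[OF top(1), of n Y] ev_em[of "\<phi> ?N (wh_cycle k n)" ?N] top(2) by simp
    qed
    ultimately show "A \<in> ?S"
      unfolding mem_Collect_eq using A by (intro exI[of _ ?Y] conjI ballI) simp_all
  next
    fix A assume "A \<in> ?S"
    then obtain Y where Y: "T.solution n {1..k} Y" and Yz: "\<And>i. i \<in> {1..k} \<Longrightarrow> Y {i} = em L (n i - 1) (z i)"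
      and A: "A = homology_class L ?N (obstruction n k Y)"
      by auto
    \<comment> \<open>Generators are indexed by sorted lists, solutions by sets; on the finite sets
      that occur the two translations are inverse to each other.\<close>
    let ?Y = "\<lambda>I. Y (set I)"
    have curv: "T.curvature n (\<lambda>J. ?Y (sorted_list_of_set J)) J = T.curvature n Y J" if "J \<subseteq> {1..k}" for J
    proof (rule T.curvature_cong)
      fix K assume "K \<subset> J"
      then have "finite K" using that finite_subset[of K "{1..k}"] by auto
      then show "?Y (sorted_list_of_set K) = Y K" by simp
    qed
    have "\<exists>\<phi>. dgl_hom (free_dgl ?G ?g (wh_diff n)) L \<phi> \<and>
      (\<forall>m. \<forall>p\<in>comb_piece ?G ?g m. em L m (\<phi> m (free_class ?G ?g (wh_diff n) m p)) = T.comb_val ?g ?Y p)"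
    proof (rule free_hom_exists[OF \<delta> dgl_axioms])
      fix I assume I: "I \<in> ?G"
      note I' = wh_indexD[OF I]
      show "?Y I \<in> total_piece L (?g I)"
        using Y I' by (simp add: T.solution_def wh_deg_eq)
      have "T.mc_at n Y (set I)" using Y I' by (simp add: T.solution_def)
      then show "T.comb_val ?g ?Y (wh_diff n I) = total_diff L (?g I) (?Y I)"
        using curv[of "set I"] I' by (simp add: T.comb_val_wh_diff wh_deg_eq T.mc_at_def psubset_imp_subset)
    qed
    then obtain \<phi> where \<phi>: "dgl_hom (free_dgl ?G ?g (wh_diff n)) L \<phi>"
      and val: "\<And>m p. p \<in> comb_piece ?G ?g m \<Longrightarrow>
        em L m (\<phi> m (free_class ?G ?g (wh_diff n) m p)) = T.comb_val ?g ?Y p"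
      by blast
    have mem: "\<phi> m (free_class ?G ?g (wh_diff n) m p) \<in> carrier (piece L m)" if "p \<in> comb_piece ?G ?g m" for m p
      using hom_mem[of ?G "wh_diff n" ?g L \<phi>, OF \<delta> dgl_axioms \<phi> that] .
    have "\<phi> (n i - 1) (wh_generator k n [i]) = z i" if i: "i \<in> {1..k}" for i
    proof -
      have "em L (n i - 1) (\<phi> (n i - 1) (wh_generator k n [i])) = em L (n i - 1) (z i)"
        using val[OF gen[OF single(1)[OF i]]] single(2)[OF i] Yz[OF i]
        by (simp add: wh_generator_def T.comb_val_single)
      then show ?thesis
        using mem[OF gen[OF single(1)[OF i]]] z[OF i] single(2)[OF i]
        by (simp add: wh_generator_def em_eq_iff)
    qed
    moreover have "\<phi> ?N (wh_cycle k n) = obstruction n k Y"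
      using val[OF top_mem] ev_em[OF mem[OF top_mem]] T.comb_val_wh_diff[OF top(1), of n ?Y] top(2) curv[of "{1..k}"]
      by (simp add: wh_cycle_def)
    ultimately show "A \<in> whitehead_set L k n z"
      unfolding whitehead_set_def using \<phi> A by (auto simp: wh_algebra_def intro!: exI[of _ \<phi>])
  qed
qed

end

lemma (in dgl) whitehead_setI:
  assumes "2 \<le> k" and "\<And>i. i \<in> {1..k} \<Longrightarrow> z i \<in> carrier (piece L (n i - 1))"
    and "T.solution n {1..k} Y" and "\<And>i. i \<in> {1..k} \<Longrightarrow> Y {i} = em L (n i - 1) (z i)"
  shows "homology_class L (sum n {1..k} - 2) (obstruction n k Y) \<in> whitehead_set L k n z"
proof -
  have "whitehead_set L k n z =
    {homology_class L (sum n {1..k} - 2) (obstruction n k Y) | Y.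
      T.solution n {1..k} Y \<and> (\<forall>i\<in>{1..k}. Y {i} = em L (n i - 1) (z i))}"
    using assms(1,2) by (rule whitehead_set_eq)
  then show ?thesis using assms(3,4) by blast
qed

lemma (in dgl) whitehead_setD:
  assumes "A \<in> whitehead_set L k n z" and "2 \<le> k"
    and "\<And>i. i \<in> {1..k} \<Longrightarrow> z i \<in> carrier (piece L (n i - 1))"
  shows "\<exists>Y. T.solution n {1..k} Y \<and> (\<forall>i\<in>{1..k}. Y {i} = em L (n i - 1) (z i)) \<and>
    A = homology_class L (sum n {1..k} - 2) (obstruction n k Y)"
proof -
  have "whitehead_set L k n z =
    {homology_class L (sum n {1..k} - 2) (obstruction n k Y) | Y.
      T.solution n {1..k} Y \<and> (\<forall>i\<in>{1..k}. Y {i} = em L (n i - 1) (z i))}"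
    using assms(2,3) by (rule whitehead_set_eq)
  then show ?thesis using assms(1) by blast
qed

section \<open>Invariance under quasi-isomorphisms\<close>

locale dgl_morphism = L: dgl L + M: dgl M for L :: "'a dg_data" and M :: "'b dg_data" +
  fixes f :: "int \<Rightarrow> 'a \<Rightarrow> 'b"
  assumes hom: "dgl_hom L M f"
begin

definition total_map :: "int \<Rightarrow> ('a \<Rightarrow>\<^sub>0 rat) \<Rightarrow> 'b \<Rightarrow>\<^sub>0 rat" where
  "total_map m p = em M m (f m (ev L m p))"

lemma f_linear: "linear_map (piece L m) (piece M m) (f m)"
  using hom by (simp add: dgl_hom_def)

lemmas f_mem = linear_mapD(1)[OF f_linear]

lemma total_map_em: "a \<in> carrier (piece L m) \<Longrightarrow> total_map m (em L m a) = em M m (f m a)"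
  by (simp add: total_map_def L.ev_em)

lemma total_map: "total_dgl_map pscale (total_piece L) (total_bracket L) (total_diff L)
    pscale (total_piece M) (total_bracket M) (total_diff M) total_map"
proof
  show "total_map m a \<in> total_piece M m" for m a
    unfolding total_map_def by (intro M.em_mem f_mem L.ev_mem)
  show "total_map m (a + b) = total_map m a + total_map m b" for m a b
    unfolding total_map_def
    by (simp add: L.ev_add linear_mapD(2)[OF f_linear] L.ev_mem M.em_add f_mem)
  show "total_map m (pscale r a) = pscale r (total_map m a)" for m r a
    unfolding total_map_def
    by (simp add: L.ev_pscale linear_mapD(3)[OF f_linear] L.ev_mem M.em_smult f_mem)
  show "total_map (l + m) (total_bracket L l m a b) = total_bracket M l m (total_map l a) (total_map m b)"
    for l m a b
    using hom unfolding total_map_def total_bracket_def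
    by (simp add: dgl_hom_def L.ev_mem L.ev_em L.bracket_mem M.ev_em f_mem)
  show "total_map (m - 1) (total_diff L m a) = total_diff M m (total_map m a)" for m a
    using hom unfolding total_map_def total_diff_def
    by (simp add: dgl_hom_def L.ev_mem L.ev_em L.diff_mem M.ev_em f_mem)
qed

sublocale F: total_dgl_map pscale "total_piece L" "total_bracket L" "total_diff L"
    pscale "total_piece M" "total_bracket M" "total_diff M" total_map
  by (rule total_map)

lemma f_cycle: "a \<in> cycles L m \<Longrightarrow> f m a \<in> cycles M m"
  unfolding L.cycles_iff M.cycles_iff
  using F.f_d[of m "em L m a"] by (auto simp: f_mem total_map_em)

text \<open>The union in \<open>homology_map\<close> runs over homologous cycles; their images are
  homologous, so it is a single class.\<close>

lemma homology_map_class: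
  assumes a: "a \<in> cycles L m"
  shows "homology_map M f m (homology_class L m a) = homology_class M m (f m a)"
proof -
  have "homology_class M m (f m x) = homology_class M m (f m a)" if "x \<in> homology_class L m a" for x
  proof -
    have x: "x \<in> cycles L m" "homology_class L m x = homology_class L m a"
      using L.mem_homology_class[OF that a] by auto
    then obtain p where p: "em L m x = em L m a + total_diff L (m + 1) p"
      using L.homology_class_eq_iff[OF x(1) a] by auto
    have "em M m (f m x) = em M m (f m a) + total_diff M (m + 1) (total_map (m + 1) p)"
      using arg_cong[OF p, of "total_map m"] F.f_d[of "m + 1" p] x(1) a
      by (simp add: F.f_add total_map_em L.cycles_carrier)
    then show ?thesis
      using M.homology_class_eq_iff[OF f_cycle[OF x(1)] f_cycle[OF a]] by blast
  qed
  moreover have "homology_class L m a \<noteq> {}"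
    using L.self_mem_homology_class[OF a] by blast
  ultimately show ?thesis
    unfolding homology_map_def by (intro SUP_eq_const)
qed

lemma homology_map_hom: "dgl_hom (homology L) (homology M) (homology_map M f)"
  unfolding dgl_hom_def linear_map_def
proof (intro conjI allI ballI)
  show "homology_map M f m \<in> carrier (piece (homology L) m) \<rightarrow> carrier (piece (homology M) m)" for m
    by (auto simp: L.homology_carrier M.homology_carrier homology_map_class f_cycle)
next
  fix m A B assume "A \<in> carrier (piece (homology L) m)" "B \<in> carrier (piece (homology L) m)"
  then show "homology_map M f m (A \<oplus>\<^bsub>piece (homology L) m\<^esub> B) =
      homology_map M f m A \<oplus>\<^bsub>piece (homology M) m\<^esub> homology_map M f m B"
    by (auto simp: L.homology_carrier L.homology_add M.homology_add homology_map_class f_cycle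
        L.cycles_add L.cycles_carrier linear_mapD(2)[OF f_linear])
next
  fix m c A assume "A \<in> carrier (piece (homology L) m)"
  then show "homology_map M f m (c \<odot>\<^bsub>piece (homology L) m\<^esub> A) = c \<odot>\<^bsub>piece (homology M) m\<^esub> homology_map M f m A"
    by (auto simp: L.homology_carrier L.homology_smult M.homology_smult homology_map_class f_cycle
        L.cycles_smult L.cycles_carrier linear_mapD(3)[OF f_linear])
next
  fix l m A B assume "A \<in> carrier (piece (homology L) l)" "B \<in> carrier (piece (homology L) m)"
  then obtain a b where ab: "a \<in> cycles L l" "b \<in> cycles L m"
    and AB: "A = homology_class L l a" "B = homology_class L m b"
    by (auto simp: L.homology_carrier)
  have "f (l + m) (bracket L l m a b) = bracket M l m (f l a) (f m b)"
    using hom ab L.cycles_carrier by (auto simp: dgl_hom_def)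
  then show "homology_map M f (l + m) (bracket (homology L) l m A B) =
      bracket (homology M) l m (homology_map M f l A) (homology_map M f m B)"
    using ab by (simp add: AB L.homology_bracket M.homology_bracket homology_map_class f_cycle L.cycles_bracket)
next
  fix m A
  \<comment> \<open>Both homology algebras have zero differential, so compatibility amounts to zero
    being sent to zero.\<close>
  have "em M (m - 1) (f (m - 1) \<zero>\<^bsub>piece L (m - 1)\<^esub>) = 0"
    using total_map_em[OF L.zero_mem, of "m - 1"] by (simp add: L.em_zero)
  then have "f (m - 1) \<zero>\<^bsub>piece L (m - 1)\<^esub> = \<zero>\<^bsub>piece M (m - 1)\<^esub>"
    using M.em_eq_iff[OF f_mem[OF L.zero_mem] M.zero_mem, of "m - 1"] by (simp add: M.em_zero)
  then show "homology_map M f (m - 1) (diff (homology L) m A) = diff (homology M) m (homology_map M f m A)"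
    by (simp add: L.homology_diff M.homology_diff L.homology_zero M.homology_zero homology_map_class L.cycles_zero)
qed

end

lemma homology_map_id: "dgl L \<Longrightarrow> A \<in> carrier (piece (homology L) m) \<Longrightarrow> homology_map L (\<lambda>_ a. a) m A = A"
proof -
  assume L: "dgl L" and A: "A \<in> carrier (piece (homology L) m)"
  interpret L: dgl L by fact
  interpret dgl_morphism L L "\<lambda>_ a. a"
    by unfold_locales (simp add: dgl_hom_def linear_map_def)
  show ?thesis using A homology_map_class by (auto simp: L.homology_carrier)
qed

lemma quasi_iso_id: "dgl L \<Longrightarrow> quasi_iso L L (\<lambda>_ a. a)"
  unfolding quasi_iso_def bij_betw_def inj_on_def
  by (auto simp: dgl_hom_def linear_map_def homology_map_id image_iff)

locale dgl_quasi_iso = L: dgl L + M: dgl M for L :: "'a dg_data" and M :: "'b dg_data" +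
  fixes f :: "int \<Rightarrow> 'a \<Rightarrow> 'b"
  assumes quasi_iso: "quasi_iso L M f"
begin

sublocale dgl_morphism L M f
  using quasi_iso by unfold_locales (simp add: quasi_iso_def)

lemma homology_map_bij:
  "bij_betw (homology_map M f m) (carrier (piece (homology L) m)) (carrier (piece (homology M) m))"
  using quasi_iso by (simp add: quasi_iso_def)

text \<open>Injectivity of the map on homology yields the first property of the locale, surjectivity
  the second.\<close>

sublocale Q: total_quasi_iso pscale "total_piece L" "total_bracket L" "total_diff L"
    pscale "total_piece M" "total_bracket M" "total_diff M" total_map
proof
  fix a m c assume a: "a \<in> total_piece L m" "total_diff L m a = 0" "total_map m a = total_diff M (m + 1) c"
  define a0 where "a0 = ev L m a"
  have a0: "em L m a0 = a" "a0 \<in> cycles L m"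
    using a by (simp_all add: a0_def L.total_piece_iff L.cycles_iff L.ev_mem)
  have "homology_map M f m (homology_class L m a0) = homology_map M f m (homology_class L m \<zero>\<^bsub>piece L m\<^esub>)"
    unfolding homology_map_class[OF a0(2)] homology_map_class[OF L.cycles_zero]
      M.homology_class_eq_iff[OF f_cycle[OF a0(2)] f_cycle[OF L.cycles_zero]]
    using a(3) a0 total_map_em[of a0 m] total_map_em[of "\<zero>\<^bsub>piece L m\<^esub>" m]
    by (intro exI[of _ c]) (simp add: L.cycles_carrier L.zero_mem L.em_zero)
  then have "homology_class L m a0 = homology_class L m \<zero>\<^bsub>piece L m\<^esub>"
    using homology_map_bij[of m] a0(2) L.cycles_zero[of m]
    unfolding bij_betw_def inj_on_def L.homology_carrier by blast
  then obtain p where "em L m a0 = em L m \<zero>\<^bsub>piece L m\<^esub> + total_diff L (m + 1) p"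
    using L.homology_class_eq_iff[OF a0(2) L.cycles_zero] by auto
  \<comment> \<open>Evaluating and embedding again moves the primitive into the embedded component
    without changing its differential.\<close>
  then have "a = total_diff L (m + 1) (em L (m + 1) (ev L (m + 1) p))"
    by (simp add: a0 L.em_zero L.total_diff_ev)
  then show "\<exists>e. e \<in> total_piece L (m + 1) \<and> a = total_diff L (m + 1) e"
    using L.em_mem[OF L.ev_mem] by blast
next
  fix c m assume c: "c \<in> total_piece M m" "total_diff M m c = 0"
  define c0 where "c0 = ev M m c"
  have c0: "em M m c0 = c" "c0 \<in> cycles M m"
    using c by (simp_all add: c0_def M.total_piece_iff M.cycles_iff M.ev_mem)
  then have "homology_class M m c0 \<in> homology_map M f m ` carrier (piece (homology L) m)"
    using homology_map_bij[of m] by (simp add: bij_betw_def M.homology_carrier)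
  then obtain a where a: "a \<in> cycles L m" "homology_class M m (f m a) = homology_class M m c0"
    by (auto simp: L.homology_carrier homology_map_class)
  then obtain p where "em M m (f m a) = em M m c0 + total_diff M (m + 1) p"
    using M.homology_class_eq_iff[OF f_cycle[OF a(1)] c0(2)] by auto
  then have "total_map m (em L m a) = c + total_diff M (m + 1) p"
    using a(1) by (simp add: total_map_em L.cycles_carrier c0)
  moreover have "em L m a \<in> total_piece L m" "total_diff L m (em L m a) = 0"
    using a(1) by (auto simp: L.cycles_iff L.em_mem)
  ultimately show "\<exists>a e. a \<in> total_piece L m \<and> total_diff L m a = 0 \<and> total_map m a = c + total_diff M (m + 1) e"
    by blast
qed

text \<open>A solution over the target lifts up to gauge, and the gauge alters the obstruction by a
  boundary. The cycles need to correspond only up to homology.\<close>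

lemma whitehead_set_subset_image:
  assumes k: "2 \<le> k" and z: "\<And>i. i \<in> {1..k} \<Longrightarrow> z i \<in> cycles L (n i - 1)"
    and z': "\<And>i. i \<in> {1..k} \<Longrightarrow> z' i \<in> cycles M (n i - 1)"
    and zz': "\<And>i. i \<in> {1..k} \<Longrightarrow> homology_class M (n i - 1) (f (n i - 1) (z i)) = homology_class M (n i - 1) (z' i)"
  shows "whitehead_set M k n z' \<subseteq> homology_map M f (sum n {1..k} - 2) ` whitehead_set L k n z"
proof
  let ?N = "sum n {1..k} - 2"
  fix A assume "A \<in> whitehead_set M k n z'"
  from M.whitehead_setD[OF this k M.cycles_carrier[OF z']] obtain Z where Z: "M.T.solution n {1..k} Z" and Zz: "\<And>i. i \<in> {1..k} \<Longrightarrow> Z {i} = em M (n i - 1) (z' i)"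
    and A: "A = homology_class M ?N (M.obstruction n k Z)"
    by blast
  \<comment> \<open>With at least two indices every {i} is a proper subset, as the lifting of
    solutions requires.\<close>
  have ns: "{1..k} \<noteq> {i}" for i
  proof
    assume "{1..k} = {i}"
    then have "card {1..k} = card {i}" by simp
    then show False using k by simp
  qed
  have "\<exists>b. total_map (n i - 1) (em L (n i - 1) (z i)) = Z {i} + total_diff M (n i) b" if i: "i \<in> {1..k}" for i
    using M.homology_class_eq_iff[OF f_cycle[OF z[OF i]] z'[OF i]] zz'[OF i] Zz[OF i] z[OF i]
    by (simp add: total_map_em L.cycles_carrier)
  moreover have "em L (n i - 1) (z i) \<in> total_piece L (n i - 1) \<and> total_diff L (n i - 1) (em L (n i - 1) (z i)) = 0"
    if "i \<in> {1..k}" for i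
    using z[OF that] by (simp add: L.cycles_iff L.em_mem)
  ultimately obtain Y c where Y: "L.T.solution n {1..k} Y" "\<And>i. i \<in> {1..k} \<Longrightarrow> Y {i} = em L (n i - 1) (z i)"
    and c: "M.T.curvature n Z {1..k} = total_map ?N (L.T.curvature n Y {1..k}) + total_diff M (?N + 1) c"
    using Q.lift_solution[of "{1..k}" n Z "\<lambda>i. em L (n i - 1) (z i)", OF _ ns Z] by auto
  define a where "a = L.obstruction n k Y"
  note a = L.ev_curvature[OF Y(1), folded a_def]
  note c' = M.ev_curvature[OF Z]
  have "em M ?N (f ?N a) = pscale (1/2) (total_map ?N (L.T.curvature n Y {1..k}))"
    using total_map_em[OF L.cycles_carrier[OF a(2)]] unfolding a(1) F.f_scale by (rule sym)
  then have "em M ?N (M.obstruction n k Z) =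
      em M ?N (f ?N a) + total_diff M (?N + 1) (pscale (1/2) c)"
    unfolding c' by (simp add: c pvs.scale_right_distrib M.T.d_scale del: One_nat_def)
  then have "A = homology_class M ?N (f ?N a)"
    unfolding A using M.homology_class_eq_iff[OF c'(2) f_cycle[OF a(2)]] by blast
  then have "A = homology_map M f ?N (homology_class L ?N a)"
    using homology_map_class[OF a(2)] by simp
  moreover have "homology_class L ?N a \<in> whitehead_set L k n z"
    unfolding a_def using k L.cycles_carrier[OF z] Y by (rule L.whitehead_setI)
  ultimately show "A \<in> homology_map M f ?N ` whitehead_set L k n z" by blast
qed

end

lemma (in dgl) whitehead_set_carrier:
  assumes k: "2 \<le> k" and z: "\<And>i. i \<in> {1..k} \<Longrightarrow> z i \<in> cycles L (n i - 1)"
  shows "whitehead_set L k n z \<subseteq> carrier (piece (homology L) (sum n {1..k} - 2))"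
proof
  fix A assume "A \<in> whitehead_set L k n z"
  from whitehead_setD[OF this k cycles_carrier[OF z]] obtain Y where "T.solution n {1..k} Y"
    "A = homology_class L (sum n {1..k} - 2) (obstruction n k Y)"
    by blast
  then show "A \<in> carrier (piece (homology L) (sum n {1..k} - 2))"
    unfolding homology_carrier using ev_curvature(2) by blast
qed

text \<open>The identity is a quasi-isomorphism, and the lifting result already tolerates homologous
  cycles on its two sides.\<close>

lemma (in dgl) whitehead_set_homologous:
  assumes k: "2 \<le> k" and z: "\<And>i. i \<in> {1..k} \<Longrightarrow> z i \<in> cycles L (n i - 1)"
    and z': "\<And>i. i \<in> {1..k} \<Longrightarrow> z' i \<in> cycles L (n i - 1)"
    and zz': "\<And>i. i \<in> {1..k} \<Longrightarrow> homology_class L (n i - 1) (z i) = homology_class L (n i - 1) (z' i)"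
  shows "whitehead_set L k n z' \<subseteq> whitehead_set L k n z"
proof -
  interpret dgl_quasi_iso L L "\<lambda>_ a. a"
    by unfold_locales (rule quasi_iso_id[OF dgl_axioms])
  let ?N = "sum n {1..k} - 2"
  have "homology_map L (\<lambda>_ a. a) ?N A = A" if "A \<in> whitehead_set L k n z" for A
    using that whitehead_set_carrier[where k = k and n = n and z = z, OF k z] by (intro homology_map_id dgl_axioms) blast
  then show ?thesis
    using whitehead_set_subset_image[OF k z z' zz'] by force
qed

lemma (in dgl_quasi_iso) whitehead_set_image:
  assumes k: "2 \<le> k" and z: "\<And>i. i \<in> {1..k} \<Longrightarrow> z i \<in> cycles L (n i - 1)"
    and z': "\<And>i. i \<in> {1..k} \<Longrightarrow> z' i \<in> cycles M (n i - 1)"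
    and zz': "\<And>i. i \<in> {1..k} \<Longrightarrow> homology_class M (n i - 1) (f (n i - 1) (z i)) = homology_class M (n i - 1) (z' i)"
  shows "homology_map M f (sum n {1..k} - 2) ` whitehead_set L k n z = whitehead_set M k n z'"
proof
  let ?N = "sum n {1..k} - 2"
  show "whitehead_set M k n z' \<subseteq> homology_map M f ?N ` whitehead_set L k n z"
    using assms by (rule whitehead_set_subset_image)
  have "homology_map M f ?N ` whitehead_set L k n z \<subseteq> whitehead_set M k n (\<lambda>i. f (n i - 1) (z i))"
  proof
    fix B assume "B \<in> homology_map M f ?N ` whitehead_set L k n z"
    then obtain A where "A \<in> whitehead_set L k n z" and BA: "B = homology_map M f ?N A" by blast
    from L.whitehead_setD[OF this(1) k L.cycles_carrier[OF z]] obtain Y where Y: "L.T.solution n {1..k} Y" "\<And>i. i \<in> {1..k} \<Longrightarrow> Y {i} = em L (n i - 1) (z i)"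
      and A: "A = homology_class L ?N (L.obstruction n k Y)"
      by blast
    \<comment> \<open>Images of solutions under a morphism are solutions, with no correction
      needed.\<close>
    let ?Y = "\<lambda>J. total_map (sum n J - 1) (Y J)"
    note a = L.ev_curvature[OF Y(1)]
    have "em M ?N (f ?N (L.obstruction n k Y)) = pscale (1/2) (M.T.curvature n ?Y {1..k})"
      using total_map_em[OF L.cycles_carrier[OF a(2)]]
      unfolding a(1) F.f_scale F.f_curvature[OF finite_atLeastAtMost] by (rule sym)
    then have "f ?N (L.obstruction n k Y) =
        M.obstruction n k ?Y"
      using M.ev_em[OF f_mem[OF L.cycles_carrier[OF a(2)]]] by simp
    then have B: "B = homology_class M ?N (M.obstruction n k ?Y)"
      unfolding BA A by (simp add: homology_map_class[OF a(2)] del: One_nat_def)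
    have sol: "M.T.solution n {1..k} ?Y"
      unfolding M.T.solution_def
    proof (intro allI impI conjI)
      fix J assume J: "J \<subset> {1..k}" "J \<noteq> {}"
      then have "finite J" using finite_subset by blast
      show "?Y J \<in> total_piece M (sum n J - 1)" by (rule F.f_mem)
      have "total_diff M (sum n J - 1) (?Y J) = total_map (sum n J - 2) (total_diff L (sum n J - 1) (Y J))"
        using F.f_d[of "sum n J - 1" "Y J"] by simp
      also have "total_diff L (sum n J - 1) (Y J) = pscale (1/2) (L.T.curvature n Y J)"
        using Y(1) J by (simp add: L.T.solution_def L.T.mc_at_def)
      finally show "M.T.mc_at n ?Y J"
        using F.f_curvature[OF \<open>finite J\<close>, of n Y] by (simp add: M.T.mc_at_def F.f_scale)
    qed
    have gen: "?Y {i} = em M (n i - 1) (f (n i - 1) (z i))" if "i \<in> {1..k}" for i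
      using Y(2)[OF that] total_map_em[OF L.cycles_carrier[OF z[OF that]]] by simp
    from k f_mem[OF L.cycles_carrier[OF z]] sol gen show "B \<in> whitehead_set M k n (\<lambda>i. f (n i - 1) (z i))"
      unfolding B by (rule M.whitehead_setI)
  qed
  \<comment> \<open>The image solution starts at the cycles f (z i), which are homologous to z' i
    but may differ from them.\<close>
  also have "\<dots> \<subseteq> whitehead_set M k n z'"
    using zz' by (intro M.whitehead_set_homologous[OF k z' f_cycle[OF z]]) auto
  finally show "homology_map M f ?N ` whitehead_set L k n z \<subseteq> whitehead_set M k n z'" .
qed

section \<open>Zig-zags\<close>

text \<open>The closure properties that allow a bijective morphism to be inverted. For the homology
  of L they follow directly from those of cycles.\<close>

definition dg_closed :: "'a dg_data \<Rightarrow> bool" where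
  "dg_closed A \<longleftrightarrow>
    (\<forall>m. \<forall>a\<in>carrier (piece A m). \<forall>b\<in>carrier (piece A m). a \<oplus>\<^bsub>piece A m\<^esub> b \<in> carrier (piece A m)) \<and>
    (\<forall>m c. \<forall>a\<in>carrier (piece A m). c \<odot>\<^bsub>piece A m\<^esub> a \<in> carrier (piece A m)) \<and>
    (\<forall>l m. \<forall>a\<in>carrier (piece A l). \<forall>b\<in>carrier (piece A m). bracket A l m a b \<in> carrier (piece A (l + m))) \<and>
    (\<forall>m. \<forall>a\<in>carrier (piece A m). diff A m a \<in> carrier (piece A (m - 1)))"

lemma (in dgl) dg_closed: "dg_closed L"
  by (simp add: dg_closed_def add_mem smult_mem bracket_mem diff_mem)

lemma (in dgl) dg_closed_homology: "dg_closed (homology L)"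
  by (auto simp: dg_closed_def homology_carrier homology_add homology_smult homology_bracket
      homology_diff homology_zero cycles_add cycles_smult cycles_bracket cycles_zero)

lemma dgl_hom_comp:
  assumes "dgl_hom A B f" and "dgl_hom B C g"
  shows "dgl_hom A C (\<lambda>m a. g m (f m a))"
  using assms by (auto simp: dgl_hom_def linear_map_def Pi_iff)

definition hom_inv :: "'a dg_data \<Rightarrow> (int \<Rightarrow> 'a \<Rightarrow> 'b) \<Rightarrow> int \<Rightarrow> 'b \<Rightarrow> 'a" where
  "hom_inv A f m = inv_into (carrier (piece A m)) (f m)"

lemma dgl_hom_inv:
  assumes A: "dg_closed A" and f: "dgl_hom A B f"
    and bij: "\<And>m. bij_betw (f m) (carrier (piece A m)) (carrier (piece B m))"
  shows "dgl_hom B A (hom_inv A f)"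
    and "bij_betw (hom_inv A f m) (carrier (piece B m)) (carrier (piece A m))"
    and "a \<in> carrier (piece A m) \<Longrightarrow> hom_inv A f m (f m a) = a"
    and "b \<in> carrier (piece B m) \<Longrightarrow> f m (hom_inv A f m b) = b"
proof -
  show 1: "bij_betw (hom_inv A f m) (carrier (piece B m)) (carrier (piece A m))" for m
    unfolding hom_inv_def by (rule bij_betw_inv_into[OF bij])
  show 2: "hom_inv A f m (f m a) = a" if "a \<in> carrier (piece A m)" for a m
    unfolding hom_inv_def using bij that by (rule bij_betw_inv_into_left)
  show 3: "f m (hom_inv A f m b) = b" if "b \<in> carrier (piece B m)" for b m
    unfolding hom_inv_def using bij that by (rule bij_betw_inv_into_right)
  have surj: "\<exists>a\<in>carrier (piece A m). b = f m a" if "b \<in> carrier (piece B m)" for b m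
    using bij[of m] that by (auto simp: bij_betw_def)
  show "dgl_hom B A (hom_inv A f)"
    unfolding dgl_hom_def linear_map_def
  proof (intro conjI allI ballI)
    show "hom_inv A f m \<in> carrier (piece B m) \<rightarrow> carrier (piece A m)" for m
      using 1[of m] by (auto simp: bij_betw_def)
  next
    fix m b b' assume "b \<in> carrier (piece B m)" "b' \<in> carrier (piece B m)"
    then obtain a a' where a: "a \<in> carrier (piece A m)" "a' \<in> carrier (piece A m)" "b = f m a" "b' = f m a'"
      using surj by metis
    then have "b \<oplus>\<^bsub>piece B m\<^esub> b' = f m (a \<oplus>\<^bsub>piece A m\<^esub> a')"
      using f by (simp add: dgl_hom_def linear_map_def)
    then show "hom_inv A f m (b \<oplus>\<^bsub>piece B m\<^esub> b') = hom_inv A f m b \<oplus>\<^bsub>piece A m\<^esub> hom_inv A f m b'"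
      using a A by (simp add: 2 dg_closed_def)
  next
    fix m c b assume "b \<in> carrier (piece B m)"
    then obtain a where a: "a \<in> carrier (piece A m)" "b = f m a"
      using surj by metis
    then have "c \<odot>\<^bsub>piece B m\<^esub> b = f m (c \<odot>\<^bsub>piece A m\<^esub> a)"
      using f by (simp add: dgl_hom_def linear_map_def)
    then show "hom_inv A f m (c \<odot>\<^bsub>piece B m\<^esub> b) = c \<odot>\<^bsub>piece A m\<^esub> hom_inv A f m b"
      using a A by (simp add: 2 dg_closed_def)
  next
    fix l m b b' assume "b \<in> carrier (piece B l)" "b' \<in> carrier (piece B m)"
    then obtain a a' where a: "a \<in> carrier (piece A l)" "a' \<in> carrier (piece A m)" "b = f l a" "b' = f m a'"
      using surj by metis
    then have "bracket B l m b b' = f (l + m) (bracket A l m a a')"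
      using f by (simp add: dgl_hom_def)
    then show "hom_inv A f (l + m) (bracket B l m b b') = bracket A l m (hom_inv A f l b) (hom_inv A f m b')"
      using a A by (simp add: 2 dg_closed_def)
  next
    fix m b assume "b \<in> carrier (piece B m)"
    then obtain a where a: "a \<in> carrier (piece A m)" "b = f m a"
      using surj by metis
    then have "diff B m b = f (m - 1) (diff A m a)"
      using f by (simp add: dgl_hom_def)
    then show "hom_inv A f (m - 1) (diff B m b) = diff A m (hom_inv A f m b)"
      using a A by (simp add: 2 dg_closed_def)
  qed
qed

text \<open>Quantifying over all representatives of corresponding classes makes the property
  composable and invertible without any choice of cycles.\<close>

definition transports_whitehead ::
    "nat \<Rightarrow> (nat \<Rightarrow> int) \<Rightarrow> 'a dg_data \<Rightarrow> 'b dg_data \<Rightarrow> (int \<Rightarrow> 'a set \<Rightarrow> 'b set) \<Rightarrow> bool" where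
  "transports_whitehead k n L M \<theta> \<longleftrightarrow>
    (\<forall>z z'. (\<forall>i\<in>{1..k}. z i \<in> cycles L (n i - 1) \<and> z' i \<in> cycles M (n i - 1) \<and>
        \<theta> (n i - 1) (homology_class L (n i - 1) (z i)) = homology_class M (n i - 1) (z' i)) \<longrightarrow>
      \<theta> (sum n {1..k} - 2) ` whitehead_set L k n z = whitehead_set M k n z')"

lemma transports_whiteheadD:
  assumes "transports_whitehead k n L M \<theta>"
    and "\<And>i. i \<in> {1..k} \<Longrightarrow> z i \<in> cycles L (n i - 1)" and "\<And>i. i \<in> {1..k} \<Longrightarrow> z' i \<in> cycles M (n i - 1)"
    and "\<And>i. i \<in> {1..k} \<Longrightarrow> \<theta> (n i - 1) (homology_class L (n i - 1) (z i)) = homology_class M (n i - 1) (z' i)"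
  shows "\<theta> (sum n {1..k} - 2) ` whitehead_set L k n z = whitehead_set M k n z'"
  using assms unfolding transports_whitehead_def by blast

text \<open>The trace of a zig-zag on homology: a relation between end points that contains the
  quasi-isomorphisms and, unlike them, can be inverted.\<close>

definition homology_equiv :: "nat \<Rightarrow> (nat \<Rightarrow> int) \<Rightarrow> 'a dg_data \<Rightarrow> 'b dg_data \<Rightarrow> bool" where
  "homology_equiv k n L M \<longleftrightarrow> dgl L \<and> dgl M \<and>
    (\<exists>\<theta>. dgl_hom (homology L) (homology M) \<theta> \<and>
      (\<forall>m. bij_betw (\<theta> m) (carrier (piece (homology L) m)) (carrier (piece (homology M) m))) \<and>
      transports_whitehead k n L M \<theta>)"

lemma homology_equiv_quasi_iso:
  assumes "dgl L" and "dgl M" and "quasi_iso L M f" and k: "2 \<le> k"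
  shows "homology_equiv k n L M"
proof -
  interpret dgl_quasi_iso L M f
    using assms by (simp add: dgl_quasi_iso_def dgl_quasi_iso_axioms_def)
  show ?thesis
    unfolding homology_equiv_def transports_whitehead_def
  proof (intro conjI exI[of _ "homology_map M f"] allI impI)
    fix z z'
    assume *: "\<forall>i\<in>{1..k}. z i \<in> cycles L (n i - 1) \<and> z' i \<in> cycles M (n i - 1) \<and>
      homology_map M f (n i - 1) (homology_class L (n i - 1) (z i)) = homology_class M (n i - 1) (z' i)"
    show "homology_map M f (sum n {1..k} - 2) ` whitehead_set L k n z = whitehead_set M k n z'"
    proof (rule whitehead_set_image[OF k])
      show "z i \<in> cycles L (n i - 1)" "z' i \<in> cycles M (n i - 1)" if "i \<in> {1..k}" for i
        using * that by blast+
      show "homology_class M (n i - 1) (f (n i - 1) (z i)) = homology_class M (n i - 1) (z' i)"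
        if "i \<in> {1..k}" for i
        using * that homology_map_class[of "z i" "n i - 1"] by force
    qed
  qed (rule assms homology_map_hom homology_map_bij)+
qed

text \<open>A quasi-isomorphism may have no inverse on chains, but its map on homology does. Bracket
  sets lie in the carrier of homology, so applying the inverse recovers them from their
  images.\<close>

lemma homology_equiv_sym:
  assumes LM: "homology_equiv k n L M" and k: "2 \<le> k"
  shows "homology_equiv k n M L"
proof -
  obtain \<theta> where \<theta>: "dgl L" "dgl M" "dgl_hom (homology L) (homology M) \<theta>"
    and bij: "\<And>m. bij_betw (\<theta> m) (carrier (piece (homology L) m)) (carrier (piece (homology M) m))"
    and W: "transports_whitehead k n L M \<theta>"
    using LM unfolding homology_equiv_def by blast
  interpret L: dgl L by fact
  interpret M: dgl M by fact
  note inv = dgl_hom_inv[OF L.dg_closed_homology \<theta>(3) bij]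
  show ?thesis
    unfolding homology_equiv_def transports_whitehead_def
  proof (intro conjI exI[of _ "hom_inv (homology L) \<theta>"] allI impI)
    fix z' z
    assume *: "\<forall>i\<in>{1..k}. z' i \<in> cycles M (n i - 1) \<and> z i \<in> cycles L (n i - 1) \<and>
      hom_inv (homology L) \<theta> (n i - 1) (homology_class M (n i - 1) (z' i)) = homology_class L (n i - 1) (z i)"
    have "\<theta> (sum n {1..k} - 2) ` whitehead_set L k n z = whitehead_set M k n z'"
    proof (rule transports_whiteheadD[OF W])
      fix i assume "i \<in> {1..k}"
      then have i: "z' i \<in> cycles M (n i - 1)" "z i \<in> cycles L (n i - 1)"
        "hom_inv (homology L) \<theta> (n i - 1) (homology_class M (n i - 1) (z' i)) = homology_class L (n i - 1) (z i)"
        using * by auto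
      then show "z i \<in> cycles L (n i - 1)" "z' i \<in> cycles M (n i - 1)" by auto
      show "\<theta> (n i - 1) (homology_class L (n i - 1) (z i)) = homology_class M (n i - 1) (z' i)"
        using i inv(4)[of "homology_class M (n i - 1) (z' i)" "n i - 1"] by (simp add: M.homology_carrier)
    qed
    moreover have "whitehead_set L k n z \<subseteq> carrier (piece (homology L) (sum n {1..k} - 2))"
      using * by (intro L.whitehead_set_carrier k) blast
    ultimately show "hom_inv (homology L) \<theta> (sum n {1..k} - 2) ` whitehead_set M k n z' = whitehead_set L k n z"
    proof -
      assume W: "\<theta> (sum n {1..k} - 2) ` whitehead_set L k n z = whitehead_set M k n z'"
        and sub: "whitehead_set L k n z \<subseteq> carrier (piece (homology L) (sum n {1..k} - 2))"
      have "hom_inv (homology L) \<theta> (sum n {1..k} - 2) ` \<theta> (sum n {1..k} - 2) ` whitehead_set L k n z =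
          (\<lambda>A. A) ` whitehead_set L k n z"
        unfolding image_image using sub by (intro image_cong refl inv(3)) blast
      then show ?thesis unfolding W by simp
    qed
  qed (rule \<theta>(1,2) inv(1,2))+
qed

lemma homology_equiv_trans:
  assumes LM: "homology_equiv k n L M" and MN: "homology_equiv k n M N"
  shows "homology_equiv k n L N"
proof -
  obtain \<theta> where \<theta>: "dgl L" "dgl M" "dgl_hom (homology L) (homology M) \<theta>"
    and bij: "\<And>m. bij_betw (\<theta> m) (carrier (piece (homology L) m)) (carrier (piece (homology M) m))"
    and W: "transports_whitehead k n L M \<theta>"
    using LM unfolding homology_equiv_def by blast
  obtain \<eta> where \<eta>: "dgl N" "dgl_hom (homology M) (homology N) \<eta>"
    and bij': "\<And>m. bij_betw (\<eta> m) (carrier (piece (homology M) m)) (carrier (piece (homology N) m))"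
    and W': "transports_whitehead k n M N \<eta>"
    using MN unfolding homology_equiv_def by blast
  interpret L: dgl L by fact
  interpret M: dgl M by fact
  show ?thesis
    unfolding homology_equiv_def transports_whitehead_def
  proof (intro conjI exI[of _ "\<lambda>m A. \<eta> m (\<theta> m A)"] allI impI)
    show "bij_betw (\<lambda>A. \<eta> m (\<theta> m A)) (carrier (piece (homology L) m)) (carrier (piece (homology N) m))" for m
      using bij_betw_trans[OF bij bij'] by (simp add: comp_def)
  next
    fix z z'
    assume *: "\<forall>i\<in>{1..k}. z i \<in> cycles L (n i - 1) \<and> z' i \<in> cycles N (n i - 1) \<and>
      \<eta> (n i - 1) (\<theta> (n i - 1) (homology_class L (n i - 1) (z i))) = homology_class N (n i - 1) (z' i)"
    \<comment> \<open>Cycles in the middle algebra are chosen in the intermediate classes to link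
      the two transports.\<close>
    have "\<exists>y. y \<in> cycles M (n i - 1) \<and> \<theta> (n i - 1) (homology_class L (n i - 1) (z i)) = homology_class M (n i - 1) y"
      if "i \<in> {1..k}" for i
    proof -
      have "homology_class L (n i - 1) (z i) \<in> carrier (piece (homology L) (n i - 1))"
        using * that by (simp add: L.homology_carrier)
      then have "\<theta> (n i - 1) (homology_class L (n i - 1) (z i)) \<in> carrier (piece (homology M) (n i - 1))"
        using bij by (rule bij_betw_apply[rotated])
      then show ?thesis by (auto simp: M.homology_carrier)
    qed
    then obtain y where y: "\<And>i. i \<in> {1..k} \<Longrightarrow> y i \<in> cycles M (n i - 1) \<and>
        \<theta> (n i - 1) (homology_class L (n i - 1) (z i)) = homology_class M (n i - 1) (y i)"
      by metis
    have "\<theta> (sum n {1..k} - 2) ` whitehead_set L k n z = whitehead_set M k n y"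
      using * y by (intro transports_whiteheadD[OF W]) blast+
    moreover have "\<eta> (sum n {1..k} - 2) ` whitehead_set M k n y = whitehead_set N k n z'"
    proof (rule transports_whiteheadD[OF W'])
      fix i assume i: "i \<in> {1..k}"
      show "y i \<in> cycles M (n i - 1)" "z' i \<in> cycles N (n i - 1)" using y[OF i] * i by auto
      show "\<eta> (n i - 1) (homology_class M (n i - 1) (y i)) = homology_class N (n i - 1) (z' i)"
        using bspec[OF * i] y[OF i] by simp
    qed
    ultimately show "(\<lambda>A. \<eta> (sum n {1..k} - 2) (\<theta> (sum n {1..k} - 2) A)) ` whitehead_set L k n z = whitehead_set N k n z'"
      by (simp add: image_image[symmetric])
  qed (rule \<theta>(1) \<eta>(1) dgl_hom_comp[OF \<theta>(3) \<eta>(2)])+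
qed

lemma homology_equiv_step:
  assumes "quasi_iso_step L M \<or> quasi_iso_step M L" and k: "2 \<le> k"
  shows "homology_equiv k n L M"
  using assms homology_equiv_quasi_iso homology_equiv_sym[OF _ k] unfolding quasi_iso_step_def by metis

lemma homology_equiv_equivclp:
  assumes "equivclp quasi_iso_step M M'" and "dgl M" and k: "2 \<le> k"
  shows "homology_equiv k n M M'"
  using assms(1)
proof (induction rule: equivclp_induct)
  case base
  show ?case using homology_equiv_quasi_iso[OF \<open>dgl M\<close> \<open>dgl M\<close> quasi_iso_id[OF \<open>dgl M\<close>] k] .
next
  case (step N N')
  then show ?case using homology_equiv_trans homology_equiv_step[OF _ k] by metis
qed

lemma homology_equiv_formal:
  assumes "formal TYPE('m) L" and k: "2 \<le> k"
  shows "homology_equiv k n L (homology L)"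
proof -
  obtain M M' :: "'m dg_data" where M: "quasi_iso_step L M \<or> quasi_iso_step M L"
    "equivclp quasi_iso_step M M'" "quasi_iso_step M' (homology L) \<or> quasi_iso_step (homology L) M'"
    using assms by (auto simp: formal_def)
  have "homology_equiv k n L M" using M(1) k by (rule homology_equiv_step)
  moreover have "homology_equiv k n M M'"
    using M(1) by (intro homology_equiv_equivclp[OF M(2) _ k]) (auto simp: quasi_iso_step_def)
  moreover have "homology_equiv k n M' (homology L)" using M(3) k by (rule homology_equiv_step)
  ultimately show ?thesis using homology_equiv_trans by metis
qed

section \<open>Graded Lie algebras with zero differential\<close>

locale zero_diff_dgl = dgl H for H :: "'a dg_data" +
  assumes diff_zero: "a \<in> carrier (piece H m) \<Longrightarrow> diff H m a = \<zero>\<^bsub>piece H (m - 1)\<^esub>"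
begin

lemma total_diff_zero: "total_diff H m p = 0"
  by (simp add: total_diff_def diff_zero ev_mem em_zero)

lemma cycles_eq: "cycles H m = carrier (piece H m)"
  by (auto simp: cycles_def diff_zero)

lemma homology_class_hom: "dgl_hom H (homology H) (homology_class H)"
  by (auto simp: dgl_hom_def linear_map_def homology_carrier cycles_eq homology_add homology_smult
      homology_bracket homology_diff homology_zero diff_zero)

text \<open>With zero differential the only boundary is zero. This identifies H with its own
  homology.\<close>

lemma homology_class_bij:
  "bij_betw (homology_class H m) (carrier (piece H m)) (carrier (piece (homology H) m))"
proof -
  have "inj_on (homology_class H m) (carrier (piece H m))"
    by (intro inj_onI) (simp add: homology_class_eq_iff cycles_eq total_diff_zero em_eq_iff)
  then show ?thesis by (simp add: bij_betw_def homology_carrier cycles_eq)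
qed

lemma zero_mem_whitehead_set:
  assumes k: "3 \<le> k" and \<xi>: "\<And>i. i \<in> {1..k} \<Longrightarrow> \<xi> i \<in> carrier (piece H (n i - 1))"
    and ne: "whitehead_set H k n \<xi> \<noteq> {}"
  shows "\<zero>\<^bsub>piece (homology H) (sum n {1..k} - 2)\<^esub> \<in> whitehead_set H k n \<xi>"
proof -
  have k2: "2 \<le> k" using k by simp
  obtain A where "A \<in> whitehead_set H k n \<xi>" using ne by blast
  from whitehead_setD[OF this k2 \<xi>] obtain Y where Y: "T.solution n {1..k} Y"
    and Y\<xi>: "\<And>i. i \<in> {1..k} \<Longrightarrow> Y {i} = em H (n i - 1) (\<xi> i)"
    by blast
  \<comment> \<open>Only the components on singletons are kept, since they are prescribed by
    \<xi>.\<close>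
  define Y' where "Y' J = (if card J = 1 then Y J else 0)" for J :: "nat set"
  have curv: "T.curvature n Y' J = 0" if J: "J \<subseteq> {1..k}" for J
  proof (cases "card J = 2")
    case True
    \<comment> \<open>This is where k \<ge> 3 enters: a set of two indices is then proper, so Y
      solves the equation there, and zero differential forces its curvature to vanish.\<close>
    have "J \<subset> {1..k}" "J \<noteq> {}" "finite J"
      using J True k finite_subset[OF J] by auto
    then have "pscale (1/2) (T.curvature n Y J) = 0"
      using Y by (simp add: T.solution_def T.mc_at_def total_diff_zero)
    then have "T.curvature n Y J = 0" by simp
    moreover have "T.curvature n Y' J = T.curvature n Y J"
    proof (rule T.curvature_cong)
      fix K assume K: "K \<subset> J" "K \<noteq> {}"
      then have "card K < 2" "card K \<noteq> 0"
        using psubset_card_mono[OF \<open>finite J\<close> K(1)] finite_subset[of K J] \<open>finite J\<close> True by auto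
      then show "Y' K = Y K" by (simp add: Y'_def)
    qed
    ultimately show ?thesis by simp
  next
    case False
    have "T.pairing n Y' Y' A B = 0" if AB: "(A, B) \<in> splits J" for A B
    proof -
      \<comment> \<open>If J does not have two elements, one of the parts is no singleton, and Y' is
        zero on it. The full set {1..k} is covered too, which makes the obstruction zero.\<close>
      have "card J = card A + card B"
        using AB finite_subset[OF J] by (auto simp: splits_def card_Un_disjoint)
      then have "card A \<noteq> 1 \<or> card B \<noteq> 1" using False by auto
      then show ?thesis by (auto simp: T.pairing_def Y'_def)
    qed
    then show ?thesis by (simp add: T.curvature_def case_prod_unfold sum.neutral)
  qed
  have "T.solution n {1..k} Y'"
    unfolding T.solution_def
  proof (intro allI impI conjI)
    fix J assume J: "J \<subset> {1..k}" "J \<noteq> {}"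
    then show "Y' J \<in> total_piece H (sum n J - 1)"
      using Y T.subspace_0[OF T.V_subspace] by (simp add: T.solution_def Y'_def)
    show "T.mc_at n Y' J"
      using J by (simp add: T.mc_at_def total_diff_zero curv psubset_imp_subset)
  qed
  moreover have "Y' {i} = em H (n i - 1) (\<xi> i)" if "i \<in> {1..k}" for i
    using Y\<xi>[OF that] by (simp add: Y'_def)
  ultimately have "homology_class H (sum n {1..k} - 2) (obstruction n k Y') \<in> whitehead_set H k n \<xi>"
    using k2 \<xi> by (intro whitehead_setI)
  then show ?thesis by (simp add: curv ev_zero homology_zero del: One_nat_def)
qed

text \<open>An endomorphism of H can be composed with the morphisms that define the bracket set, so
  solutions need not be considered.\<close>

lemma whitehead_set_automorphism:
  assumes \<alpha>: "dgl_hom H H \<alpha>" and \<alpha>\<xi>: "\<And>i. i \<in> {1..k} \<Longrightarrow> \<alpha> (n i - 1) (\<xi> i) = \<xi>' i"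
    and w: "wh_cycle k n \<in> carrier (piece (wh_algebra k n) (sum n {1..k} - 2))"
    and B: "B \<in> whitehead_set H k n \<xi>"
  shows "\<exists>v\<in>carrier (piece H (sum n {1..k} - 2)). B = homology_class H (sum n {1..k} - 2) v \<and>
    homology_class H (sum n {1..k} - 2) (\<alpha> (sum n {1..k} - 2) v) \<in> whitehead_set H k n \<xi>'"
proof -
  obtain \<phi> where \<phi>: "dgl_hom (wh_algebra k n) H \<phi>"
    and \<phi>\<xi>: "\<And>i. i \<in> {1..k} \<Longrightarrow> \<phi> (n i - 1) (wh_generator k n [i]) = \<xi> i"
    and B': "B = homology_class H (sum n {1..k} - 2) (\<phi> (sum n {1..k} - 2) (wh_cycle k n))"
    using B by (auto simp: whitehead_set_def)
  have "homology_class H (sum n {1..k} - 2) (\<alpha> (sum n {1..k} - 2) (\<phi> (sum n {1..k} - 2) (wh_cycle k n)))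
      \<in> whitehead_set H k n \<xi>'"
    unfolding whitehead_set_def using dgl_hom_comp[OF \<phi> \<alpha>] \<phi>\<xi> \<alpha>\<xi>
    by (auto intro!: exI[of _ "\<lambda>m a. \<alpha> m (\<phi> m a)"])
  moreover have "\<phi> (sum n {1..k} - 2) (wh_cycle k n) \<in> carrier (piece H (sum n {1..k} - 2))"
    using \<phi> w by (auto simp: dgl_hom_def linear_map_def)
  ultimately show ?thesis using B' by blast
qed

end

text \<open>Ensures that morphisms can be applied to w and yield elements of the target.\<close>

lemma wh_cycle_mem:
  "wh_cycle k n \<in> carrier (piece (wh_algebra k n) (sum n {1..k} - 2))"
proof -
  have \<delta>: "wh_diff n I \<in> comb_piece (wh_index k) (wh_deg n) (wh_deg n I - 1)" if "I \<in> wh_index k" for I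
    using wh_diff_mem[of I k n] wh_indexD[OF that] wh_deg_eq[of I n] by auto
  interpret W: dg_ideal "word_algebra (wh_index k) (wh_deg n) (wh_diff n)" "lie_ideal (wh_index k) (wh_deg n)"
    using \<delta> by (rule lie_dg_ideal)
  have "wh_diff n [1..<Suc k] \<in> comb_piece (wh_index k) (wh_deg n) (sum n {1..k} - 2)"
    using wh_diff_mem[of "[1..<Suc k]" k n] by (simp add: atLeastLessThanSuc_atLeastAtMost del: upt_Suc)
  then show ?thesis
    using W.quot_carrier[of "sum n {1..k} - 2"]
    by (auto simp: wh_cycle_def wh_algebra_def free_dgl_def free_class_def W.cls_def word_algebra_simps)
qed

theorem theorem1:
  fixes L :: "'a dg_data" and k :: nat and n :: "nat \<Rightarrow> int"
    and x :: "nat \<Rightarrow> 'a set" and z :: "nat \<Rightarrow> 'a"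
  assumes "dgl L"
    and "k \<ge> 2"
    and "\<And>i. i \<in> {1..k} \<Longrightarrow> x i \<in> carrier (piece (homology L) (n i - 1))"
    and "\<And>i. i \<in> {1..k} \<Longrightarrow> z i \<in> x i"
    and "whitehead_set L k n z \<noteq> {}"
    and "k \<ge> 3 \<and> \<zero>\<^bsub>piece (homology L) ((\<Sum>i = 1..k. n i) - 2)\<^esub> \<notin> whitehead_set L k n z \<or>
         \<not> (\<exists>f. bij_betw f (whitehead_set L k n z) (whitehead_set (homology L) k n x))"
  shows "\<not> formal TYPE('m) L"
proof
  assume "formal TYPE('m) L"
  define H where "H = homology L"
  define N where "N = sum n {1..k} - 2"
  have "homology_equiv k n L H"
    unfolding H_def using \<open>formal TYPE('m) L\<close> assms(2) by (rule homology_equiv_formal)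
  then obtain \<theta> where "dgl H" and \<theta>: "dgl_hom H (homology H) \<theta>"
    and \<theta>_bij: "\<And>m. bij_betw (\<theta> m) (carrier (piece H m)) (carrier (piece (homology H) m))"
    and W: "transports_whitehead k n L H \<theta>"
    unfolding homology_equiv_def H_def[symmetric] by blast
  interpret L: dgl L by fact
  interpret H: dgl H by fact
  interpret H: zero_diff_dgl H
    by unfold_locales (simp add: H_def L.homology_diff)
  have z: "z i \<in> cycles L (n i - 1)" and zx: "homology_class L (n i - 1) (z i) = x i" if i: "i \<in> {1..k}" for i
  proof -
    obtain a where "a \<in> cycles L (n i - 1)" "x i = homology_class L (n i - 1) a"
      using assms(3)[OF i] by (auto simp: L.homology_carrier)
    then show "z i \<in> cycles L (n i - 1)" "homology_class L (n i - 1) (z i) = x i"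
      using L.mem_homology_class[of "z i" "n i - 1" a] assms(4)[OF i] by auto
  qed
  have x: "x i \<in> carrier (piece H (n i - 1))" if "i \<in> {1..k}" for i
    using assms(3)[OF that] by (simp add: H_def)
  \<comment> \<open>The canonical identification of H with its homology. Composing its inverse with
    \<theta> gives an automorphism \<alpha> of H.\<close>
  let ?j = "homology_class H"
  note j_inv = dgl_hom_inv[OF H.dg_closed H.homology_class_hom H.homology_class_bij]
  define \<alpha> where "\<alpha> m A = hom_inv H ?j m (\<theta> m A)" for m A
  have \<alpha>: "dgl_hom H H \<alpha>"
    unfolding \<alpha>_def[abs_def] using \<theta> j_inv(1) by (rule dgl_hom_comp)
  have \<alpha>_bij: "bij_betw (\<alpha> m) (carrier (piece H m)) (carrier (piece H m))" for m
    using bij_betw_trans[OF \<theta>_bij j_inv(2)] by (simp add: \<alpha>_def[abs_def] comp_def)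
  note \<alpha>_inv = dgl_hom_inv[OF H.dg_closed \<alpha> \<alpha>_bij]
  define \<xi> where "\<xi> i = \<alpha> (n i - 1) (x i)" for i
  have \<xi>: "\<xi> i \<in> carrier (piece H (n i - 1))" if "i \<in> {1..k}" for i
    unfolding \<xi>_def using \<alpha>_bij x[OF that] by (rule bij_betw_apply)
  have image: "\<theta> N ` whitehead_set L k n z = whitehead_set H k n \<xi>"
    unfolding N_def
  proof (rule transports_whiteheadD[OF W])
    fix i assume i: "i \<in> {1..k}"
    show "z i \<in> cycles L (n i - 1)" using i by (rule z)
    show "\<xi> i \<in> cycles H (n i - 1)" using \<xi>[OF i] by (simp add: H.cycles_eq)
    have "\<theta> (n i - 1) (x i) \<in> carrier (piece (homology H) (n i - 1))"
      using \<theta>_bij x[OF i] by (rule bij_betw_apply)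
    then show "\<theta> (n i - 1) (homology_class L (n i - 1) (z i)) = ?j (n i - 1) (\<xi> i)"
      by (simp add: zx[OF i] \<xi>_def \<alpha>_def j_inv(4))
  qed
  have W_carrier: "whitehead_set L k n z \<subseteq> carrier (piece H N)"
    unfolding H_def N_def using assms(2) z by (rule L.whitehead_set_carrier)
  have \<theta>_inj: "inj_on (\<theta> N) (carrier (piece H N))"
    using \<theta>_bij by (auto simp: bij_betw_def)
  have "bij_betw (\<theta> N) (whitehead_set L k n z) (whitehead_set H k n \<xi>)"
    unfolding bij_betw_def using image inj_on_subset[OF \<theta>_inj W_carrier] by simp
  \<comment> \<open>The automorphism \<alpha> need not be the identity, so the bracket set of \<xi>
    has to be related to that of x; \<alpha> does so after conjugation with
    \<open>?j\<close>.\<close>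
  moreover have "\<exists>h. bij_betw h (whitehead_set H k n x) (whitehead_set H k n \<xi>)"
  proof -
    define h where "h B = ?j N (\<alpha> N (hom_inv H ?j N B))" for B
    have h: "h (?j N v) = ?j N (\<alpha> N v)" if "v \<in> carrier (piece H N)" for v
      using that by (simp add: h_def j_inv(3))
    have fwd: "\<exists>v\<in>carrier (piece H N). B = ?j N v \<and> ?j N (\<alpha> N v) \<in> whitehead_set H k n \<xi>"
      if "B \<in> whitehead_set H k n x" for B
      unfolding N_def by (rule H.whitehead_set_automorphism[OF \<alpha> _ wh_cycle_mem that]) (simp add: \<xi>_def)
    \<comment> \<open>The inverse automorphism sends \<xi> back to x and gives surjectivity.\<close>
    have bwd: "\<exists>u\<in>carrier (piece H N). B = ?j N u \<and> ?j N (hom_inv H \<alpha> N u) \<in> whitehead_set H k n x"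
      if "B \<in> whitehead_set H k n \<xi>" for B
      unfolding N_def by (rule H.whitehead_set_automorphism[OF \<alpha>_inv(1) _ wh_cycle_mem that])
        (simp add: \<xi>_def \<alpha>_inv(3) x)
    have j_inj: "u = v" if "?j N u = ?j N v" "u \<in> carrier (piece H N)" "v \<in> carrier (piece H N)" for u v
      using that H.homology_class_bij[of N] by (auto simp: bij_betw_def inj_on_def)
    have "bij_betw h (whitehead_set H k n x) (whitehead_set H k n \<xi>)"
    proof (rule bij_betwI')
      fix A B assume "A \<in> whitehead_set H k n x" "B \<in> whitehead_set H k n x"
      then obtain u v where uv: "u \<in> carrier (piece H N)" "v \<in> carrier (piece H N)" "A = ?j N u" "B = ?j N v"
        using fwd by metis
      have "\<alpha> N u \<in> carrier (piece H N)" "\<alpha> N v \<in> carrier (piece H N)"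
        using uv bij_betw_apply[OF \<alpha>_bij] by auto
      then have "h A = h B \<longleftrightarrow> \<alpha> N u = \<alpha> N v"
        using uv j_inj by (auto simp: h)
      also have "\<dots> \<longleftrightarrow> u = v" using uv \<alpha>_inv(3)[of _ N] by metis
      also have "\<dots> \<longleftrightarrow> A = B" using uv j_inj by auto
      finally show "h A = h B \<longleftrightarrow> A = B" .
    next
      fix A assume "A \<in> whitehead_set H k n x"
      then show "h A \<in> whitehead_set H k n \<xi>" using fwd[of A] h by auto
    next
      fix B assume "B \<in> whitehead_set H k n \<xi>"
      then obtain u where u: "u \<in> carrier (piece H N)" "B = ?j N u"
        and mem: "?j N (hom_inv H \<alpha> N u) \<in> whitehead_set H k n x"
        using bwd by blast
      have "hom_inv H \<alpha> N u \<in> carrier (piece H N)"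
        using \<alpha>_inv(2) u(1) by (rule bij_betw_apply)
      then have "B = h (?j N (hom_inv H \<alpha> N u))"
        using u by (simp add: h \<alpha>_inv(4))
      then show "\<exists>A\<in>whitehead_set H k n x. B = h A" using mem by blast
    qed
    then show ?thesis by blast
  qed
  ultimately have "\<exists>f. bij_betw f (whitehead_set L k n z) (whitehead_set H k n x)"
    by (meson bij_betw_inv_into bij_betw_trans)
  moreover have "\<zero>\<^bsub>piece H N\<^esub> \<in> whitehead_set L k n z" if "k \<ge> 3"
  proof -
    have "\<zero>\<^bsub>piece (homology H) N\<^esub> \<in> whitehead_set H k n \<xi>"
      unfolding N_def using that \<xi>
    proof (rule H.zero_mem_whitehead_set)
      show "whitehead_set H k n \<xi> \<noteq> {}" using image assms(5) by blast
    qed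
    then obtain A where A: "A \<in> whitehead_set L k n z" "\<theta> N A = \<zero>\<^bsub>piece (homology H) N\<^esub>"
      using image by (metis imageE)
    have "\<theta> N \<zero>\<^bsub>piece H N\<^esub> = \<zero>\<^bsub>piece (homology H) N\<^esub>"
    proof -
      \<comment> \<open>Zero is written as a differential, with which \<theta> commutes; both
        differentials vanish.\<close>
      have "\<theta> N (diff H (N + 1) \<zero>\<^bsub>piece H (N + 1)\<^esub>) = diff (homology H) (N + 1) (\<theta> (N + 1) \<zero>\<^bsub>piece H (N + 1)\<^esub>)"
        using \<theta> H.zero_mem[of "N + 1"] unfolding dgl_hom_def by (metis add_diff_cancel_right')
      then show ?thesis using H.diff_zero[OF H.zero_mem, of "N + 1"] by (simp add: H.homology_diff)
    qed
    moreover have "A \<in> carrier (piece H N)" using A(1) W_carrier by blast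
    ultimately have "A = \<zero>\<^bsub>piece H N\<^esub>"
      using inj_onD[OF \<theta>_inj _ _ H.zero_mem, of A] A(2) by simp
    then show ?thesis using A by simp
  qed
  ultimately show False
    using assms(6) by (auto simp: H_def N_def)
qed

end
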